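(* Let $\phi(x,y)=(u(x,y),v(x,y))$ be a pair of rational functions $u,v\in\mathbb{R}(x,y)$ which satisfies the projective translation equation $$(1-z)\,\phi(\mathbf{x})=\phi\Big(\phi(\mathbf{x}z)\,\frac{1-z}{z}\Big),\qquad \mathbf{x}=(x,y),$$ and the boundary condition $$\lim_{z\to 0}\frac{\phi(\mathbf{x}z)}{z}=\mathbf{x}.$$ Assume that $\phi(x,y)\neq(x,y)$. Then there exists an integer $N\ge 0$, uniquely determined by $\phi$ (called the level of $\phi$), such that $$\phi=\ell^{-1}\circ\phi_N\circ\ell$$ for some $1$-BIR $\ell$, where $$\phi_N(x,y)=\Big(x(y+1)^{N-1},\ \frac{y}{y+1}\Big).$$
   Context: The functional equation is understood as an identity of (pairs of) rational functions in the variables $x,y,z$ over $\mathbb{R}$, and the limit is understood for generic $\mathbf{x}$, i.e. as an identity of rational functions in $x,y$. A $1$-BIR is a birational transformation $\ell$ of the plane over $\mathbb{R}$ both of whose coordinates are homogeneous rational functions of degree $1$ in $(x,y)$. *)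

theory Defs
  imports "HOL-Computational_Algebra.Computational_Algebra" "HOL-Computational_Algebra.Field_as_Ring"
begin

text \<open>
  The fields \<open>\<real>(x,y)\<close> and \<open>\<real>(x,y,z)\<close> are the fraction fields of the iterated
  polynomial rings \<open>\<real>[x][y]\<close> and \<open>\<real>[x][y][z]\<close>; the innermost indeterminate is \<open>x\<close>.
\<close>

type_synonym rat2 = "real poly poly fract"
type_synonym rat3 = "real poly poly poly fract"
type_synonym rat_map = "rat2 \<times> rat2"

definition const2 :: "real \<Rightarrow> rat2" where "const2 c = to_fract [:[:c:]:]"
definition x2 :: rat2 where "x2 = to_fract [:[:0, 1:]:]"
definition y2 :: rat2 where "y2 = to_fract [:0, 1:]"

definition const3 :: "real \<Rightarrow> rat3" where "const3 c = to_fract [:[:[:c:]:]:]"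
definition x3 :: rat3 where "x3 = to_fract [:[:[:0, 1:]:]:]"
definition y3 :: rat3 where "y3 = to_fract [:[:0, 1:]:]"
definition z3 :: rat3 where "z3 = to_fract [:0, 1:]"

text \<open>
  Evaluation at a point \<open>(a, b)\<close> of a ring containing the reals through the embedding \<open>h\<close>
  (below: the identity of \<open>\<real>\<close>, \<open>const2\<close> or \<open>const3\<close>).
\<close>

definition bipoly :: "(real \<Rightarrow> 'a::comm_ring_1) \<Rightarrow> real poly poly \<Rightarrow> 'a \<Rightarrow> 'a \<Rightarrow> 'a" where
  "bipoly h p a b = poly (map_poly (\<lambda>q. poly (map_poly h q) a) p) b"

text \<open>
  A rational function is evaluated through its representation in lowest terms. It is defined
  at \<open>(a, b)\<close> iff the reduced denominator does not vanish there, which (as \<open>\<real>[x,y]\<close> is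
  factorial) holds iff some representation as a quotient has non-vanishing denominator there.
  Where \<open>rat_defined\<close> fails, the value of \<open>rat_eval\<close> is the meaningless \<open>0\<close>.
\<close>

definition rat_defined :: "(real \<Rightarrow> 'a::field) \<Rightarrow> rat2 \<Rightarrow> 'a \<Rightarrow> 'a \<Rightarrow> bool" where
  "rat_defined h f a b \<longleftrightarrow> bipoly h (snd (quot_of_fract f)) a b \<noteq> 0"

definition rat_eval :: "(real \<Rightarrow> 'a::field) \<Rightarrow> rat2 \<Rightarrow> 'a \<Rightarrow> 'a \<Rightarrow> 'a" where
  "rat_eval h f a b =
     bipoly h (fst (quot_of_fract f)) a b / bipoly h (snd (quot_of_fract f)) a b"

definition map_defined :: "(real \<Rightarrow> 'a::field) \<Rightarrow> rat_map \<Rightarrow> 'a \<times> 'a \<Rightarrow> bool" where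
  "map_defined h F p \<longleftrightarrow>
     rat_defined h (fst F) (fst p) (snd p) \<and> rat_defined h (snd F) (fst p) (snd p)"

definition map_eval :: "(real \<Rightarrow> 'a::field) \<Rightarrow> rat_map \<Rightarrow> 'a \<times> 'a \<Rightarrow> 'a \<times> 'a" where
  "map_eval h F p =
     (rat_eval h (fst F) (fst p) (snd p), rat_eval h (snd F) (fst p) (snd p))"

definition scale :: "'a::times \<Rightarrow> 'a \<times> 'a \<Rightarrow> 'a \<times> 'a" where
  "scale c p = (c * fst p, c * snd p)"

text \<open>
  Composition \<open>F \<circ> G\<close> is substitution of the pair \<open>G\<close> into \<open>F\<close>; it is meaningful when no
  reduced denominator of \<open>F\<close> becomes identically zero.
\<close>

definition composable :: "rat_map \<Rightarrow> rat_map \<Rightarrow> bool" where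
  "composable F G \<longleftrightarrow> map_defined const2 F G"

definition rat_comp :: "rat_map \<Rightarrow> rat_map \<Rightarrow> rat_map" where
  "rat_comp F G = map_eval const2 F G"

text \<open>
  The identity is one in \<open>\<real>(x,y,z)\<close>. The substitutions \<open>\<phi>(x,y)\<close> and \<open>\<phi>(xz,yz)\<close> are always
  defined, the outer substitution on the right-hand side need not be.
\<close>

definition translation_equation :: "rat_map \<Rightarrow> bool" where
  "translation_equation \<phi> \<longleftrightarrow>
     (let p = scale ((1 - z3) / z3) (map_eval const3 \<phi> (x3 * z3, y3 * z3))
      in map_defined const3 \<phi> p \<and>
         scale (1 - z3) (map_eval const3 \<phi> (x3, y3)) = map_eval const3 \<phi> p)"

text \<open>
  The limit is required at generic real points, i.e. off the zero set of some non-zero polynomial.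
\<close>

definition boundary_condition :: "rat_map \<Rightarrow> bool" where
  "boundary_condition \<phi> \<longleftrightarrow>
     (\<exists>d. d \<noteq> 0 \<and>
       (\<forall>a b. bipoly (\<lambda>c. c) d a b \<noteq> 0 \<longrightarrow>
          ((\<lambda>z::real. scale (1 / z) (map_eval (\<lambda>c. c) \<phi> (a * z, b * z))) \<longlongrightarrow> (a, b)) (at 0)))"

definition mutually_inverse :: "rat_map \<Rightarrow> rat_map \<Rightarrow> bool" where
  "mutually_inverse F G \<longleftrightarrow>
     composable F G \<and> rat_comp F G = (x2, y2) \<and>
     composable G F \<and> rat_comp G F = (x2, y2)"

definition birational :: "rat_map \<Rightarrow> bool" where
  "birational F \<longleftrightarrow> (\<exists>G. mutually_inverse F G)"

text \<open>The variable \<open>z\<close> serves as the scaling parameter: \<open>f(zx, zy) = z f(x, y)\<close>.\<close>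

definition homogeneous1 :: "rat2 \<Rightarrow> bool" where
  "homogeneous1 f \<longleftrightarrow>
     rat_eval const3 f (z3 * x3) (z3 * y3) = z3 * rat_eval const3 f x3 y3"

definition one_BIR :: "rat_map \<Rightarrow> bool" where
  "one_BIR \<l> \<longleftrightarrow> birational \<l> \<and> homogeneous1 (fst \<l>) \<and> homogeneous1 (snd \<l>)"

definition phi_level :: "nat \<Rightarrow> rat_map" where
  "phi_level N = (x2 * (y2 + 1) powi (int N - 1), y2 / (y2 + 1))"

definition has_level :: "rat_map \<Rightarrow> nat \<Rightarrow> bool" where
  "has_level \<phi> N \<longleftrightarrow>
     (\<exists>\<l> \<l>'. one_BIR \<l> \<and> mutually_inverse \<l> \<l>' \<and>
        composable (phi_level N) \<l> \<and> composable \<l>' (rat_comp (phi_level N) \<l>) \<and>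
        \<phi> = rat_comp \<l>' (rat_comp (phi_level N) \<l>))"

end

theory Submission
  imports Defs
begin

text \<open>
  In polar coordinates, the slope \<open>t = x / y\<close> and \<open>y\<close>, the translation equation says that
  \<open>\<phi>\<close> is the map at time \<open>1\<close> of a flow. Let \<open>h t q\<close> be the slope of \<open>\<phi>(tq, q)\<close> and \<open>V t q\<close> its second
  coordinate divided by \<open>q\<close>. Then
    \<open>h (h t a) (b * V t a) = h t (a + b)\<close> and \<open>V t a * V (h t a) (b * V t a) = V t (a + b)\<close>,
  and the boundary condition says that \<open>h t 0 = t\<close> and \<open>V t 0 = 1\<close>. The level \<open>N\<close> is the degree of
  \<open>h t q\<close> as a function of \<open>q\<close>.

  Along an orbit, \<open>R(a) = h t a\<close> is a rational function of the time \<open>a\<close> alone, whereas \<open>R(a + b)\<close> is a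
  rational function of \<open>R(a)\<close> and of \<open>b S(a)\<close>, where \<open>S\<close> is the velocity. So two complex
  times with the same slope differ by an affine change of time that preserves \<open>R\<close>, and such changes
  form a group that is transitive on the fibres of \<open>R\<close>. This forces \<open>R\<close> to be the \<open>N\<close>-th
  power of an affine function, up to a Moebius transformation \<open>M\<close>. Over the reals this idea takes an
  elementary form: after \<open>R\<close> is given a pole at infinity, the first two
  coefficients of the flow law at \<open>b = \<infinity>\<close> show that the \<open>N\<close>-th power of an affine function
  of \<open>a\<close> is a rational function of \<open>R(a)\<close> (\<open>flow_polynomial_orbit\<close>), and then comparison of
  poles and degrees shows that it is a Moebius transform of \<open>R(a)\<close>
  (\<open>polynomial_in_rational_function\<close>). The result, \<open>real_flow_normal_form\<close>, is
    \<open>M (h t q) = M t * (1 + q * w t)^N\<close> and \<open>V t q * w (h t q) = w t / (1 + q * w t)\<close>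
  with a rational function \<open>w\<close>. The case \<open>h t q = t\<close> is that of \<open>N = 0\<close>; it needs only the
  same two coefficients of the second law.

  The two identities state that the \<open>1\<close>-BIR with \<open>(x, y) \<mapsto> (y w(t) M(t), y w(t))\<close> conjugates \<open>\<phi>\<close> to
  the model map \<open>\<phi>\<^sub>N\<close> (\<open>level_exists\<close>). Conversely, any \<open>1\<close>-BIR acts on slopes by
  an invertible rational function, so that for two levels \<open>N\<close> and \<open>N'\<close>, an \<open>N'\<close>-th power of an affine
  function of \<open>q\<close> is a rational function of an \<open>N\<close>-th power. Hence \<open>N\<close> divides \<open>N'\<close>, and by symmetry
  they are equal (\<open>level_unique\<close>).

  All analysis takes place at real points. Identities of rational functions are moved there and back
  along generic points, where "generic" means off the zero set of a non-zero polynomial, or, in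
  polar coordinates, for all but finitely many \<open>t\<close> and then all but finitely many \<open>q\<close>.
\<close>

section \<open>Evaluation of polynomials and of fractions at generic real points\<close>

text \<open>
  The type of real numbers is an instance of the Euclidean rings here, with its division as the
  Euclidean one. These rewrite rules then split fractions that \<open>field_simps\<close> combines.
\<close>

declare div_mult_self1 [simp del] div_mult_self2 [simp del] div_mult_self3 [simp del]
  div_mult_self4 [simp del]

definition ring_map :: "('a::comm_ring_1 \<Rightarrow> 'b::comm_ring_1) \<Rightarrow> bool" where
  "ring_map h \<longleftrightarrow>
     h 1 = 1 \<and> (\<forall>x y. h (x + y) = h x + h y) \<and> (\<forall>x y. h (x * y) = h x * h y)"

lemma ring_map_1: "ring_map h \<Longrightarrow> h 1 = 1"
  and ring_map_add: "ring_map h \<Longrightarrow> h (x + y) = h x + h y"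
  and ring_map_mult: "ring_map h \<Longrightarrow> h (x * y) = h x * h y"
  by (auto simp: ring_map_def)

lemma ring_map_0: "ring_map h \<Longrightarrow> h 0 = 0"
  using ring_map_add[of h 0 0] by simp

lemma ring_map_uminus: "ring_map h \<Longrightarrow> h (- x) = - h x"
  using ring_map_add[of h x "- x"] ring_map_0[of h] by (simp add: eq_neg_iff_add_eq_0 add.commute)

lemma ring_map_diff: "ring_map h \<Longrightarrow> h (x - y) = h x - h y"
  using ring_map_add[of h x "- y"] ring_map_uminus[of h y] by simp

lemma ring_map_power: "ring_map h \<Longrightarrow> h (x ^ n) = h x ^ n"
  by (induction n) (simp_all add: ring_map_1 ring_map_mult)

lemmas ring_map_simps =
  ring_map_0 ring_map_1 ring_map_add ring_map_mult ring_map_uminus ring_map_diff ring_map_power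

lemma ring_map_id: "ring_map (\<lambda>x. x)"
  by (simp add: ring_map_def)

lemma ring_map_comp: "ring_map g \<Longrightarrow> ring_map h \<Longrightarrow> ring_map (\<lambda>x. g (h x))"
  by (simp add: ring_map_def)

lemma ring_map_pCons: "ring_map (\<lambda>c. [:c:])"
  by (simp add: ring_map_def one_pCons)

lemma ring_map_to_fract: "ring_map to_fract"
  by (simp add: ring_map_def)

lemma poly_map_poly_pCons:
  "ring_map h \<Longrightarrow> poly (map_poly h (pCons c p)) a = h c + a * poly (map_poly h p) a"
  by (simp add: map_poly_pCons ring_map_0)

lemma poly_map_poly_const: "ring_map h \<Longrightarrow> poly (map_poly h [:c:]) a = h c"
  by (simp add: map_poly_pCons ring_map_0)

lemma poly_map_poly_X: "ring_map h \<Longrightarrow> poly (map_poly h [:0, 1:]) a = a"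
  by (simp add: map_poly_pCons ring_map_simps)

lemma poly_map_poly_add:
  assumes h: "ring_map h"
  shows "poly (map_poly h (p + q)) a = poly (map_poly h p) a + poly (map_poly h q) a"
proof (induction p q rule: poly_induct2)
  case 0
  then show ?case by simp
next
  case (pCons c p d q)
  then show ?case
    by (simp add: poly_map_poly_pCons[OF h] ring_map_add[OF h] algebra_simps)
qed

lemma poly_map_poly_smult:
  assumes h: "ring_map h"
  shows "poly (map_poly h (smult c p)) a = h c * poly (map_poly h p) a"
  by (induction p)
    (simp_all add: poly_map_poly_pCons[OF h] ring_map_mult[OF h] algebra_simps)

lemma ring_map_poly:
  assumes h: "ring_map h"
  shows "ring_map (\<lambda>p. poly (map_poly h p) a)"
  unfolding ring_map_def
proof (intro conjI allI)
  show "poly (map_poly h 1) a = 1"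
    by (simp add: ring_map_1[OF h])
  show "poly (map_poly h (p + q)) a = poly (map_poly h p) a + poly (map_poly h q) a" for p q
    by (rule poly_map_poly_add[OF h])
  show "poly (map_poly h (p * q)) a = poly (map_poly h p) a * poly (map_poly h q) a" for p q
    by (induction p)
      (simp_all add: poly_map_poly_pCons[OF h] ring_map_0[OF h] algebra_simps
        poly_map_poly_add[OF h] poly_map_poly_smult[OF h])
qed

lemma ring_map_poly_comp:
  assumes g: "ring_map g" and h: "ring_map h"
  shows "g (poly (map_poly h p) a) = poly (map_poly (\<lambda>c. g (h c)) p) (g a)"
  by (induction p)
    (simp_all add: poly_map_poly_pCons[OF h] poly_map_poly_pCons[OF ring_map_comp[OF g h]]
      ring_map_simps[OF g])

lemma ring_map_bipoly: "ring_map h \<Longrightarrow> ring_map (\<lambda>p. bipoly h p a b)"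
  unfolding bipoly_def by (intro ring_map_poly)

lemma ring_map_bipoly_comp:
  assumes g: "ring_map g" and h: "ring_map h"
  shows "g (bipoly h p a b) = bipoly (\<lambda>c. g (h c)) p (g a) (g b)"
  unfolding bipoly_def
  by (simp add: ring_map_poly_comp[OF g ring_map_poly[OF h]] ring_map_poly_comp[OF g h])

lemma bipoly_const: "ring_map h \<Longrightarrow> bipoly h [:[:c:]:] a b = h c"
  and bipoly_X: "ring_map h \<Longrightarrow> bipoly h [:[:0, 1:]:] a b = a"
  and bipoly_Y: "ring_map h \<Longrightarrow> bipoly h [:0, 1:] a b = b"
  by (simp_all add: bipoly_def poly_map_poly_const poly_map_poly_X ring_map_poly)

lemma fract_cases:
  obtains n d where "f = to_fract n / to_fract d" "d \<noteq> 0"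
  by (cases f) (auto simp: Fract_conv_to_fract)

text \<open>
  Membership in the filter \<open>zariski\<close> below means truth off the zero set of a non-zero element, which
  is how "for generic real points" is made precise, in two and in three variables alike.
\<close>

locale evaluations =
  fixes ev :: "'p \<Rightarrow> 'd::idom \<Rightarrow> real"
  assumes ring_map_ev: "ring_map (ev p)"
    and separating: "d \<noteq> 0 \<Longrightarrow> \<exists>p. ev p d \<noteq> 0"
begin

definition zariski :: "'p filter" where
  "zariski = Abs_filter (\<lambda>P. \<exists>d. d \<noteq> 0 \<and> (\<forall>p. ev p d \<noteq> 0 \<longrightarrow> P p))"

lemma eventually_zariski:
  "eventually P zariski \<longleftrightarrow> (\<exists>d. d \<noteq> 0 \<and> (\<forall>p. ev p d \<noteq> 0 \<longrightarrow> P p))"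
  unfolding zariski_def
proof (rule eventually_Abs_filter, unfold_locales, goal_cases)
  case 1
  show ?case by (rule exI[of _ 1]) simp
next
  case (2 P Q)
  then obtain d e where "d \<noteq> 0" "e \<noteq> 0"
    "\<forall>p. ev p d \<noteq> 0 \<longrightarrow> P p" "\<forall>p. ev p e \<noteq> 0 \<longrightarrow> Q p" by blast
  then show ?case
    by (intro exI[of _ "d * e"]) (auto simp: ring_map_mult[OF ring_map_ev])
next
  case (3 P Q)
  then show ?case by blast
qed

lemma eventually_ev_neq_0: "d \<noteq> 0 \<Longrightarrow> eventually (\<lambda>p. ev p d \<noteq> 0) zariski"
  unfolding eventually_zariski by blast

text \<open>
  The value of a fraction at a point depends on the chosen quotient, and at bad points it is
  \<open>0\<close> by the convention for division. The relation \<open>rep f \<phi>\<close> ignores such points; it is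
  compatible with all field operations, without side conditions, since division by zero behaves
  in the same way in the field of fractions and in the reals.
\<close>

definition rep :: "'d fract \<Rightarrow> ('p \<Rightarrow> real) \<Rightarrow> bool" where
  "rep f \<phi> \<longleftrightarrow> (\<exists>n d. d \<noteq> 0 \<and> f = to_fract n / to_fract d \<and>
     eventually (\<lambda>p. \<phi> p = ev p n / ev p d) zariski)"

lemma rep_to_fract: "rep (to_fract n) (\<lambda>p. ev p n)"
  unfolding rep_def by (rule exI[of _ n], rule exI[of _ 1]) (simp add: ring_map_1[OF ring_map_ev])

lemma rep_add:
  assumes "rep f \<phi>" "rep g \<psi>"
  shows "rep (f + g) (\<lambda>p. \<phi> p + \<psi> p)"
proof -
  obtain n d m e where *: "d \<noteq> 0" "f = to_fract n / to_fract d" "e \<noteq> 0" "g = to_fract m / to_fract e"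
    and ev: "eventually (\<lambda>p. \<phi> p = ev p n / ev p d) zariski"
      "eventually (\<lambda>p. \<psi> p = ev p m / ev p e) zariski"
    using assms unfolding rep_def by blast
  have "eventually (\<lambda>p. \<phi> p + \<psi> p = ev p (n * e + m * d) / ev p (d * e)) zariski"
    using ev eventually_ev_neq_0[OF \<open>d \<noteq> 0\<close>] eventually_ev_neq_0[OF \<open>e \<noteq> 0\<close>]
    by eventually_elim (simp add: ring_map_simps[OF ring_map_ev] add_frac_eq)
  then show ?thesis
    unfolding rep_def using *
    by (intro exI[of _ "n * e + m * d"] exI[of _ "d * e"]) (simp add: add_frac_eq)
qed

lemma rep_mult:
  assumes "rep f \<phi>" "rep g \<psi>"
  shows "rep (f * g) (\<lambda>p. \<phi> p * \<psi> p)"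
proof -
  obtain n d m e where *: "d \<noteq> 0" "f = to_fract n / to_fract d" "e \<noteq> 0" "g = to_fract m / to_fract e"
    and ev: "eventually (\<lambda>p. \<phi> p = ev p n / ev p d) zariski"
      "eventually (\<lambda>p. \<psi> p = ev p m / ev p e) zariski"
    using assms unfolding rep_def by blast
  have "eventually (\<lambda>p. \<phi> p * \<psi> p = ev p (n * m) / ev p (d * e)) zariski"
    using ev by eventually_elim (simp add: ring_map_simps[OF ring_map_ev])
  then show ?thesis
    unfolding rep_def using *
    by (intro exI[of _ "n * m"] exI[of _ "d * e"]) simp
qed

lemma rep_uminus: 
  assumes "rep f \<phi>"
  shows "rep (- f) (\<lambda>p. - \<phi> p)"
  using rep_mult[OF rep_to_fract[of "- 1"] assms]
  by (simp add: ring_map_simps[OF ring_map_ev])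

lemma rep_diff:
  assumes "rep f \<phi>" "rep g \<psi>"
  shows "rep (f - g) (\<lambda>p. \<phi> p - \<psi> p)"
  using rep_add[OF assms(1) rep_uminus[OF assms(2)]] by simp

lemma rep_inverse:
  assumes "rep f \<phi>"
  shows "rep (inverse f) (\<lambda>p. inverse (\<phi> p))"
proof -
  obtain n d where *: "d \<noteq> 0" "f = to_fract n / to_fract d"
    and ev: "eventually (\<lambda>p. \<phi> p = ev p n / ev p d) zariski"
    using assms unfolding rep_def by blast
  show ?thesis
  proof (cases "n = 0")
    case True
    have "eventually (\<lambda>p. inverse (\<phi> p) = ev p 0) zariski"
      using ev by eventually_elim (simp add: True ring_map_0[OF ring_map_ev])
    then show ?thesis unfolding rep_def using * True
      by (intro exI[of _ 0] exI[of _ 1]) (simp add: ring_map_1[OF ring_map_ev])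
  next
    case False
    have "eventually (\<lambda>p. inverse (\<phi> p) = ev p d / ev p n) zariski"
      using ev by eventually_elim simp
    then show ?thesis unfolding rep_def using * False
      by (intro exI[of _ d] exI[of _ n]) simp
  qed
qed

lemma rep_divide:
  assumes "rep f \<phi>" "rep g \<psi>"
  shows "rep (f / g) (\<lambda>p. \<phi> p / \<psi> p)"
  using rep_mult[OF assms(1) rep_inverse[OF assms(2)]] by (simp add: divide_inverse)

lemma rep_1: "rep 1 (\<lambda>p. 1)"
  using rep_to_fract[of 1] by (simp add: ring_map_1[OF ring_map_ev])

lemma rep_power: "rep f \<phi> \<Longrightarrow> rep (f ^ n) (\<lambda>p. \<phi> p ^ n)"
  by (induction n) (simp_all add: rep_1 rep_mult)

lemma rep_neq_0:
  assumes "rep f \<phi>" "f \<noteq> 0"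
  shows "eventually (\<lambda>p. \<phi> p \<noteq> 0) zariski"
proof -
  obtain n d where *: "d \<noteq> 0" "f = to_fract n / to_fract d"
    and ev: "eventually (\<lambda>p. \<phi> p = ev p n / ev p d) zariski"
    using assms unfolding rep_def by blast
  have "n \<noteq> 0" using * assms(2) by auto
  show ?thesis
    using ev eventually_ev_neq_0[OF \<open>d \<noteq> 0\<close>] eventually_ev_neq_0[OF \<open>n \<noteq> 0\<close>]
    by eventually_elim simp
qed

lemma rep_eq_0:
  assumes "rep 0 \<phi>"
  shows "eventually (\<lambda>p. \<phi> p = 0) zariski"
proof -
  obtain n d where *: "d \<noteq> 0" "0 = to_fract n / to_fract d"
    and ev: "eventually (\<lambda>p. \<phi> p = ev p n / ev p d) zariski"
    using assms unfolding rep_def by blast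
  have "n = 0" using * by auto
  show ?thesis
    using ev by eventually_elim (simp add: \<open>n = 0\<close> ring_map_0[OF ring_map_ev])
qed

lemma rep_unique:
  assumes "rep f \<phi>" "rep f \<psi>"
  shows "eventually (\<lambda>p. \<phi> p = \<psi> p) zariski"
  using rep_eq_0[of "\<lambda>p. \<phi> p - \<psi> p"] rep_diff[OF assms] by simp

lemma rep_poly:
  assumes h: "ring_map h" and const: "\<And>c. rep (h c) (\<lambda>p. c)" and f: "rep f \<phi>"
  shows "rep (poly (map_poly h q) f) (\<lambda>p. poly q (\<phi> p))"
proof (induction q)
  case 0
  show ?case using const[of 0] by (simp add: ring_map_0[OF h])
next
  case (pCons c q)
  show ?case
    using rep_add[OF const[of c] rep_mult[OF f pCons.IH]]
    by (simp add: poly_map_poly_pCons[OF h])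
qed

lemma rep_bipoly:
  assumes h: "ring_map h" and const: "\<And>c. rep (h c) (\<lambda>p. c)"
    and f: "rep f \<phi>" and g: "rep g \<psi>"
  shows "rep (bipoly h q f g) (\<lambda>p. bipoly (\<lambda>c. c) q (\<phi> p) (\<psi> p))"
proof (induction q)
  case 0
  show ?case using const[of 0] by (simp add: bipoly_def ring_map_0[OF h])
next
  case (pCons c q)
  have hp: "ring_map (\<lambda>q. poly (map_poly h q) f)" by (rule ring_map_poly[OF h])
  show ?case
    using rep_add[OF rep_poly[OF h const f, of c] rep_mult[OF g pCons.IH]]
    by (simp add: bipoly_def poly_map_poly_pCons[OF hp] map_poly_pCons)
qed

lemma rep_rat_eval:
  assumes h: "ring_map h" and const: "\<And>c. rep (h c) (\<lambda>p. c)"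
    and f: "rep f \<phi>" and g: "rep g \<psi>"
  shows "rep (rat_eval h k f g) (\<lambda>p. rat_eval (\<lambda>c. c) k (\<phi> p) (\<psi> p))"
  unfolding rat_eval_def by (intro rep_divide rep_bipoly assms)

end

section \<open>Statements that hold for all but finitely many reals\<close>

lemma MOST_real_ex: "(MOST x::real. P x) \<Longrightarrow> \<exists>x. P x"
  using eventually_happens[of P cofinite] infinite_UNIV_char_0[where 'a = real] by auto

lemma MOST2_mono:
  assumes "MOST t. MOST a. P t a" "\<And>t a. P t a \<Longrightarrow> Q t a"
  shows "MOST t. MOST a. Q t a"
  using assms(1) by (rule eventually_mono) (erule eventually_mono, rule assms(2))

text \<open>
  Separate polynomiality in each variable is enough for all arguments about non-vanishing. It
  allows the quantifiers "for all but finitely many" to be nested in any order, and it avoids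
  rewriting polynomials in changed coordinates.
\<close>

definition polyfun :: "(real \<Rightarrow> real) \<Rightarrow> bool" where
  "polyfun f \<longleftrightarrow> (\<exists>p. \<forall>x. f x = poly p x)"

lemma polyfun_const [intro, simp]: "polyfun (\<lambda>x. c)"
  unfolding polyfun_def by (rule exI[of _ "[:c:]"]) simp

lemma polyfun_id [intro, simp]: "polyfun (\<lambda>x. x)"
  unfolding polyfun_def by (rule exI[of _ "[:0, 1:]"]) simp

lemma polyfun_add [intro]: "polyfun f \<Longrightarrow> polyfun g \<Longrightarrow> polyfun (\<lambda>x. f x + g x)"
  unfolding polyfun_def by (metis poly_add)

lemma polyfun_diff [intro]: "polyfun f \<Longrightarrow> polyfun g \<Longrightarrow> polyfun (\<lambda>x. f x - g x)"
  unfolding polyfun_def by (metis poly_diff)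

lemma polyfun_mult [intro]: "polyfun f \<Longrightarrow> polyfun g \<Longrightarrow> polyfun (\<lambda>x. f x * g x)"
  unfolding polyfun_def by (metis poly_mult)

lemma polyfun_power [intro]: "polyfun f \<Longrightarrow> polyfun (\<lambda>x. f x ^ n)"
  unfolding polyfun_def by (metis poly_power)

lemma polyfun_sum: "(\<And>i. i \<in> I \<Longrightarrow> polyfun (f i)) \<Longrightarrow> polyfun (\<lambda>x. \<Sum>i\<in>I. f i x)"
  by (induction I rule: infinite_finite_induct) auto

lemma polyfun_poly [intro]: "polyfun f \<Longrightarrow> polyfun (\<lambda>x. poly p (f x))"
  unfolding polyfun_def by (metis poly_pcompose)

abbreviation eval2 :: "real poly poly \<Rightarrow> real \<Rightarrow> real \<Rightarrow> real" where
  "eval2 \<equiv> bipoly (\<lambda>c. c)"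

lemma eval2_pCons: "eval2 (pCons q p) a b = poly q a + b * eval2 p a b"
  by (simp add: bipoly_def poly_map_poly_pCons[OF ring_map_poly[OF ring_map_id], simplified])

lemma eval2_0 [simp]: "eval2 0 a b = 0"
  by (simp add: bipoly_def)

lemma polyfun_eval2 [intro]: "polyfun f \<Longrightarrow> polyfun g \<Longrightarrow> polyfun (\<lambda>x. eval2 d (f x) (g x))"
  by (induction d) (auto simp: eval2_pCons)

lemmas polyfun_intros = polyfun_diff polyfun_mult polyfun_add polyfun_power polyfun_eval2
  polyfun_poly polyfun_id polyfun_const

lemma polyfun_MOST:
  assumes "polyfun f" "f x0 \<noteq> 0"
  shows "MOST x. f x \<noteq> 0"
proof -
  obtain p where p: "\<And>x. f x = poly p x" using assms(1) unfolding polyfun_def by blast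
  then have "p \<noteq> 0" using assms(2) by auto
  then show ?thesis unfolding eventually_cofinite using p poly_roots_finite by simp
qed

lemma polyfun_eq:
  assumes "polyfun f" "polyfun g" "MOST x. f x = g x"
  shows "f x = g x"
proof (rule ccontr)
  assume "f x \<noteq> g x"
  then have "MOST x. f x - g x \<noteq> 0"
    using assms(1,2) by (intro polyfun_MOST[of _ x]) auto
  then have "MOST x::real. False" using assms(3) by eventually_elim simp
  then show False using MOST_real_ex by blast
qed

lemma poly_MOST: "p \<noteq> 0 \<Longrightarrow> MOST x::real. poly p x \<noteq> 0"
  unfolding eventually_cofinite using poly_roots_finite by simp

lemma poly_eq_MOST:
  assumes "MOST x::real. poly p x = poly q x"
  shows "p = q"
proof -
  have "poly p x = poly q x" for x
    by (rule polyfun_eq[OF _ _ assms]) auto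
  then show ?thesis using poly_eq_poly_eq_iff by blast
qed

text \<open>
  One point where the function does not vanish suffices: first vary one variable through that
  point, then the other one.
\<close>

lemma MOST2_polyfun:
  assumes "\<And>y. polyfun (\<lambda>t. f t y)" "\<And>t. polyfun (f t)" "f t0 y0 \<noteq> 0"
  shows "MOST t. MOST y. f t y \<noteq> 0"
proof -
  have "MOST t. f t y0 \<noteq> 0" by (rule polyfun_MOST[OF assms(1,3)])
  then show ?thesis by eventually_elim (rule polyfun_MOST[OF assms(2)])
qed

lemma MOST3_polyfun:
  assumes "\<And>a b. polyfun (\<lambda>t. f t a b)" "\<And>t b. polyfun (\<lambda>a. f t a b)" "\<And>t a. polyfun (f t a)"
    "f t0 a0 b0 \<noteq> 0"
  shows "MOST t. MOST a. MOST b. f t a b \<noteq> 0"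
proof -
  have "MOST t. f t a0 b0 \<noteq> 0" by (rule polyfun_MOST[OF assms(1,4)])
  then show ?thesis by eventually_elim (rule MOST2_polyfun[OF assms(2,3)])
qed

lemma evaluations_real_poly: "evaluations (\<lambda>x d. poly d (x::real))"
  by unfold_locales (use poly_all_0_iff_0 in \<open>auto simp: ring_map_def\<close>)

text \<open>
  A non-zero polynomial has a non-zero leading coefficient; a point that separates this
  coefficient from \<open>0\<close> leaves a non-zero real polynomial in the last variable.
\<close>

lemma evaluations_poly:
  fixes ev :: "'a \<Rightarrow> 'b::idom \<Rightarrow> real"
  assumes "evaluations ev"
  shows "evaluations (\<lambda>p d. poly (map_poly (ev (fst p)) d) (snd p :: real))"
proof
  interpret evaluations ev by fact
  show "ring_map (\<lambda>d. poly (map_poly (ev (fst p)) d) (snd p :: real))" for p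
    by (intro ring_map_poly ring_map_ev)
  fix d :: "'b poly" assume "d \<noteq> 0"
  then obtain p where p: "ev p (lead_coeff d) \<noteq> 0" using separating[of "lead_coeff d"] by auto
  have "map_poly (ev p) d \<noteq> 0"
  proof
    assume "map_poly (ev p) d = 0"
    then have "coeff (map_poly (ev p) d) (degree d) = 0" by simp
    then show False using p by (simp add: coeff_map_poly ring_map_0[OF ring_map_ev])
  qed
  then obtain z where "poly (map_poly (ev p) d) z \<noteq> 0" using poly_all_0_iff_0 by blast
  then show "\<exists>p. poly (map_poly (ev (fst p)) d) (snd p) \<noteq> 0"
    by (intro exI[of _ "(p, z)"]) simp
qed

definition eval3 :: "real poly poly poly \<Rightarrow> real \<Rightarrow> real \<Rightarrow> real \<Rightarrow> real" where
  "eval3 d a b c = poly (map_poly (\<lambda>q. eval2 q a b) d) c"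

interpretation pts2: evaluations "\<lambda>p d. eval2 d (fst p) (snd p)"
  using evaluations_poly[OF evaluations_real_poly] by (simp add: bipoly_def)

interpretation pts3: evaluations "\<lambda>p d. eval3 d (fst (fst p)) (snd (fst p)) (snd p)"
  using evaluations_poly[OF pts2.evaluations_axioms] by (simp add: eval3_def)

lemma eval2_neq_0_ex: "d \<noteq> 0 \<Longrightarrow> \<exists>a b. b \<noteq> 0 \<and> eval2 d a b \<noteq> 0"
  using pts2.separating[of "[:0, 1:] * d"] by (auto simp: eval2_pCons)

lemma eval2_slices:
  assumes "d \<noteq> 0"
  shows "MOST t. MOST y. eval2 d (t * y) y \<noteq> 0" "MOST y. MOST t. eval2 d (t * y) y \<noteq> 0"
proof -
  obtain a b where "b \<noteq> 0" "eval2 d a b \<noteq> 0" using eval2_neq_0_ex assms by blast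
  then have "eval2 d (a / b * b) b \<noteq> 0" by simp
  note nz = this
  have 1: "polyfun (\<lambda>t. eval2 d (t * y) y)" "polyfun (\<lambda>y. eval2 d (t * y) y)" for t y
    by (intro polyfun_intros)+
  show "MOST t. MOST y. eval2 d (t * y) y \<noteq> 0"
    by (rule MOST2_polyfun[OF 1 nz])
  show "MOST y. MOST t. eval2 d (t * y) y \<noteq> 0"
    by (rule MOST2_polyfun[of "\<lambda>y t. eval2 d (t * y) y", OF 1(2,1) nz])
qed

text \<open>
  Polar coordinates: the slope \<open>t = x / y\<close> and the coordinate \<open>y\<close>. Homogeneous functions of
  degree \<open>0\<close> depend on \<open>t\<close> only. Both orders of the quantifiers are needed, because some maps
  respect the fibration by \<open>t\<close> and others the one by \<open>y\<close>.
\<close>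

lemma zariski2_slices:
  assumes "eventually P pts2.zariski"
  shows "MOST t. MOST y. P (t * y, y)" "MOST y. MOST t. P (t * y, y)"
proof -
  obtain d where d: "d \<noteq> 0" "\<And>p. eval2 d (fst p) (snd p) \<noteq> 0 \<Longrightarrow> P p"
    using assms unfolding pts2.eventually_zariski by blast
  show "MOST t. MOST y. P (t * y, y)"
    using eval2_slices(1)[OF d(1)] by (elim eventually_mono) (simp add: d(2))
  show "MOST y. MOST t. P (t * y, y)"
    using eval2_slices(2)[OF d(1)] by (elim eventually_mono) (simp add: d(2))
qed

text \<open>
  The coordinates \<open>x = t (a + b)\<close>, \<open>y = a + b\<close>, \<open>z = a / (a + b)\<close> turn the translation equation
  into the law of a flow with times \<open>a\<close> and \<open>b\<close>. The power of \<open>a + b\<close> in the proof clears the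
  denominators that the substitution for \<open>z\<close> introduces.
\<close>

lemma zariski3_slices:
  assumes "eventually P pts3.zariski"
  shows "MOST t. MOST a. MOST b. P ((t * (a + b), a + b), a / (a + b))"
proof -
  obtain d where d: "d \<noteq> 0"
      "\<And>p. eval3 d (fst (fst p)) (snd (fst p)) (snd p) \<noteq> 0 \<Longrightarrow> P p"
    using assms unfolding pts3.eventually_zariski by blast
  define k where "k = degree d"
  define f where "f t a b =
    (\<Sum>i\<le>k. eval2 (coeff d i) (t * (a + b)) (a + b) * (a ^ i * (a + b) ^ (k - i)))" for t a b
  have eval3: "eval3 d x y z = (\<Sum>i\<le>k. eval2 (coeff d i) x y * z ^ i)" for x y z
  proof -
    have "degree (map_poly (\<lambda>q. eval2 q x y) d) \<le> k" unfolding k_def by (rule map_poly_degree_leq)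
    then show ?thesis unfolding eval3_def poly_altdef
      by (intro sum.mono_neutral_cong_left) (auto simp: coeff_map_poly coeff_eq_0 intro!: le_degree)
  qed
  have f: "f t a b = (a + b) ^ k * eval3 d (t * (a + b)) (a + b) (a / (a + b))"
    if "a + b \<noteq> 0" for t a b
    unfolding f_def eval3 sum_distrib_left using that
    by (intro sum.cong) (auto simp: power_divide power_diff)
  have "\<exists>t a b. f t a b \<noteq> 0"
  proof -
    have "d * [:[:0, 1:]:] \<noteq> 0" using d(1) by simp
    from pts3.separating[OF this] obtain x y z where "eval3 (d * [:[:0, 1:]:]) x y z \<noteq> 0" by auto
    moreover have "eval3 [:[:0, 1:]:] x y z = y"
      by (simp add: eval3_def map_poly_pCons eval2_pCons)
    ultimately have y: "y \<noteq> 0" "eval3 d x y z \<noteq> 0"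
      using ring_map_mult[OF pts3.ring_map_ev[of "((x, y), z)"], of d "[:[:0, 1:]:]"]
      by auto
    then have "f (x / y) (y * z) (y - y * z) \<noteq> 0" by (subst f) auto
    then show ?thesis by blast
  qed
  then obtain t0 a0 b0 where "f t0 a0 b0 \<noteq> 0" by blast
  then have "MOST t. MOST a. MOST b. f t a b \<noteq> 0"
    by (intro MOST3_polyfun[of f]) (unfold f_def, (intro polyfun_sum polyfun_intros)+)
  moreover have "MOST b. P ((t * (a + b), a + b), a / (a + b))" if "MOST b. f t a b \<noteq> 0" for t a
  proof -
    have "MOST b. b \<noteq> - a" by simp
    with that show ?thesis by eventually_elim (rule d(2), auto simp: f)
  qed
  ultimately show ?thesis by (rule MOST2_mono)
qed

lemma eval2_cone:
  "\<exists>e. \<forall>t q. eval2 e t q = eval2 d (t * q) q"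
proof -
  let ?c = "\<lambda>c::real. [:[:c:]:]"
  have c: "ring_map ?c" using ring_map_comp[OF ring_map_pCons ring_map_pCons] .
  define e where "e = bipoly ?c d ([:[:0, 1:]:] * [:0, 1:]) [:0, 1:]"
  have "eval2 e t q = eval2 d (t * q) q" for t q
    unfolding e_def
    by (subst ring_map_bipoly_comp[OF ring_map_bipoly[OF ring_map_id] c])
      (simp del: mult_pCons_left mult_pCons_right add: ring_map_mult[OF ring_map_bipoly[OF ring_map_id]] bipoly_const[OF ring_map_id]
        bipoly_X[OF ring_map_id] bipoly_Y[OF ring_map_id])
  then show ?thesis by blast
qed

section \<open>Two coefficients at infinity and rational functions of one variable\<close>

text \<open>
  The ratio of the second to the leading coefficient, that is, minus the sum of the complex roots.
  The reflected polynomial makes it \<open>0\<close> for constants without a case distinction.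
\<close>

definition neg_root_sum :: "real poly \<Rightarrow> real" where
  "neg_root_sum p = coeff (reflect_poly p) 1 / lead_coeff p"

lemma neg_root_sum_const: "degree p = 0 \<Longrightarrow> neg_root_sum p = 0"
  by (simp add: neg_root_sum_def coeff_reflect_poly)

lemma neg_root_sum_pos: "degree p > 0 \<Longrightarrow> neg_root_sum p = coeff p (degree p - 1) / lead_coeff p"
  by (simp add: neg_root_sum_def coeff_reflect_poly)

lemma neg_root_sum_mult:
  assumes "p \<noteq> 0" "q \<noteq> 0"
  shows "neg_root_sum (p * q) = neg_root_sum p + neg_root_sum q"
proof -
  have "coeff (reflect_poly (p * q)) 1 =
      lead_coeff p * coeff (reflect_poly q) 1 + coeff (reflect_poly p) 1 * lead_coeff q"
    by (simp add: reflect_poly_mult coeff_mult)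
  moreover have "(a * c + d * b) / (a * b) = d / a + c / b" if "a \<noteq> 0" "b \<noteq> 0" for a b c d :: real
    using that by (simp add: field_simps)
  ultimately show ?thesis
    unfolding neg_root_sum_def lead_coeff_mult using assms by (metis leading_coeff_0_iff)
qed

lemma neg_root_sum_pcompose_shift:
  "p \<noteq> 0 \<Longrightarrow> neg_root_sum (p \<circ>\<^sub>p [:a, 1:]) = real (degree p) * a + neg_root_sum p"
proof (induction p)
  case 0
  then show ?case by simp
next
  case (pCons c p)
  show ?case
  proof (cases "degree p = 0")
    case True
    then obtain k where k: "p = [:k:]" using degree_eq_zeroE by blast
    show ?thesis
    proof (cases "k = 0")
      case True
      then show ?thesis using k by (simp add: neg_root_sum_const)
    next
      case False
      have eq: "pCons c p \<circ>\<^sub>p [:a, 1:] = [:c + a * k, k:]"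
        by (simp add: k pcompose_pCons algebra_simps)
      show ?thesis
        unfolding eq using False neg_root_sum_pos[of "[:c + a * k, k:]"] neg_root_sum_pos[of "pCons c p"]
        by (simp add: k add_divide_distrib)
    qed
  next
    case False
    then have p0: "p \<noteq> 0" by auto
    define r where "r = p \<circ>\<^sub>p [:a, 1:]"
    have dr: "degree r = degree p" by (simp add: r_def degree_pcompose)
    then have r0: "r \<noteq> 0" using False by auto
    have dg: "degree ([:a, 1:] * r) = Suc (degree p)"
      using r0 by (subst degree_mult_eq) (auto simp: dr)
    have comp: "pCons c p \<circ>\<^sub>p [:a, 1:] = [:c:] + [:a, 1:] * r"
      by (simp only: pcompose_pCons r_def)
    have deg: "degree ([:c:] + [:a, 1:] * r) = Suc (degree p)"
      using dg by (subst degree_add_eq_right) auto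
    have "neg_root_sum ([:c:] + [:a, 1:] * r) = neg_root_sum ([:a, 1:] * r)"
      using False dg deg by (subst (1 2) neg_root_sum_pos) (auto simp: coeff_pCons split: nat.split)
    also have "\<dots> = neg_root_sum [:a, 1:] + neg_root_sum r"
      by (rule neg_root_sum_mult) (use r0 in auto)
    also have "\<dots> = a + (real (degree p) * a + neg_root_sum p)"
      using pCons.IH[OF p0] by (simp add: r_def neg_root_sum_pos)
    also have "neg_root_sum p = neg_root_sum (pCons c p)"
      using False p0 by (auto simp: neg_root_sum_pos coeff_pCons split: nat.split)
    finally show ?thesis
      using p0 by (simp only: comp) (simp add: algebra_simps)
  qed
qed

lemma neg_root_sum_pcompose_scale:
  assumes "p \<noteq> 0" "s \<noteq> 0"
  shows "neg_root_sum (p \<circ>\<^sub>p [:0, s:]) = neg_root_sum p / s"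
proof (cases "degree p = 0")
  case True
  then show ?thesis by (simp add: neg_root_sum_const degree_pcompose)
next
  case False
  then obtain n where n: "degree p = Suc n" by (cases "degree p") auto
  have "degree (p \<circ>\<^sub>p [:0, s:]) = Suc n" by (simp add: n assms degree_pcompose)
  then have 1: "neg_root_sum (p \<circ>\<^sub>p [:0, s:]) = (s ^ n * coeff p n) / (s ^ Suc n * coeff p (Suc n))"
    using neg_root_sum_pos[of "p \<circ>\<^sub>p [:0, s:]"] by (simp only: coeff_pcompose_linear) simp
  have 2: "neg_root_sum p = coeff p n / coeff p (Suc n)"
    using neg_root_sum_pos[of p] n by simp
  show ?thesis unfolding 1 2 using assms(2) by simp
qed

lemma lead_coeff_pcompose_shift: "lead_coeff (p \<circ>\<^sub>p [:a, 1::real:]) = lead_coeff p"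
  using lead_coeff_comp[of "[:a, 1:]" p] by simp

lemma lead_coeff_pcompose_scale:
  "(s::real) \<noteq> 0 \<Longrightarrow> lead_coeff (p \<circ>\<^sub>p [:0, s:]) = lead_coeff p * s ^ degree p"
  using lead_coeff_comp[of "[:0, s:]" p] by simp

text \<open>
  The first two terms of the expansion at \<open>b = \<infinity>\<close> of an identity between rational functions. They
  are all that is used of the flow law along a single orbit.
\<close>

lemma asymptotics:
  assumes nz: "A \<noteq> 0" "B \<noteq> 0" "P \<noteq> 0" "Q \<noteq> 0" "s \<noteq> 0"
    and eq: "MOST b. poly A (b * s) * poly Q (a + b) = poly P (a + b) * poly B (b * s)"
  shows "degree A + degree Q = degree P + degree B"
    and "lead_coeff A * s ^ degree A * lead_coeff Q = lead_coeff P * (lead_coeff B * s ^ degree B)"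
    and "neg_root_sum A / s + (real (degree Q) * a + neg_root_sum Q) =
      real (degree P) * a + neg_root_sum P + neg_root_sum B / s"
proof -
  let ?s = "[:0, s:]" and ?a = "[:a, 1:]"
  have e: "(A \<circ>\<^sub>p ?s) * (Q \<circ>\<^sub>p ?a) = (P \<circ>\<^sub>p ?a) * (B \<circ>\<^sub>p ?s)"
    by (rule poly_eq_MOST) (use eq in \<open>simp add: poly_pcompose\<close>)
  have n: "A \<circ>\<^sub>p ?s \<noteq> 0" "Q \<circ>\<^sub>p ?a \<noteq> 0" "P \<circ>\<^sub>p ?a \<noteq> 0" "B \<circ>\<^sub>p ?s \<noteq> 0"
    using nz by (auto simp: pcompose_eq_0_iff)
  show "degree A + degree Q = degree P + degree B"
    using arg_cong[OF e, of degree] nz(5)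
    by (simp only: degree_mult_eq n not_False_eq_True degree_pcompose) simp
  show "lead_coeff A * s ^ degree A * lead_coeff Q = lead_coeff P * (lead_coeff B * s ^ degree B)"
    using arg_cong[OF e, of lead_coeff]
    by (simp only: lead_coeff_mult lead_coeff_pcompose_shift lead_coeff_pcompose_scale[OF nz(5)])
  show "neg_root_sum A / s + (real (degree Q) * a + neg_root_sum Q) =
      real (degree P) * a + neg_root_sum P + neg_root_sum B / s"
    using arg_cong[OF e, of neg_root_sum]
    by (simp only: neg_root_sum_mult n neg_root_sum_pcompose_shift nz neg_root_sum_pcompose_scale not_False_eq_True)
qed

lemma MOST_compose:
  assumes "\<And>c. MOST a. f a \<noteq> c" "MOST x. P x"
  shows "MOST a. P (f a)"
proof -
  have "finite {x. \<not> P x}" using assms(2) by (simp add: eventually_cofinite)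
  then have "MOST a. \<forall>c\<in>{x. \<not> P x}. f a \<noteq> c"
    using assms(1) by (subst eventually_ball_finite_distrib) auto
  then show ?thesis by eventually_elim auto
qed

lemma MOST_shift: "(MOST x. P x) \<Longrightarrow> MOST b::real. P (a + b)"
  by (rule MOST_compose[rotated]) (auto simp: add.commute[of a] eq_diff_eq[symmetric])

lemma MOST_scale: "(MOST x. P x) \<Longrightarrow> s \<noteq> 0 \<Longrightarrow> MOST b::real. P (b * s)"
  by (rule MOST_compose[rotated]) (auto simp: nonzero_eq_divide_eq[symmetric])

text \<open>
  \<open>H\<close> is the numerator of \<open>X(P/Q)\<close>. As \<open>P\<close> has larger degree than \<open>Q\<close>, the power of \<open>P\<close> that comes
  from the leading term of \<open>X\<close> dominates, and it is the only term not divisible by \<open>Q\<close>.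
\<close>

lemma homogenization_ex:
  fixes P Q X :: "real poly"
  assumes deg: "degree Q < degree P" and "X \<noteq> 0"
  shows "\<exists>H U. H \<noteq> 0 \<and> degree H = degree X * degree P \<and>
    H = smult (lead_coeff X) (P ^ degree X) + Q * U \<and>
    (\<forall>a. poly Q a \<noteq> 0 \<longrightarrow> poly H a = poly Q a ^ degree X * poly X (poly P a / poly Q a))"
  using \<open>X \<noteq> 0\<close>
proof (induction X)
  case 0
  then show ?case by simp
next
  case (pCons c X)
  show ?case
  proof (cases "X = 0")
    case True
    then show ?thesis using pCons by (intro exI[of _ "[:c:]"] exI[of _ 0]) auto
  next
    case False
    then obtain H U where H: "H \<noteq> 0" "degree H = degree X * degree P"
        "H = smult (lead_coeff X) (P ^ degree X) + Q * U"
        "\<And>a. poly Q a \<noteq> 0 \<Longrightarrow> poly H a = poly Q a ^ degree X * poly X (poly P a / poly Q a)"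
      using pCons by blast
    define k where "k = degree X"
    define G where "G = smult c (Q ^ Suc k) + P * H"
    have P0: "P \<noteq> 0" using deg by auto
    have dPH: "degree (P * H) = Suc k * degree P"
      using P0 H by (simp add: degree_mult_eq k_def)
    have "degree (smult c (Q ^ Suc k)) \<le> Suc k * degree Q"
      using degree_power_le[of Q "Suc k"] by (simp add: mult.commute)
    also have "\<dots> < Suc k * degree P" using deg by (intro mult_strict_left_mono) auto
    finally have dG: "degree G = Suc k * degree P"
      unfolding G_def using dPH by (subst degree_add_eq_right) simp_all
    show ?thesis
    proof (rule exI[of _ G], rule exI[of _ "smult c (Q ^ k) + P * U"], intro conjI allI impI)
      show "G \<noteq> 0" using dG deg by auto
      show "degree G = degree (pCons c X) * degree P" using False dG by (simp add: k_def)
      show "G = smult (lead_coeff (pCons c X)) (P ^ degree (pCons c X)) + Q * (smult c (Q ^ k) + P * U)"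
        unfolding G_def using False by (subst H(3)) (simp add: k_def algebra_simps)
      show "poly G a = poly Q a ^ degree (pCons c X) * poly (pCons c X) (poly P a / poly Q a)"
        if "poly Q a \<noteq> 0" for a
        using False that by (simp add: G_def H(4) k_def field_simps)
    qed
  qed
qed

text \<open>
  Let \<open>R = P/Q\<close> have a pole at infinity. If a non-constant polynomial is a rational function of \<open>R\<close>,
  then \<open>R\<close> cannot have another pole, as such a pole would be one of the polynomial, too. Comparison of
  degrees then shows that a polynomial whose degree is the order of the pole of \<open>R\<close> at infinity
  depends on \<open>R\<close> in an affine way. In the application this polynomial is a power of a linear one,
  so \<open>R\<close> is essentially a power.
\<close>

lemma polynomial_in_rational_function:
  fixes P Q X Y g :: "real poly"
  assumes cop: "coprime P Q" and deg: "degree Q < degree P" and Q0: "Q \<noteq> 0"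
    and dg: "degree g = degree P - degree Q" and Y0: "Y \<noteq> 0"
    and eq: "MOST a. poly g a * poly Y (poly P a / poly Q a) = poly X (poly P a / poly Q a)"
  shows "degree Q = 0 \<and> (\<exists>\<alpha> \<beta>. \<alpha> \<noteq> 0 \<and> (\<forall>a. poly g a = \<alpha> * (poly P a / poly Q a) + \<beta>))"
proof -
  define k where "k = degree Y"
  define l where "l = degree X"
  obtain HY UY :: "real poly" where HY: "HY \<noteq> 0" "degree HY = k * degree P"
      "\<And>a. poly Q a \<noteq> 0 \<Longrightarrow> poly HY a = poly Q a ^ k * poly Y (poly P a / poly Q a)"
    using homogenization_ex[OF deg Y0] unfolding k_def by blast
  have g0: "g \<noteq> 0" using dg deg by auto
  have X0: "X \<noteq> 0"
  proof
    assume [simp]: "X = 0"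
    have "MOST a. poly (g * HY) a = poly 0 a"
      using eq poly_MOST[OF Q0] by eventually_elim (auto simp: HY(3))
    then have "g * HY = 0" by (rule poly_eq_MOST)
    then show False using g0 HY by simp
  qed
  obtain HX UX where HX: "HX \<noteq> 0" "degree HX = l * degree P"
      "HX = smult (lead_coeff X) (P ^ l) + Q * UX"
      "\<And>a. poly Q a \<noteq> 0 \<Longrightarrow> poly HX a = poly Q a ^ l * poly X (poly P a / poly Q a)"
    using homogenization_ex[OF deg X0] unfolding l_def by blast
  have "g * HY * Q ^ l = HX * Q ^ k"
  proof (rule poly_eq_MOST)
    show "MOST a. poly (g * HY * Q ^ l) a = poly (HX * Q ^ k) a"
      using eq poly_MOST[OF Q0] by eventually_elim (simp add: HY(3) HX(4))
  qed
  note H = this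
  define m where "m = degree P - degree Q"
  have P: "degree P = m + degree Q" and m: "m > 0" using deg by (auto simp: m_def)
  have "degree g + k * degree P + l * degree Q = l * degree P + k * degree Q"
    using arg_cong[OF H, of degree] g0 HY HX Q0 by (simp add: degree_mult_eq degree_power_eq)
  then have "m * (k + 1) = m * l" using dg unfolding m_def[symmetric] P by (simp add: algebra_simps)
  then have l: "l = Suc k" using m by (metis Suc_eq_plus1 mult_cancel1 not_gr_zero)
  have "g * HY * Q = HX"
    using H Q0 unfolding l by (simp add: mult.assoc[symmetric])
  then have "Q dvd HX" by (metis dvd_triv_right)
  then have "Q dvd smult (lead_coeff X) (P ^ l)"
    unfolding HX(3) by (metis dvd_add_left_iff dvd_triv_left)
  then have "Q dvd P ^ l" using X0 by (simp add: dvd_smult_iff)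
  moreover have "coprime Q (P ^ l)" using cop by (simp add: coprime_commute)
  ultimately have "is_unit Q" by (metis coprime_common_divisor dvd_refl)
  then have Qd: "degree Q = 0" by (simp add: is_unit_iff_degree Q0)
  then obtain q where q: "Q = [:q:]" using degree_eq_zeroE by blast
  have q0: "q \<noteq> 0" using q Q0 by auto
  define R where "R = smult (1 / q) P"
  have dR: "degree R = degree P" using q0 by (simp add: R_def)
  have R: "poly R a = poly P a / poly Q a" for a by (simp add: R_def q)
  have comp: "g * (Y \<circ>\<^sub>p R) = X \<circ>\<^sub>p R"
    by (rule poly_eq_MOST) (use eq in \<open>simp add: poly_pcompose R\<close>)
  define D where "D = X div Y"
  define Z where "Z = X mod Y"
  have XDZ: "X = D * Y + Z" by (simp add: D_def Z_def)
  have e: "(g - D \<circ>\<^sub>p R) * (Y \<circ>\<^sub>p R) = Z \<circ>\<^sub>p R"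
    using comp by (simp add: XDZ pcompose_add pcompose_mult algebra_simps)
  have gD: "g = D \<circ>\<^sub>p R"
  proof (rule ccontr)
    assume ne: "g \<noteq> D \<circ>\<^sub>p R"
    have "Y \<circ>\<^sub>p R \<noteq> 0" using Y0 dR deg by (subst pcompose_eq_0_iff) auto
    with ne have "Z \<circ>\<^sub>p R \<noteq> 0" using e by (metis mult_eq_0_iff right_minus_eq)
    then have "Z \<noteq> 0" by auto
    then have "degree Z < degree Y" unfolding Z_def using degree_mod_less[OF Y0, of X] by auto
    have "degree (Y \<circ>\<^sub>p R) \<le> degree ((g - D \<circ>\<^sub>p R) * (Y \<circ>\<^sub>p R))"
      using ne \<open>Y \<circ>\<^sub>p R \<noteq> 0\<close> by (subst degree_mult_eq) auto
    then have "degree Y * degree P \<le> degree Z * degree P"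
      unfolding e by (simp add: dR degree_pcompose)
    then show False using \<open>degree Z < degree Y\<close> deg by simp
  qed
  have "degree D * degree P = degree P"
    using arg_cong[OF gD, of degree] dg Qd by (auto simp: dR degree_pcompose)
  then have "degree D = 1" using deg by simp
  then have "D = [:coeff D 0, coeff D 1:]"
    by (auto intro!: poly_eqI simp: coeff_pCons coeff_eq_0 split: nat.split)
  moreover have "coeff D 1 \<noteq> 0"
    using \<open>degree D = 1\<close> by (metis leading_coeff_0_iff degree_0 zero_neq_one)
  ultimately obtain \<alpha> \<beta> where D: "D = [:\<beta>, \<alpha>:]" "\<alpha> \<noteq> 0" by blast
  have "poly g a = \<alpha> * (poly P a / poly Q a) + \<beta>" for a
    unfolding gD by (simp add: poly_pcompose D R)
  then show ?thesis using Qd D by blast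
qed

text \<open>
  A rational function of \<open>R\<close> is one of \<open>1 / (R - r)\<close>. This allows a pole of \<open>R\<close> to be moved to
  infinity.
\<close>

lemma rational_function_reparametrize:
  fixes X Y :: "real poly"
  assumes Y: "Y \<noteq> 0" and r: "MOST a. R a \<noteq> r"
    and eq: "MOST a. f a * poly Y (R a) = poly X (R a)"
  shows "\<exists>X' Y'. Y' \<noteq> 0 \<and> (MOST a. f a * poly Y' (1 / (R a - r)) = poly X' (1 / (R a - r)))"
proof -
  define k where "k = degree X"
  define l where "l = degree Y"
  define X' where "X' = reflect_poly (X \<circ>\<^sub>p [:r, 1:]) * [:0, 1:] ^ l"
  define Y' where "Y' = reflect_poly (Y \<circ>\<^sub>p [:r, 1:]) * [:0, 1:] ^ k"
  have "Y' \<noteq> 0"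
    unfolding Y'_def using Y by (auto simp: pcompose_eq_0_iff)
  moreover have "MOST a. f a * poly Y' (1 / (R a - r)) = poly X' (1 / (R a - r))"
    using r eq
  proof eventually_elim
    case (elim a)
    then have "poly X' (1 / (R a - r)) = (1 / (R a - r)) ^ (k + l) * poly X (R a)"
      and "poly Y' (1 / (R a - r)) = (1 / (R a - r)) ^ (k + l) * poly Y (R a)"
      by (simp_all add: X'_def Y'_def poly_reflect_poly_nz poly_pcompose k_def l_def power_add degree_pcompose)
    then show ?case using elim(2) by (simp add: algebra_simps)
  qed
  ultimately show ?thesis by blast
qed

section \<open>Orbits of a rational flow\<close>

definition slice :: "real poly poly \<Rightarrow> real \<Rightarrow> real poly" where
  "slice A t = map_poly (\<lambda>p. poly p t) A"

lemma poly_slice: "poly (slice A t) q = eval2 A t q"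
  by (simp add: slice_def bipoly_def)

lemma coeff_slice: "coeff (slice A t) i = poly (coeff A i) t"
  by (simp add: slice_def coeff_map_poly)

lemma slice_generic:
  assumes "poly (lead_coeff A) t \<noteq> 0"
  shows "degree (slice A t) = degree A" "slice A t \<noteq> 0"
    "neg_root_sum (slice A t) = poly (coeff (reflect_poly A) 1) t / poly (lead_coeff A) t"
proof -
  have "degree (slice A t) \<le> degree A" unfolding slice_def by (rule map_poly_degree_leq)
  moreover have "degree A \<le> degree (slice A t)"
    using assms by (intro le_degree) (simp add: coeff_slice)
  ultimately show deg: "degree (slice A t) = degree A" by simp
  show "slice A t \<noteq> 0" using assms coeff_slice[of A t "degree A"] by auto
  show "neg_root_sum (slice A t) = poly (coeff (reflect_poly A) 1) t / poly (lead_coeff A) t"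
    by (simp add: neg_root_sum_def deg coeff_slice coeff_reflect_poly)
qed

lemma eval2_mult: "eval2 (p * q) a b = eval2 p a b * eval2 q a b"
  and eval2_diff: "eval2 (p - q) a b = eval2 p a b - eval2 q a b"
  by (simp_all add: ring_map_simps[OF ring_map_bipoly[OF ring_map_id]])

lemma eval2_smult: "eval2 (smult c p) a b = poly c a * eval2 p a b"
  by (induction p) (simp_all add: eval2_pCons algebra_simps)

text \<open>
  \<open>R\<close> is the slope along one orbit and \<open>S\<close> the velocity. A Moebius transform \<open>P/Q\<close> of \<open>R\<close> has a pole
  at infinity, and \<open>A/B\<close> is the transformed slope as a function of the initial slope and of the
  distance, so that the flow law is \<open>(A/B)(R(a), b S(a)) = (P/Q)(a + b)\<close>. By its first two coefficients
  at \<open>b = \<infinity>\<close>, both \<open>S(a)\<^sup>d\<close> and \<open>S(a) \<delta>(a)\<close> are rational functions of \<open>R(a)\<close>, where \<open>d\<close> is the order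
  of the pole and \<open>\<delta>\<close> is a linear polynomial with leading coefficient \<open>d\<close>.
  Hence so is \<open>\<delta>\<^sup>d\<close>, and this polynomial of degree \<open>d\<close> is an affine function of \<open>P/Q\<close>.
\<close>

lemma flow_polynomial_orbit:
  fixes A B :: "real poly poly" and P Q :: "real poly" and R S :: "real \<Rightarrow> real"
  assumes A0: "A \<noteq> 0" and B0: "B \<noteq> 0" and cop: "coprime P Q" and deg: "degree Q < degree P"
    and Q0: "Q \<noteq> 0" and R: "\<And>c. MOST a. R a \<noteq> c" and S: "MOST a. S a \<noteq> 0"
    and flow: "MOST a. MOST b. eval2 A (R a) (b * S a) * poly Q (a + b) =
      poly P (a + b) * eval2 B (R a) (b * S a)"
    and param: "\<And>f X Y. Y \<noteq> 0 \<Longrightarrow> MOST a. f a * poly Y (R a) = poly X (R a) \<Longrightarrow>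
      \<exists>X' Y'. Y' \<noteq> 0 \<and>
        (MOST a. f a * poly Y' (poly P a / poly Q a) = poly X' (poly P a / poly Q a))"
  shows "\<exists>N \<alpha> \<beta> wn wd. N > 0 \<and> \<alpha> \<noteq> 0 \<and> wn \<noteq> 0 \<and> wd \<noteq> 0 \<and>
    (MOST a. MOST q. eval2 B (R a) q \<noteq> 0 \<and>
      \<alpha> * (eval2 A (R a) q / eval2 B (R a) q) + \<beta> =
      (\<alpha> * (poly P a / poly Q a) + \<beta>) * (1 + q * (poly wn (R a) / poly wd (R a))) ^ N)"
proof -
  define a0 a1 where "a0 = lead_coeff A" and "a1 = coeff (reflect_poly A) 1"
  define b0 b1 where "b0 = lead_coeff B" and "b1 = coeff (reflect_poly B) 1"
  define d where "d = degree P - degree Q"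
  \<comment> \<open>the leading coefficient of \<open>P/Q\<close> at infinity\<close>
  define c where "c = lead_coeff P / lead_coeff Q"
  define \<delta> where "\<delta> = [:neg_root_sum P - neg_root_sum Q, real d:]"
  have P0: "P \<noteq> 0" using deg by auto
  have d: "d > 0" "degree P = d + degree Q" using deg by (auto simp: d_def)
  have c0: "c \<noteq> 0" using P0 Q0 by (simp add: c_def)
  have nz: "MOST a. poly a0 (R a) \<noteq> 0 \<and> poly b0 (R a) \<noteq> 0"
    using A0 B0 by (intro MOST_compose[OF R] MOST_conjI poly_MOST) (auto simp: a0_def b0_def)
  have \<delta>0: "\<delta> \<noteq> 0" and d\<delta>: "degree \<delta> = 1" using d by (auto simp: \<delta>_def)
  have asym: "MOST a. poly a0 (R a) * S a ^ d = c * poly b0 (R a) \<and>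
      poly (a1 * b0 - b1 * a0) (R a) = poly (a0 * b0) (R a) * (S a * poly \<delta> a)"
    using nz S flow
  proof eventually_elim
    case (elim a)
    let ?A = "slice A (R a)" and ?B = "slice B (R a)"
    have sA: "degree ?A = degree A" "?A \<noteq> 0" "neg_root_sum ?A = poly a1 (R a) / poly a0 (R a)"
      using slice_generic[of A "R a"] elim(1) by (auto simp: a0_def a1_def)
    have sB: "degree ?B = degree B" "?B \<noteq> 0" "neg_root_sum ?B = poly b1 (R a) / poly b0 (R a)"
      using slice_generic[of B "R a"] elim(1) by (auto simp: b0_def b1_def)
    have lc: "lead_coeff ?A = poly a0 (R a)" "lead_coeff ?B = poly b0 (R a)"
      by (simp_all add: sA sB coeff_slice a0_def b0_def)
    have "MOST b. poly ?A (b * S a) * poly Q (a + b) = poly P (a + b) * poly ?B (b * S a)"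
      using elim(3) by (simp add: poly_slice)
    note as = asymptotics[OF sA(2) sB(2) P0 Q0 elim(2) this]
    have dd: "degree A = d + degree B" using as(1) d by (simp add: sA sB)
    have 1: "poly a0 (R a) * S a ^ d = c * poly b0 (R a)"
      using as(2) Q0 elim(2) unfolding lc unfolding sA sB dd c_def
      by (simp add: power_add field_simps)
    have "neg_root_sum ?A - neg_root_sum ?B = S a * poly \<delta> a"
      using as(3) elim(2) d(2) by (simp add: \<delta>_def field_simps)
    then have 2: "poly (a1 * b0 - b1 * a0) (R a) = poly (a0 * b0) (R a) * (S a * poly \<delta> a)"
      using elim(1) unfolding sA sB by (simp add: field_simps)
    from 1 2 show ?case ..
  qed
  define Y where "Y = smult c ((a0 * b0) ^ d * b0)"
  define X where "X = (a1 * b0 - b1 * a0) ^ d * a0"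
  have Y0: "Y \<noteq> 0" using A0 B0 c0 by (simp add: Y_def a0_def b0_def)
  have "MOST a. poly (\<delta> ^ d) a * poly Y (R a) = poly X (R a)"
    using asym
  proof eventually_elim
    case (elim a)
    have "poly X (R a) = poly (a1 * b0 - b1 * a0) (R a) ^ d * poly a0 (R a)"
      by (simp add: X_def)
    also have "\<dots> = poly (a0 * b0) (R a) ^ d * poly \<delta> a ^ d * (poly a0 (R a) * S a ^ d)"
      unfolding elim[THEN conjunct2] by (simp add: power_mult_distrib)
    also have "\<dots> = poly (\<delta> ^ d) a * poly Y (R a)"
      unfolding elim[THEN conjunct1] by (simp add: Y_def)
    finally show ?case by simp
  qed
  from param[OF Y0 this] obtain X' Y' where Y': "Y' \<noteq> 0" and
    XY: "MOST a. poly (\<delta> ^ d) a * poly Y' (poly P a / poly Q a) = poly X' (poly P a / poly Q a)"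
    by blast
  have "degree (\<delta> ^ d) = degree P - degree Q"
    using d\<delta> \<delta>0 by (simp add: degree_power_eq d_def)
  from polynomial_in_rational_function[OF cop deg Q0 this Y' XY]
  obtain \<alpha> \<beta> where Qd: "degree Q = 0" and \<alpha>: "\<alpha> \<noteq> 0"
      and \<alpha>\<beta>: "\<And>a. poly (\<delta> ^ d) a = \<alpha> * (poly P a / poly Q a) + \<beta>"
    by blast
  define wn where "wn = smult (real d) (a0 * b0)"
  define wd where "wd = a1 * b0 - b1 * a0"
  have "wd \<noteq> 0"
  proof
    assume [simp]: "wd = 0"
    have "MOST a::real. False"
      using nz asym S poly_MOST[OF \<delta>0]
      by eventually_elim (simp add: wd_def[symmetric])
    then show False by (simp add: infinite_UNIV_char_0)
  qed
  moreover have "wn \<noteq> 0" using d A0 B0 by (simp add: wn_def a0_def b0_def)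
  moreover have "MOST a. MOST q. eval2 B (R a) q \<noteq> 0 \<and>
      \<alpha> * (eval2 A (R a) q / eval2 B (R a) q) + \<beta> =
      (\<alpha> * (poly P a / poly Q a) + \<beta>) * (1 + q * (poly wn (R a) / poly wd (R a))) ^ d"
    using nz S flow asym poly_MOST[OF \<delta>0]
  proof eventually_elim
    case (elim a)
    have w: "poly wn (R a) / poly wd (R a) = real d / (S a * poly \<delta> a)"
      using elim by (simp add: wn_def wd_def)
    have "slice B (R a) \<noteq> 0" using slice_generic(2) elim(1) unfolding b0_def by blast
    then have B: "MOST q. eval2 B (R a) q \<noteq> 0" using poly_MOST by (simp add: poly_slice[symmetric])
    have "MOST q. q / S a \<noteq> b" for b
      using elim(2) by (auto simp: field_simps)
    from MOST_compose[OF this elim(3)]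
    have "MOST q. eval2 A (R a) q * poly Q (a + q / S a) = poly P (a + q / S a) * eval2 B (R a) q"
      using elim(2) by simp
    with B show ?case
    proof eventually_elim
      case (elim q)
      have "poly Q (a + q / S a) \<noteq> 0" using Qd Q0 by (metis degree_eq_zeroE poly_const_conv pCons_0_0)
      then have "eval2 A (R a) q / eval2 B (R a) q = poly P (a + q / S a) / poly Q (a + q / S a)"
        using elim by (simp add: field_simps)
      then have "\<alpha> * (eval2 A (R a) q / eval2 B (R a) q) + \<beta> = poly \<delta> (a + q / S a) ^ d"
        using \<alpha>\<beta>[of "a + q / S a"] by simp
      also have "poly \<delta> (a + q / S a) =
          poly \<delta> a * (1 + q * (poly wn (R a) / poly wd (R a)))"
        unfolding w using \<open>S a \<noteq> 0\<close> \<open>poly \<delta> a \<noteq> 0\<close>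
      proof -
        have "poly \<delta> (a + q / S a) = poly \<delta> a + q * (real d / S a)"
          by (simp add: \<delta>_def algebra_simps)
        then show "poly \<delta> (a + q / S a) = poly \<delta> a * (1 + q * (real d / (S a * poly \<delta> a)))"
          using \<open>poly \<delta> a \<noteq> 0\<close> by (simp add: distrib_left)
      qed
      also have "\<dots> ^ d = (\<alpha> * (poly P a / poly Q a) + \<beta>) *
          (1 + q * (poly wn (R a) / poly wd (R a))) ^ d"
        using \<alpha>\<beta>[of a] by (simp add: power_mult_distrib)
      finally show ?case using elim by simp
    qed
  qed
  ultimately show ?thesis using d(1) \<alpha> by blast
qed

lemma coprime_minus_smult:
  assumes "coprime P (Q :: real poly)"
  shows "coprime (P - smult r Q) Q"
proof (rule coprimeI)
  fix c assume "c dvd P - smult r Q" "c dvd Q"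
  then have "c dvd P - smult r Q + smult r Q" by (intro dvd_add dvd_smult)
  then show "is_unit c" using assms \<open>c dvd Q\<close> coprime_common_divisor by auto
qed

definition moebius :: "real \<Rightarrow> real \<Rightarrow> real \<Rightarrow> real \<Rightarrow> real \<Rightarrow> real" where
  "moebius \<alpha> \<beta> \<gamma> \<delta> x = (\<alpha> * x + \<beta>) / (\<gamma> * x + \<delta>)"

text \<open>
  If \<open>R\<close> has no pole at infinity, then it has a finite real value \<open>r\<close> there, and the previous
  lemma applies to \<open>1 / (R - r)\<close>. The slope that parametrizes the coefficients of \<open>A\<close> and \<open>B\<close>
  is not transformed, only the value of \<open>A/B\<close> is.
\<close>

lemma flow_rational_orbit:
  fixes A B :: "real poly poly" and P Q :: "real poly" and R S :: "real \<Rightarrow> real"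
  assumes A0: "A \<noteq> 0" and B0: "B \<noteq> 0" and cop: "coprime P Q"
    and Q0: "Q \<noteq> 0" and PQ: "\<And>c. P \<noteq> smult c Q" and S: "MOST a. S a \<noteq> 0"
    and R_def: "R = (\<lambda>a. poly P a / poly Q a)"
    and flow: "MOST a. MOST b. eval2 B (R a) (b * S a) \<noteq> 0 \<and>
      eval2 A (R a) (b * S a) / eval2 B (R a) (b * S a) = R (a + b)"
  shows "\<exists>N \<alpha> \<beta> \<gamma> \<delta> wn wd. N > 0 \<and> \<alpha> * \<delta> - \<beta> * \<gamma> \<noteq> 0 \<and> wn \<noteq> 0 \<and> wd \<noteq> 0 \<and>
    (MOST a. MOST q. eval2 B (R a) q \<noteq> 0 \<and>
      \<gamma> * (eval2 A (R a) q / eval2 B (R a) q) + \<delta> \<noteq> 0 \<and> \<gamma> * R a + \<delta> \<noteq> 0 \<and> poly wd (R a) \<noteq> 0 \<and>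
      moebius \<alpha> \<beta> \<gamma> \<delta> (eval2 A (R a) q / eval2 B (R a) q) =
      moebius \<alpha> \<beta> \<gamma> \<delta> (R a) * (1 + q * (poly wn (R a) / poly wd (R a))) ^ N)"
proof -
  have R: "MOST a. R a \<noteq> c" for c
  proof -
    have "P - smult c Q \<noteq> 0" using PQ[of c] by simp
    from poly_MOST[OF this] poly_MOST[OF Q0] show ?thesis
      by eventually_elim (auto simp: R_def field_simps)
  qed
  have Qab: "MOST b. poly Q (a + b) \<noteq> 0" for a by (rule MOST_shift[OF poly_MOST[OF Q0]])
  have flow': "MOST a. MOST b. eval2 A (R a) (b * S a) * poly Q (a + b) =
      poly P (a + b) * eval2 B (R a) (b * S a)"
    using flow
  proof eventually_elim
    case (elim a)
    from elim Qab[of a] show ?case by eventually_elim (auto simp: R_def field_simps)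
  qed
  have wd: "MOST a. poly wd (R a) \<noteq> 0" if "wd \<noteq> 0" for wd
    by (rule MOST_compose[OF R poly_MOST[OF that]])
  show ?thesis
  proof (cases "degree Q < degree P")
    case True
    obtain N \<alpha> \<beta> wn wd where *: "N > 0" "\<alpha> \<noteq> 0" "wn \<noteq> 0" "wd \<noteq> 0"
      "MOST a. MOST q. eval2 B (R a) q \<noteq> 0 \<and>
        \<alpha> * (eval2 A (R a) q / eval2 B (R a) q) + \<beta> =
        (\<alpha> * (poly P a / poly Q a) + \<beta>) * (1 + q * (poly wn (R a) / poly wd (R a))) ^ N"
      using flow_polynomial_orbit[OF A0 B0 cop True Q0 R S flow'] unfolding R_def by blast
    show ?thesis
    proof (rule exI[of _ N], rule exI[of _ \<alpha>], rule exI[of _ \<beta>], rule exI[of _ 0],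
        rule exI[of _ 1], rule exI[of _ wn], rule exI[of _ wd], intro conjI)
      show "MOST a. MOST q. eval2 B (R a) q \<noteq> 0 \<and>
        0 * (eval2 A (R a) q / eval2 B (R a) q) + 1 \<noteq> 0 \<and> 0 * R a + 1 \<noteq> 0 \<and> poly wd (R a) \<noteq> 0 \<and>
        moebius \<alpha> \<beta> 0 1 (eval2 A (R a) q / eval2 B (R a) q) =
        moebius \<alpha> \<beta> 0 1 (R a) * (1 + q * (poly wn (R a) / poly wd (R a))) ^ N"
        using *(5) wd[OF *(4)]
      proof eventually_elim
        case (elim a)
        from elim(1) show ?case
          by (rule eventually_mono) (use elim(2) in \<open>simp add: moebius_def R_def\<close>)
      qed
    qed (use * in auto)
  next
    case False
    define m where "m = degree Q"
    \<comment> \<open>the value of \<open>R\<close> at infinity\<close>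
    define r where "r = coeff P m / lead_coeff Q"
    define Q' where "Q' = P - smult r Q"
    define B' where "B' = A - smult [:r:] B"
    have Q'0: "Q' \<noteq> 0" unfolding Q'_def using PQ[of r] by simp
    have "degree Q' \<le> m" unfolding Q'_def m_def using False by (intro degree_diff_le) auto
    moreover have "coeff Q' m = 0" using Q0 by (simp add: Q'_def r_def m_def)
    ultimately have deg: "degree Q' < degree Q"
      using Q'0 unfolding m_def by (metis le_neq_implies_less leading_coeff_0_iff)
    have cop': "coprime Q Q'"
      unfolding Q'_def using cop coprime_minus_smult[of P Q r] by (simp add: coprime_commute)
    have evB': "eval2 B' t q = eval2 A t q - r * eval2 B t q" for t q
      by (simp add: B'_def eval2_diff eval2_smult)
    have B'0: "B' \<noteq> 0"
    proof
      assume "B' = 0"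
      then have AB: "eval2 A t q = r * eval2 B t q" for t q using evB'[of t q] by simp
      have "MOST a::real. False"
        using flow
      proof eventually_elim
        case (elim a)
        have "MOST b::real. False" using elim MOST_shift[OF R[of r]]
          by eventually_elim (auto simp: AB)
        then show ?case by (simp add: infinite_UNIV_char_0)
      qed
      then show False by (simp add: infinite_UNIV_char_0)
    qed
    have flow'': "MOST a. MOST b. eval2 B (R a) (b * S a) * poly Q' (a + b) =
      poly Q (a + b) * eval2 B' (R a) (b * S a)"
      using flow' by (rule MOST2_mono) (simp add: evB' Q'_def algebra_simps)
    have RQ': "MOST a. 1 / (R a - r) = poly Q a / poly Q' a"
      using poly_MOST[OF Q0] poly_MOST[OF Q'0]
      by eventually_elim (simp add: R_def Q'_def field_simps)
    have param: "\<exists>X' Y'. Y' \<noteq> 0 \<and>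
        (MOST a. f a * poly Y' (poly Q a / poly Q' a) = poly X' (poly Q a / poly Q' a))"
      if Y: "Y \<noteq> 0" and f: "MOST a. f a * poly Y (R a) = poly X (R a)"
      for f :: "real \<Rightarrow> real" and X Y
    proof -
      obtain X' Y' where Y': "Y' \<noteq> 0" and
        e: "MOST a. f a * poly Y' (1 / (R a - r)) = poly X' (1 / (R a - r))"
        using rational_function_reparametrize[OF Y R[of r] f] by blast
      from e RQ' have "MOST a. f a * poly Y' (poly Q a / poly Q' a) = poly X' (poly Q a / poly Q' a)"
        by eventually_elim simp
      with Y' show ?thesis by (intro exI[of _ X'] exI[of _ Y'] conjI)
    qed
    note ex = flow_polynomial_orbit[OF B0 B'0 cop' deg Q'0 R S flow'']
    have "\<exists>N \<alpha> \<beta> wn wd. N > 0 \<and> \<alpha> \<noteq> 0 \<and> wn \<noteq> 0 \<and> wd \<noteq> 0 \<and>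
      (MOST a. MOST q. eval2 B' (R a) q \<noteq> 0 \<and>
        \<alpha> * (eval2 B (R a) q / eval2 B' (R a) q) + \<beta> =
        (\<alpha> * (poly Q a / poly Q' a) + \<beta>) * (1 + q * (poly wn (R a) / poly wd (R a))) ^ N)"
      by (rule ex) (rule param)
    then obtain N \<alpha> \<beta> wn wd where *: "N > 0" "\<alpha> \<noteq> 0" "wn \<noteq> 0" "wd \<noteq> 0"
      "MOST a. MOST q. eval2 B' (R a) q \<noteq> 0 \<and>
        \<alpha> * (eval2 B (R a) q / eval2 B' (R a) q) + \<beta> =
        (\<alpha> * (poly Q a / poly Q' a) + \<beta>) * (1 + q * (poly wn (R a) / poly wd (R a))) ^ N"
      by blast
    have B: "MOST a. MOST q. eval2 B (R a) q \<noteq> 0"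
    proof -
      have "MOST a. poly (lead_coeff B) (R a) \<noteq> 0" using wd[of "lead_coeff B"] B0 by simp
      then show ?thesis
      proof eventually_elim
        case (elim a)
        from poly_MOST[OF slice_generic(2)[OF elim]] show ?case by (simp add: poly_slice)
      qed
    qed
    have conv: "\<alpha> * (1 / (x - r)) + \<beta> = moebius \<beta> (\<alpha> - \<beta> * r) 1 (- r) x" if "x \<noteq> r" for x
      using that by (simp add: moebius_def field_simps)
    show ?thesis
    proof (rule exI[of _ N], rule exI[of _ \<beta>], rule exI[of _ "\<alpha> - \<beta> * r"], rule exI[of _ 1],
        rule exI[of _ "- r"], rule exI[of _ wn], rule exI[of _ wd], intro conjI)
      show "MOST a. MOST q. eval2 B (R a) q \<noteq> 0 \<and>
        1 * (eval2 A (R a) q / eval2 B (R a) q) + - r \<noteq> 0 \<and> 1 * R a + - r \<noteq> 0 \<and> poly wd (R a) \<noteq> 0 \<and>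
        moebius \<beta> (\<alpha> - \<beta> * r) 1 (- r) (eval2 A (R a) q / eval2 B (R a) q) =
        moebius \<beta> (\<alpha> - \<beta> * r) 1 (- r) (R a) * (1 + q * (poly wn (R a) / poly wd (R a))) ^ N"
        using *(5) B wd[OF *(4)] R[of r] RQ'
      proof eventually_elim
        case (elim a)
        note Ra = elim(3-5)
        from elim(1,2) show ?case
        proof eventually_elim
          case (elim q)
          let ?h = "eval2 A (R a) q / eval2 B (R a) q"
          have h: "?h \<noteq> r" using elim by (auto simp: evB' field_simps)
          have "eval2 B (R a) q / eval2 B' (R a) q = 1 / (?h - r)"
            using elim h by (simp add: evB' field_simps)
          then have "\<alpha> * (1 / (?h - r)) + \<beta> =
              (\<alpha> * (1 / (R a - r)) + \<beta>) * (1 + q * (poly wn (R a) / poly wd (R a))) ^ N"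
            using elim Ra(3) by simp
          then show ?case unfolding conv[OF h] conv[OF Ra(2)] using h Ra elim(2) by simp
        qed
      qed
    qed (use * in auto)
  qed
qed

section \<open>The normal form of a real flow\<close>

lemma eval2_MOST: 
  assumes "B \<noteq> 0"
  shows "MOST t. MOST q. eval2 B t q \<noteq> 0"
proof -
  obtain t q where "eval2 B t q \<noteq> 0" using pts2.separating[OF assms] by auto
  then show ?thesis
    by (rule MOST2_polyfun[of "eval2 B", rotated 2]) (intro polyfun_intros)+
qed

text \<open>
  One orbit meets infinitely many slopes \<open>t\<close>, and an identity between rational functions that holds
  for infinitely many \<open>t\<close> and, for each of them, for infinitely many \<open>q\<close>, holds everywhere.
\<close>

lemma normal_form_extend:
  fixes A B :: "real poly poly" and wn wd :: "real poly" and R :: "real \<Rightarrow> real"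
  defines "h \<equiv> \<lambda>t q. eval2 A t q / eval2 B t q"
  assumes B0: "B \<noteq> 0" and det: "\<alpha> * \<delta> - \<beta> * \<gamma> \<noteq> 0" and wd0: "wd \<noteq> 0"
    and R: "\<And>c. MOST a. R a \<noteq> c"
    and id: "MOST a. MOST q. eval2 B (R a) q \<noteq> 0 \<and> \<gamma> * h (R a) q + \<delta> \<noteq> 0 \<and>
      \<gamma> * R a + \<delta> \<noteq> 0 \<and> poly wd (R a) \<noteq> 0 \<and>
      moebius \<alpha> \<beta> \<gamma> \<delta> (h (R a) q) =
      moebius \<alpha> \<beta> \<gamma> \<delta> (R a) * (1 + q * (poly wn (R a) / poly wd (R a))) ^ N"
  shows "MOST t. MOST q. \<gamma> * h t q + \<delta> \<noteq> 0 \<and> \<gamma> * t + \<delta> \<noteq> 0 \<and>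
      moebius \<alpha> \<beta> \<gamma> \<delta> (h t q) = moebius \<alpha> \<beta> \<gamma> \<delta> t * (1 + q * (poly wn t / poly wd t)) ^ N"
proof -
  define F where "F t q = (\<alpha> * eval2 A t q + \<beta> * eval2 B t q) * (\<gamma> * t + \<delta>) * poly wd t ^ N -
    (\<alpha> * t + \<beta>) * (poly wd t + q * poly wn t) ^ N * (\<gamma> * eval2 A t q + \<delta> * eval2 B t q)" for t q
  define G where "G t q = \<gamma> * eval2 A t q + \<delta> * eval2 B t q" for t q
  have clear: "moebius \<alpha> \<beta> \<gamma> \<delta> (h t q) = (\<alpha> * eval2 A t q + \<beta> * eval2 B t q) / G t q"
      "\<gamma> * h t q + \<delta> = G t q / eval2 B t q" if "eval2 B t q \<noteq> 0" for t q
  proof -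
    show 2: "\<gamma> * h t q + \<delta> = G t q / eval2 B t q"
      using that by (simp add: h_def G_def field_simps)
    have 1: "\<alpha> * h t q + \<beta> = (\<alpha> * eval2 A t q + \<beta> * eval2 B t q) / eval2 B t q"
      using that by (simp add: h_def field_simps)
    show "moebius \<alpha> \<beta> \<gamma> \<delta> (h t q) = (\<alpha> * eval2 A t q + \<beta> * eval2 B t q) / G t q"
      unfolding moebius_def 1 2 using that by simp
  qed
  have w: "1 + q * (poly wn t / poly wd t) = (poly wd t + q * poly wn t) / poly wd t"
    if "poly wd t \<noteq> 0" for t q
    using that by (simp add: field_simps)
  have F: "polyfun (\<lambda>t. F t q)" "polyfun (F t)" for t q
    unfolding F_def by (intro polyfun_intros)+
  have "F t q = 0" for t q
  proof (rule ccontr)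
    assume "F t q \<noteq> 0"
    then have "MOST t. MOST q. F t q \<noteq> 0" by (rule MOST2_polyfun[OF F])
    from MOST_compose[OF R this] id have "MOST a::real. False"
    proof eventually_elim
      case (elim a)
      then have "MOST q::real. False"
      proof eventually_elim
        case (elim q)
        have B: "eval2 B (R a) q \<noteq> 0" and W: "poly wd (R a) \<noteq> 0" and
          m: "moebius \<alpha> \<beta> \<gamma> \<delta> (h (R a) q) =
            moebius \<alpha> \<beta> \<gamma> \<delta> (R a) * (1 + q * (poly wn (R a) / poly wd (R a))) ^ N"
          using elim by auto
        have "(\<alpha> * eval2 A (R a) q + \<beta> * eval2 B (R a) q) / G (R a) q =
          (\<alpha> * R a + \<beta>) / (\<gamma> * R a + \<delta>) * ((poly wd (R a) + q * poly wn (R a)) / poly wd (R a)) ^ N"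
          using m unfolding clear(1)[OF B] w[OF W] by (simp only: moebius_def)
        moreover have "G (R a) q \<noteq> 0" using elim clear(2)[of "R a" q] by auto
        ultimately have "F (R a) q = 0"
          using elim unfolding F_def G_def[symmetric] by (simp add: power_divide divide_eq_eq eq_divide_eq mult_ac)
        then show ?case using elim by simp
      qed
      then show ?case by (simp add: infinite_UNIV_char_0)
    qed
    then show False by (simp add: infinite_UNIV_char_0)
  qed
  note F0 = this
  obtain t1 q1 where "G t1 q1 \<noteq> 0"
  proof -
    from MOST_real_ex[OF id] obtain a where "MOST q. eval2 B (R a) q \<noteq> 0 \<and> \<gamma> * h (R a) q + \<delta> \<noteq> 0 \<and>
      \<gamma> * R a + \<delta> \<noteq> 0 \<and> poly wd (R a) \<noteq> 0 \<and>
      moebius \<alpha> \<beta> \<gamma> \<delta> (h (R a) q) =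
      moebius \<alpha> \<beta> \<gamma> \<delta> (R a) * (1 + q * (poly wn (R a) / poly wd (R a))) ^ N" ..
    from MOST_real_ex[OF this] obtain q where
      "eval2 B (R a) q \<noteq> 0" "\<gamma> * h (R a) q + \<delta> \<noteq> 0" by blast
    then have "G (R a) q \<noteq> 0" using clear(2)[of "R a" q] by auto
    then show thesis by (rule that)
  qed
  then have G: "MOST t. MOST q. G t q \<noteq> 0"
    by (rule MOST2_polyfun[rotated 2]) (unfold G_def, (intro polyfun_intros)+)
  have B: "MOST t. MOST q. eval2 B t q \<noteq> 0" by (rule eval2_MOST[OF B0])
  have "[:\<delta>, \<gamma>:] \<noteq> 0" using det by auto
  from poly_MOST[OF this] have gd: "MOST t. \<gamma> * t + \<delta> \<noteq> 0"
    by (simp add: add.commute mult.commute)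
  from B G gd poly_MOST[OF wd0] show ?thesis
  proof eventually_elim
    case (elim t)
    note t = elim(3,4)
    from elim(1,2) show ?case
    proof eventually_elim
      case (elim q)
      have "(\<alpha> * eval2 A t q + \<beta> * eval2 B t q) / G t q =
          (\<alpha> * t + \<beta>) / (\<gamma> * t + \<delta>) * ((poly wd t + q * poly wn t) / poly wd t) ^ N"
        using F0[of t q] t elim unfolding F_def G_def[symmetric]
        by (simp add: power_divide divide_eq_eq eq_divide_eq mult_ac)
      then show ?case using clear[OF elim(1)] elim t w[OF t(2)] by (simp add: moebius_def)
    qed
  qed
qed

text \<open>
  The normal form of the slope determines that of the velocity: the law of the flow expresses the slope
  at time \<open>a + b\<close> in two ways as an \<open>N\<close>-th power of an affine function of \<open>b\<close>, and both have to
  agree. The functions \<open>m\<close> and \<open>w\<close> are arbitrary here.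
\<close>

lemma velocity_normal_form:
  fixes h V :: "real \<Rightarrow> real \<Rightarrow> real" and m w :: "real \<Rightarrow> real"
  assumes N: "N > 0" and nf: "MOST t. MOST q. m (h t q) = m t * (1 + q * w t) ^ N"
    and m: "MOST t. m t \<noteq> 0" and w: "MOST t. w t \<noteq> 0"
    and flow: "MOST t. MOST a. MOST b. V t a \<noteq> 0 \<and> h (h t a) (b * V t a) = h t (a + b)"
  shows "MOST t. MOST a. V t a * w (h t a) = w t / (1 + a * w t)"
  using nf m w flow
proof eventually_elim
  case (elim t)
  have fin: "MOST a. h t a \<noteq> c" for c
  proof -
    have "\<exists>a. m t * (1 + a * w t) ^ N - m c \<noteq> 0"
    proof (cases "m c = 0")
      case True
      then show ?thesis using elim by (intro exI[of _ 0]) simp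
    next
      case False
      then show ?thesis using elim N by (intro exI[of _ "- 1 / w t"]) (simp add: power_0_left)
    qed
    then obtain a0 where a0: "m t * (1 + a0 * w t) ^ N - m c \<noteq> 0" ..
    have "polyfun (\<lambda>a. m t * (1 + a * w t) ^ N - m c)" by (intro polyfun_intros)
    from polyfun_MOST[OF this a0] have "MOST a. m t * (1 + a * w t) ^ N - m c \<noteq> 0" .
    with elim(1) show ?thesis by eventually_elim auto
  qed
  have "polyfun (\<lambda>a. 1 + a * w t)" by (intro polyfun_add polyfun_mult polyfun_id polyfun_const)
  from polyfun_MOST[OF this, of 0] have "MOST a. 1 + a * w t \<noteq> 0" by simp
  with elim(1,4) MOST_compose[OF fin nf] show ?case
  proof eventually_elim
    case a: (elim a)
    define x where "x = V t a * w (h t a)"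
    define y where "y = w t / (1 + a * w t)"
    have V: "V t a \<noteq> 0" using MOST_real_ex[OF a(2)] by blast
    have "MOST b. (1 + b * y) ^ N = (1 + b * x) ^ N"
      using a(2) MOST_shift[OF elim(1), of a] MOST_scale[OF a(3) V]
    proof eventually_elim
      case (elim b)
      have "m t * (1 + (a + b) * w t) ^ N = m t * (1 + a * w t) ^ N * (1 + b * x) ^ N"
        using elim a(1) by (simp add: x_def mult_ac)
      moreover have "1 + (a + b) * w t = (1 + a * w t) * (1 + b * y)"
        using a(4) by (simp add: y_def field_simps)
      ultimately show ?case
        using \<open>m t \<noteq> 0\<close> a(4) by (simp add: power_mult_distrib)
    qed
    then have eq: "(1 + b * y) ^ N = (1 + b * x) ^ N" for b
      by (rule polyfun_eq[rotated 2]) (intro polyfun_power polyfun_add polyfun_mult polyfun_id polyfun_const)+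
    \<comment> \<open>compare the zeros in \<open>b\<close> of the two powers\<close>
    have "x = y"
    proof (cases "x = 0")
      case True
      then have "(1 + b * y) ^ N = 1" for b using eq[of b] by simp
      from this[of "- 1 / y"] show ?thesis using True N by (cases "y = 0") (auto simp: power_0_left)
    next
      case False
      then have "(1 + (- 1 / x) * y) ^ N = 0" using eq[of "- 1 / x"] N by simp
      then have "y / x = 1" by simp
      then show ?thesis using False by simp
    qed
    then show ?case by (simp add: x_def y_def)
  qed
qed

text \<open>
  The case of a constant slope, where the flow moves every point along a line through the origin.
  Again the first two coefficients at infinity decide, now for the velocity itself. If
  \<open>e = 0\<close>, then the velocity is \<open>1\<close>, in accordance with \<open>k / 0 = 0\<close>.
\<close>

lemma radial_normal_form:
  fixes C D :: "real poly poly"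
  defines "V \<equiv> \<lambda>t q. eval2 C t q / eval2 D t q"
  assumes C0: "C \<noteq> 0" and D0: "D \<noteq> 0"
    and flow: "MOST t. MOST a. MOST b. V t a \<noteq> 0 \<and> eval2 D t (b * V t a) \<noteq> 0 \<and>
      V t a * V t (b * V t a) = V t (a + b)"
  shows "\<exists>wn wd. MOST t. MOST a. V t a = 1 / (1 + a * (poly wn t / poly wd t))"
proof -
  define c0 c1 where "c0 = lead_coeff C" and "c1 = coeff (reflect_poly C) 1"
  define d0 d1 where "d0 = lead_coeff D" and "d1 = coeff (reflect_poly D) 1"
  define k :: real where "k = real (degree C) - real (degree D)"
  define wn where "wn = smult k (c0 * d0)"
  define wd where "wd = c1 * d0 - d1 * c0"
  have nz: "MOST t. poly c0 t \<noteq> 0 \<and> poly d0 t \<noteq> 0"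
    using C0 D0 by (intro MOST_conjI poly_MOST) (auto simp: c0_def d0_def)
  have "MOST t. MOST a. V t a = 1 / (1 + a * (poly wn t / poly wd t))"
    using nz flow
  proof eventually_elim
    case t: (elim t)
    let ?C = "slice C t" and ?D = "slice D t"
    have sC: "degree ?C = degree C" "?C \<noteq> 0" "neg_root_sum ?C = poly c1 t / poly c0 t"
      using slice_generic[of C t] t(1) by (auto simp: c0_def c1_def)
    have sD: "degree ?D = degree D" "?D \<noteq> 0" "neg_root_sum ?D = poly d1 t / poly d0 t"
      using slice_generic[of D t] t(1) by (auto simp: d0_def d1_def)
    define e where "e = neg_root_sum ?C - neg_root_sum ?D"
    have w: "poly wn t / poly wd t = k / e"
      using t(1) unfolding e_def sC sD wn_def wd_def by (simp add: diff_frac_eq)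
    have asym: "MOST a. e = V t a * (k * a + e) \<and>
      V t a * (lead_coeff ?C * V t a ^ degree C * lead_coeff ?D) =
      lead_coeff ?C * (lead_coeff ?D * V t a ^ degree D)"
      using t(2)
    proof eventually_elim
      case (elim a)
      define s where "s = V t a"
      have s: "s \<noteq> 0" using MOST_real_ex[OF elim] by (auto simp: s_def)
      have sC': "smult s ?C \<noteq> 0" using s sC by simp
      have "MOST b. poly (smult s ?C) (b * s) * poly ?D (a + b) = poly ?C (a + b) * poly ?D (b * s)"
        using elim MOST_shift[OF poly_MOST[OF sD(2)], of a]
      proof eventually_elim
        case (elim b)
        have "s * V t (b * s) = V t (a + b)" "eval2 D t (b * s) \<noteq> 0"
          using elim by (auto simp: s_def)
        then show ?case using elim(2) unfolding V_def by (simp add: poly_slice field_simps)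
      qed
      note as = asymptotics[OF sC' sD(2) sC(2) sD(2) s this]
      have "neg_root_sum (smult s ?C) = neg_root_sum ?C"
      proof (cases "degree ?C = 0")
        case True
        then show ?thesis by (simp add: neg_root_sum_const)
      next
        case False
        then show ?thesis using s by (simp add: neg_root_sum_pos)
      qed
      then have "e / s = k * a + e"
        using as(3) by (simp add: e_def k_def sC(1) sD(1) algebra_simps diff_divide_distrib)
      then have 1: "e = s * (k * a + e)" using s by (simp add: field_simps)
      have 2: "s * (lead_coeff ?C * s ^ degree C * lead_coeff ?D) =
          lead_coeff ?C * (lead_coeff ?D * s ^ degree D)"
        using as(2) s by (simp add: sC(1) sD(1) mult_ac)
      from 1 2 show ?case unfolding s_def ..
    qed
    show ?case
    proof (cases "e = 0")
      case False
      from asym show ?thesis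
      proof eventually_elim
        case (elim a)
        then have "k * a + e \<noteq> 0" using False by auto
        moreover have "V t a = e / (k * a + e)"
          using calculation elim by (simp add: field_simps)
        moreover have "1 + a * (k / e) = (k * a + e) / e" using False by (simp add: field_simps)
        ultimately show ?case unfolding w using False by simp
      qed
    next
      case True
      have "MOST a::real. a \<noteq> 0" by simp
      with asym t(2) show ?thesis
      proof eventually_elim
        case (elim a)
        have V: "V t a \<noteq> 0" using MOST_real_ex[OF elim(2)] by blast
        then have "k = 0" using elim True by simp
        then have "degree C = degree D" by (simp add: k_def)
        then have "V t a = 1" using elim(1) V sC(2) sD(2) by simp
        then show ?case unfolding w True by simp
      qed
    qed
  qed
  then show ?thesis by blast
qed

lemma MOST_imp_eventually_at: "(MOST x::real. P x) \<Longrightarrow> eventually P (at a)"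
  unfolding eventually_cofinite eventually_at_topological
  by (rule exI[of _ "- ({x. \<not> P x} - {a})"], intro conjI open_Compl finite_imp_closed finite_Diff)
    auto

text \<open>
  A non-constant slope on an orbit leads to a positive exponent \<open>N\<close>. If the slope is constant on
  all orbits, then by the boundary condition it is \<open>t\<close>, and the assertion holds with \<open>N = 0\<close>.
\<close>

theorem real_flow_normal_form:
  fixes A B C D :: "real poly poly"
  defines "h \<equiv> \<lambda>t q. eval2 A t q / eval2 B t q" and "V \<equiv> \<lambda>t q. eval2 C t q / eval2 D t q"
  assumes nz: "B \<noteq> 0" "C \<noteq> 0" "D \<noteq> 0"
    and flow: "MOST t. MOST a. MOST b. V t a \<noteq> 0 \<and>
      eval2 B (h t a) (b * V t a) \<noteq> 0 \<and> eval2 D (h t a) (b * V t a) \<noteq> 0 \<and>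
      h (h t a) (b * V t a) = h t (a + b) \<and> V t a * V (h t a) (b * V t a) = V t (a + b)"
    and bnd: "MOST t. (h t \<longlongrightarrow> t) (at 0)"
    and nontriv: "\<not> (MOST t. MOST q. h t q = t \<and> V t q = 1)"
  shows "\<exists>N \<alpha> \<beta> \<gamma> \<delta> wn wd. \<alpha> * \<delta> - \<beta> * \<gamma> \<noteq> 0 \<and> wn \<noteq> 0 \<and> wd \<noteq> 0 \<and>
    (MOST t. MOST q. \<gamma> * h t q + \<delta> \<noteq> 0 \<and> \<gamma> * t + \<delta> \<noteq> 0 \<and>
      moebius \<alpha> \<beta> \<gamma> \<delta> (h t q) = moebius \<alpha> \<beta> \<gamma> \<delta> t * (1 + q * (poly wn t / poly wd t)) ^ N \<and>
      V t q * (poly wn (h t q) / poly wd (h t q)) =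
        (poly wn t / poly wd t) / (1 + q * (poly wn t / poly wd t)))"
proof (cases "MOST t. MOST q. h t q = t")
  case True
  have "MOST t. MOST a. MOST b. V t a \<noteq> 0 \<and> eval2 D t (b * V t a) \<noteq> 0 \<and>
      V t a * V t (b * V t a) = V t (a + b)"
    using flow True
  proof eventually_elim
    case (elim t)
    from elim show ?case
    proof eventually_elim
      case (elim a)
      from elim(1) show ?case by (rule eventually_mono) (use elim(2) in auto)
    qed
  qed
  then obtain wn wd where w: "MOST t. MOST a. V t a = 1 / (1 + a * (poly wn t / poly wd t))"
    using radial_normal_form[OF nz(2,3)] unfolding V_def by blast
  have "wn \<noteq> 0 \<and> wd \<noteq> 0"
  proof (rule ccontr)
    assume "\<not> (wn \<noteq> 0 \<and> wd \<noteq> 0)"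
    then have [simp]: "poly wn t / poly wd t = 0" for t by auto
    from w True have "MOST t. MOST q. h t q = t \<and> V t q = 1"
      by eventually_elim (auto elim: eventually_elim2)
    then show False using nontriv by blast
  qed
  moreover have "MOST t. MOST q. 0 * h t q + 1 \<noteq> 0 \<and> 0 * t + 1 \<noteq> 0 \<and>
      moebius 1 0 0 1 (h t q) = moebius 1 0 0 1 t * (1 + q * (poly wn t / poly wd t)) ^ 0 \<and>
      V t q * (poly wn (h t q) / poly wd (h t q)) =
        (poly wn t / poly wd t) / (1 + q * (poly wn t / poly wd t))"
    using w True
  proof eventually_elim
    case (elim t)
    from elim show ?case by eventually_elim (simp add: moebius_def)
  qed
  moreover have "(1::real) * 1 - 0 * 0 \<noteq> 0" by simp
  ultimately show ?thesis by blast
next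
  case False
  have A0: "A \<noteq> 0"
  proof
    assume "A = 0"
    then have h: "h t = (\<lambda>q. 0)" for t by (simp add: h_def)
    have "MOST t::real. t \<noteq> 0" by simp
    with bnd have "MOST t::real. False"
      by eventually_elim (auto simp: h tendsto_const_iff)
    then show False by (simp add: infinite_UNIV_char_0)
  qed
  have moving: "MOST t. MOST q. h t q \<noteq> t"
  proof -
    have "\<exists>t q. eval2 A t q - t * eval2 B t q \<noteq> 0"
    proof (rule ccontr)
      assume "\<not> ?thesis"
      then have AB: "eval2 A t q = t * eval2 B t q" for t q by simp
      have "MOST t. MOST q. eval2 B t q \<noteq> 0"
        by (rule eval2_MOST[OF nz(1)])
      then have "MOST t. MOST q. h t q = t"
        by (rule MOST2_mono) (simp add: h_def AB)
      then show False using False by blast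
    qed
    then have "MOST t. MOST q. eval2 A t q - t * eval2 B t q \<noteq> 0"
      by (elim exE, intro MOST2_polyfun[of "\<lambda>t q. eval2 A t q - t * eval2 B t q"])
        (assumption | intro polyfun_intros)+
    moreover have "MOST t. MOST q. eval2 B t q \<noteq> 0"
      by (rule eval2_MOST[OF nz(1)])
    ultimately show ?thesis
    proof eventually_elim
      case (elim t)
      then show ?case by eventually_elim (auto simp: h_def divide_eq_eq)
    qed
  qed
  have "MOST t. poly (lead_coeff B) t \<noteq> 0" using nz by (intro poly_MOST) simp
  with flow bnd moving have "MOST t0. (MOST a. MOST b. V t0 a \<noteq> 0 \<and>
      eval2 B (h t0 a) (b * V t0 a) \<noteq> 0 \<and>
      h (h t0 a) (b * V t0 a) = h t0 (a + b)) \<and> (h t0 \<longlongrightarrow> t0) (at 0) \<and> (MOST q. h t0 q \<noteq> t0) \<and>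
      poly (lead_coeff B) t0 \<noteq> 0"
    by eventually_elim (auto elim!: MOST2_mono)
  then obtain t0 where flow0: "MOST a. MOST b. V t0 a \<noteq> 0 \<and>
      eval2 B (h t0 a) (b * V t0 a) \<noteq> 0 \<and> h (h t0 a) (b * V t0 a) = h t0 (a + b)"
    and bnd0: "(h t0 \<longlongrightarrow> t0) (at 0)" and mov0: "MOST q. h t0 q \<noteq> t0"
    and B0: "poly (lead_coeff B) t0 \<noteq> 0"
    using MOST_real_ex by blast
  \<comment> \<open>the orbit through the slope \<open>t0\<close>, with the slope as a quotient in lowest terms\<close>
  define g where "g = gcd (slice A t0) (slice B t0)"
  define P where "P = slice A t0 div g"
  define Q where "Q = slice B t0 div g"
  have sB: "slice B t0 \<noteq> 0" by (rule slice_generic(2)[OF B0])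
  have g0: "g \<noteq> 0" using sB by (simp add: g_def)
  have cop: "coprime P Q" unfolding P_def Q_def g_def using sB by (intro div_gcd_coprime) simp
  have PQ: "slice A t0 = P * g" "slice B t0 = Q * g" by (simp_all add: P_def Q_def g_def)
  have Q0: "Q \<noteq> 0" using sB PQ(2) by auto
  define R where "R = (\<lambda>a. poly P a / poly Q a)"
  have hR: "MOST a. h t0 a = R a"
    using poly_MOST[OF g0]
    by eventually_elim (simp add: h_def R_def poly_slice[symmetric] PQ)
  have nonconst: "P \<noteq> smult c Q" for c
  proof
    assume P: "P = smult c Q"
    have hc: "MOST a. h t0 a = c"
      using hR poly_MOST[OF Q0] by eventually_elim (simp add: R_def P)
    then have "((\<lambda>_. c) \<longlongrightarrow> t0) (at (0::real))"
      by (rule iffD1[OF tendsto_cong[OF MOST_imp_eventually_at] bnd0])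
    then have "c = t0" by (simp add: tendsto_const_iff)
    have "MOST a::real. False" using hc mov0 by eventually_elim (simp add: \<open>c = t0\<close>)
    then show False by (simp add: infinite_UNIV_char_0)
  qed
  have R: "MOST a. R a \<noteq> c" for c
  proof -
    have "P - smult c Q \<noteq> 0" using nonconst[of c] by simp
    from poly_MOST[OF this] poly_MOST[OF Q0] show ?thesis
      by eventually_elim (auto simp: R_def field_simps)
  qed
  have S: "MOST a. V t0 a \<noteq> 0"
    using flow0 by eventually_elim (use MOST_real_ex in blast)
  have "MOST a. MOST b. eval2 B (R a) (b * V t0 a) \<noteq> 0 \<and>
      eval2 A (R a) (b * V t0 a) / eval2 B (R a) (b * V t0 a) = R (a + b)"
    using flow0 hR
  proof eventually_elim
    case (elim a)
    from elim(1) MOST_shift[OF hR, of a] show ?case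
      by eventually_elim (use elim(2) in \<open>simp add: h_def\<close>)
  qed
  from flow_rational_orbit[OF A0 nz(1) cop Q0 nonconst S R_def this]
  obtain N \<alpha> \<beta> \<gamma> \<delta> wn wd where N: "N > 0" and det: "\<alpha> * \<delta> - \<beta> * \<gamma> \<noteq> 0"
    and w0: "wn \<noteq> 0" "wd \<noteq> 0" and
    id: "MOST a. MOST q. eval2 B (R a) q \<noteq> 0 \<and>
      \<gamma> * (eval2 A (R a) q / eval2 B (R a) q) + \<delta> \<noteq> 0 \<and> \<gamma> * R a + \<delta> \<noteq> 0 \<and> poly wd (R a) \<noteq> 0 \<and>
      moebius \<alpha> \<beta> \<gamma> \<delta> (eval2 A (R a) q / eval2 B (R a) q) =
      moebius \<alpha> \<beta> \<gamma> \<delta> (R a) * (1 + q * (poly wn (R a) / poly wd (R a))) ^ N"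
    by blast
  define w where "w t = poly wn t / poly wd t" for t
  have nf: "MOST t. MOST q. \<gamma> * h t q + \<delta> \<noteq> 0 \<and> \<gamma> * t + \<delta> \<noteq> 0 \<and>
      moebius \<alpha> \<beta> \<gamma> \<delta> (h t q) = moebius \<alpha> \<beta> \<gamma> \<delta> t * (1 + q * w t) ^ N"
    unfolding h_def w_def by (rule normal_form_extend[OF nz(1) det w0(2) R id])
  have "MOST t. moebius \<alpha> \<beta> \<gamma> \<delta> t \<noteq> 0"
  proof -
    have "[:\<beta>, \<alpha>:] \<noteq> 0" "[:\<delta>, \<gamma>:] \<noteq> 0" using det by auto
    from this[THEN poly_MOST] show ?thesis
      by eventually_elim (simp add: moebius_def algebra_simps)
  qed
  moreover have "MOST t. w t \<noteq> 0"
    using w0[THEN poly_MOST] by eventually_elim (simp add: w_def)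
  moreover have "MOST t. MOST q. moebius \<alpha> \<beta> \<gamma> \<delta> (h t q) = moebius \<alpha> \<beta> \<gamma> \<delta> t * (1 + q * w t) ^ N"
    using nf by (rule MOST2_mono) blast
  moreover have "MOST t. MOST a. MOST b. V t a \<noteq> 0 \<and> h (h t a) (b * V t a) = h t (a + b)"
    using flow by (rule MOST2_mono) (auto elim: eventually_mono)
  ultimately have vel: "MOST t. MOST a. V t a * w (h t a) = w t / (1 + a * w t)"
    using velocity_normal_form[OF N] by blast
  have "MOST t. MOST q. \<gamma> * h t q + \<delta> \<noteq> 0 \<and> \<gamma> * t + \<delta> \<noteq> 0 \<and>
      moebius \<alpha> \<beta> \<gamma> \<delta> (h t q) = moebius \<alpha> \<beta> \<gamma> \<delta> t * (1 + q * w t) ^ N \<and>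
      V t q * w (h t q) = w t / (1 + q * w t)"
    using nf vel
  proof eventually_elim
    case (elim t)
    then show ?case by eventually_elim blast
  qed
  then show ?thesis using det w0 unfolding w_def by blast
qed

section \<open>From the translation equation to a real flow\<close>

lemma ring_map_const2: "ring_map const2"
  unfolding const2_def
  using ring_map_comp[OF ring_map_to_fract ring_map_comp[OF ring_map_pCons ring_map_pCons]] .

lemma ring_map_const3: "ring_map const3"
  unfolding const3_def
  using ring_map_comp[OF ring_map_to_fract ring_map_comp[OF ring_map_pCons
    ring_map_comp[OF ring_map_pCons ring_map_pCons]]] .

lemma rep2_const: "pts2.rep (const2 c) (\<lambda>p. c)"
  and rep2_x: "pts2.rep x2 fst"
  and rep2_y: "pts2.rep y2 snd"
  using pts2.rep_to_fract[of "[:[:c:]:]"] pts2.rep_to_fract[of "[:[:0, 1:]:]"]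
    pts2.rep_to_fract[of "[:0, 1:]"]
  by (simp_all add: const2_def x2_def y2_def eval2_pCons)

lemma eval3_pCons: "eval3 (pCons q d) a b c = eval2 q a b + c * eval3 d a b c"
  unfolding eval3_def using poly_map_poly_pCons[OF pts2.ring_map_ev[of "(a, b)"]] by simp

lemma eval3_0 [simp]: "eval3 0 a b c = 0"
  by (simp add: eval3_def)

lemma eval2_1 [simp]: "eval2 1 a b = 1"
  by (rule ring_map_1[OF ring_map_bipoly[OF ring_map_id]])

lemma rep3_const: "pts3.rep (const3 c) (\<lambda>p. c)"
  and rep3_x: "pts3.rep x3 (\<lambda>p. fst (fst p))"
  and rep3_y: "pts3.rep y3 (\<lambda>p. snd (fst p))"
  and rep3_z: "pts3.rep z3 snd"
  using pts3.rep_to_fract[of "[:[:[:c:]:]:]"] pts3.rep_to_fract[of "[:[:[:0, 1:]:]:]"]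
    pts3.rep_to_fract[of "[:[:0, 1:]:]"] pts3.rep_to_fract[of "[:0, 1:]"]
  by (simp_all add: const3_def x3_def y3_def z3_def eval2_pCons eval3_pCons)

text \<open>
  The way back from real identities to identities of rational functions.
\<close>

lemma rep2_MOST_eq:
  assumes "pts2.rep f \<phi>" "pts2.rep g \<psi>" "MOST t. MOST y. \<phi> (t * y, y) = \<psi> (t * y, y)"
  shows "f = g"
proof (rule ccontr)
  assume "f \<noteq> g"
  then have "f - g \<noteq> 0" by simp
  from zariski2_slices(1)[OF pts2.rep_neq_0[OF pts2.rep_diff[OF assms(1,2)] this]] assms(3)
  have "MOST t::real. False"
  proof eventually_elim
    case (elim t)
    then have "MOST y::real. False" by eventually_elim simp
    then show ?case by (simp add: infinite_UNIV_char_0)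
  qed
  then show False by (simp add: infinite_UNIV_char_0)
qed

abbreviation ev2 :: "rat2 \<Rightarrow> real \<Rightarrow> real \<Rightarrow> real" where
  "ev2 \<equiv> rat_eval (\<lambda>c. c)"

abbreviation num :: "rat2 \<Rightarrow> real poly poly" where "num f \<equiv> fst (quot_of_fract f)"
abbreviation den :: "rat2 \<Rightarrow> real poly poly" where "den f \<equiv> snd (quot_of_fract f)"

lemma num_den: "f = to_fract (num f) / to_fract (den f)"
  using quot_to_fract_quot_of_fract[of f]
  by (simp add: quot_to_fract_def case_prod_unfold Fract_conv_to_fract)

lemma rep2_self: "pts2.rep f (\<lambda>p. ev2 f (fst p) (snd p))"
  unfolding pts2.rep_def rat_eval_def
  by (rule exI[of _ "num f"], rule exI[of _ "den f"]) (use num_den[of f] in simp)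

lemma num_eq_0: "num f = 0 \<longleftrightarrow> f = 0"
  using num_den[of f] by (auto simp: quot_of_fract_0)

lemma translation_equation_real:
  assumes "translation_equation (u, v)"
  shows "MOST t. MOST a. MOST b. let p = b / a * ev2 u (t * a) a; q = b / a * ev2 v (t * a) a in
    eval2 (den u) p q \<noteq> 0 \<and> eval2 (den v) p q \<noteq> 0 \<and>
    ev2 u p q = b / (a + b) * ev2 u (t * (a + b)) (a + b) \<and>
    ev2 v p q = b / (a + b) * ev2 v (t * (a + b)) (a + b)"
proof -
  define f where "f w = (1 - z3) / z3 * rat_eval const3 w (x3 * z3) (y3 * z3)" for w
  define \<phi> where "\<phi> w p = (1 - snd p) / snd p *
    ev2 w (fst (fst p) * snd p) (snd (fst p) * snd p)" for w and p :: "(real \<times> real) \<times> real"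
  have f: "pts3.rep (f w) (\<phi> w)" for w
    unfolding f_def \<phi>_def
    by (intro pts3.rep_mult pts3.rep_divide pts3.rep_diff pts3.rep_1 rep3_z
        pts3.rep_rat_eval[OF ring_map_const3 rep3_const] rep3_x rep3_y)
  have eq: "(1 - z3) * rat_eval const3 w x3 y3 = rat_eval const3 w (f u) (f v)"
    and d: "bipoly const3 (den w) (f u) (f v) \<noteq> 0" if "w = u \<or> w = v" for w
    using assms that unfolding translation_equation_def f_def
    by (auto simp: Let_def map_defined_def map_eval_def scale_def rat_defined_def)
  have l: "pts3.rep ((1 - z3) * rat_eval const3 w x3 y3)
      (\<lambda>p. (1 - snd p) * ev2 w (fst (fst p)) (snd (fst p)))" for w
    by (intro pts3.rep_mult pts3.rep_divide pts3.rep_diff pts3.rep_1 rep3_z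
        pts3.rep_rat_eval[OF ring_map_const3 rep3_const] rep3_x rep3_y)
  have r: "pts3.rep (rat_eval const3 w (f u) (f v)) (\<lambda>p. ev2 w (\<phi> u p) (\<phi> v p))" for w
    by (intro pts3.rep_rat_eval[OF ring_map_const3 rep3_const] f)
  have "eventually (\<lambda>p. (1 - snd p) * ev2 w (fst (fst p)) (snd (fst p)) = ev2 w (\<phi> u p) (\<phi> v p))
      pts3.zariski" if "w = u \<or> w = v" for w
    using l[of w] unfolding eq[OF that] by (rule pts3.rep_unique[OF _ r])
  moreover have "eventually (\<lambda>p. eval2 (den w) (\<phi> u p) (\<phi> v p) \<noteq> 0) pts3.zariski"
    if "w = u \<or> w = v" for w
    by (rule pts3.rep_neq_0[OF _ d[OF that]])
      (intro pts3.rep_bipoly[OF ring_map_const3 rep3_const] f)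
  ultimately have "eventually (\<lambda>p. \<forall>w\<in>{u, v}. eval2 (den w) (\<phi> u p) (\<phi> v p) \<noteq> 0 \<and>
      (1 - snd p) * ev2 w (fst (fst p)) (snd (fst p)) = ev2 w (\<phi> u p) (\<phi> v p)) pts3.zariski"
    by (simp add: eventually_conj)
  note sl = zariski3_slices[OF this]
  have a0: "MOST a::real. a \<noteq> 0" by simp
  from sl show ?thesis
  proof eventually_elim
    case (elim t)
    from elim a0 show ?case
    proof eventually_elim
      case (elim a)
      have "MOST b. b \<noteq> - a" by simp
      from elim(1) this show ?case
      proof eventually_elim
        case (elim b)
        have ab: "a + b \<noteq> 0" using elim by auto
        have 1: "1 - a / (a + b) = b / (a + b)" using ab by (simp add: field_simps)
        have 2: "\<phi> w ((t * (a + b), a + b), a / (a + b)) = b / a * ev2 w (t * a) a" for w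
          using ab \<open>a \<noteq> 0\<close> by (simp add: \<phi>_def 1)
        show ?case using elim(1) by (simp add: 1 2 Let_def)
      qed
    qed
  qed
qed

text \<open>
  For a point with slope \<open>t\<close> the slope of \<open>\<phi>(tq, q)\<close> is \<open>h t q\<close>, and its second coordinate is
  \<open>q * V t q\<close>; by homogeneity these two functions describe the flow at all times.
\<close>

lemma rat_flow_normal_form:
  assumes eq: "translation_equation (u, v)" and bnd: "boundary_condition (u, v)"
    and nontriv: "(u, v) \<noteq> (x2, y2)"
  defines "r \<equiv> u / v" and "t \<equiv> x2 / y2"
    and "w \<equiv> \<lambda>wn wd f. poly (map_poly const2 wn) f / poly (map_poly const2 wd) f"
  shows "v \<noteq> 0 \<and> (\<exists>N \<alpha> \<beta> \<gamma> \<delta> wn wd. \<alpha> * \<delta> - \<beta> * \<gamma> \<noteq> 0 \<and> wn \<noteq> 0 \<and> wd \<noteq> 0 \<and>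
    const2 \<gamma> * r + const2 \<delta> \<noteq> 0 \<and>
    (const2 \<alpha> * r + const2 \<beta>) / (const2 \<gamma> * r + const2 \<delta>) =
    (const2 \<alpha> * t + const2 \<beta>) / (const2 \<gamma> * t + const2 \<delta>) * (1 + y2 * w wn wd t) ^ N \<and>
    v * w wn wd r = y2 * w wn wd t / (1 + y2 * w wn wd t))"
proof -
  obtain d where d: "d \<noteq> 0" and lim: "\<And>a b. eval2 d a b \<noteq> 0 \<Longrightarrow>
      ((\<lambda>z::real. (1 / z * ev2 u (a * z) (b * z), 1 / z * ev2 v (a * z) (b * z))) \<longlongrightarrow> (a, b)) (at 0)"
    using bnd unfolding boundary_condition_def by (auto simp: scale_def map_eval_def)
  have limu: "((\<lambda>z. 1 / z * ev2 u (a * z) (b * z)) \<longlongrightarrow> a) (at 0)"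
    and limv: "((\<lambda>z. 1 / z * ev2 v (a * z) (b * z)) \<longlongrightarrow> b) (at 0)" if "eval2 d a b \<noteq> 0" for a b
    using tendsto_fst[OF lim[OF that]] tendsto_snd[OF lim[OF that]] by simp_all
  have v0: "v \<noteq> 0"
  proof
    assume "v = 0"
    then have [simp]: "ev2 v a b = 0" for a b by (simp add: rat_eval_def quot_of_fract_0)
    obtain a b where "b \<noteq> 0" "eval2 d a b \<noteq> 0" using eval2_neq_0_ex[OF d] by blast
    then show False using limv[of a b] by (simp add: tendsto_const_iff)
  qed
  obtain A where A: "\<And>t q. eval2 A t q = eval2 (num u * den v) (t * q) q" using eval2_cone by metis
  obtain B where B: "\<And>t q. eval2 B t q = eval2 (den u * num v) (t * q) q" using eval2_cone by metis
  obtain C where C: "\<And>t q. eval2 C t q = eval2 (num v) (t * q) q" using eval2_cone by metis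
  obtain D where D: "\<And>t q. eval2 D t q = eval2 ([:0, 1:] * den v) (t * q) q" using eval2_cone by metis
  have D': "eval2 D t q = q * eval2 (den v) (t * q) q" for t q
    unfolding D by (simp add: eval2_pCons)
  have B': "eval2 B t q = eval2 (den u) (t * q) q * eval2 (num v) (t * q) q" for t q
    unfolding B by (rule eval2_mult)
  define h where "h t q = eval2 A t q / eval2 B t q" for t q
  define V where "V t q = eval2 C t q / eval2 D t q" for t q
  have h: "h t q = ev2 u (t * q) q / ev2 v (t * q) q" for t q
    by (simp add: h_def A B' eval2_mult rat_eval_def)
  have V: "V t q = ev2 v (t * q) q / q" for t q
    by (simp add: V_def C D' rat_eval_def mult.commute)
  have nz0: "num v \<noteq> 0" "den u \<noteq> 0" "den v \<noteq> 0"
    using v0 num_eq_0[of v] by auto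
  have nonzero: "E \<noteq> 0" if "\<And>t q. eval2 E t q = eval2 F (t * q) q" "F \<noteq> 0" for E F
  proof
    assume "E = 0"
    then have "eval2 F (t * q) q = 0" for t q using that(1)[of t q] by simp
    with eval2_slices(1)[OF that(2)] show False by (simp add: infinite_UNIV_char_0)
  qed
  have nz: "B \<noteq> 0" "C \<noteq> 0" "D \<noteq> 0"
    using nonzero[OF B] nonzero[OF C] nonzero[OF D] nz0 by simp_all
  have vnz: "MOST t. MOST a. ev2 v (t * a) a \<noteq> 0"
    using eval2_slices(1)[OF nz0(1)] eval2_slices(1)[OF nz0(3)]
  proof eventually_elim
    case (elim t)
    then show ?case by eventually_elim (simp add: rat_eval_def)
  qed
  have flow: "MOST t. MOST a. MOST b. V t a \<noteq> 0 \<and>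
      eval2 B (h t a) (b * V t a) \<noteq> 0 \<and> eval2 D (h t a) (b * V t a) \<noteq> 0 \<and>
      h (h t a) (b * V t a) = h t (a + b) \<and> V t a * V (h t a) (b * V t a) = V t (a + b)"
    using translation_equation_real[OF eq] vnz
  proof eventually_elim
    case (elim t)
    note vt = elim(2)
    have "MOST a::real. a \<noteq> 0" by simp
    from elim(1) vt this show ?case
    proof eventually_elim
      case (elim a)
      have "MOST b::real. b \<noteq> 0" "MOST b. b \<noteq> - a" by simp_all
      from elim(1) MOST_shift[OF vt, of a] this show ?case
      proof eventually_elim
        case b: (elim b)
        define W where "W = ev2 v (t * a) a"
        \<comment> \<open>\<open>(p, q)\<close> is the point at which the outer \<open>\<phi>\<close> of the translation equation is taken\<close>
        define p where "p = b / a * ev2 u (t * a) a"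
        define q where "q = b / a * W"
        have ab: "a + b \<noteq> 0" using b by auto
        have W: "W \<noteq> 0" using elim by (simp add: W_def)
        have Vta: "V t a = W / a" by (simp add: V W_def)
        have q: "b * V t a = q" by (simp add: Vta q_def)
        have q0: "q \<noteq> 0" using W b elim by (simp add: q_def)
        have p: "h t a * q = p" using W by (simp add: h W_def[symmetric] p_def q_def)
        have 1: "eval2 (den u) p q \<noteq> 0" "eval2 (den v) p q \<noteq> 0"
            "ev2 u p q = b / (a + b) * ev2 u (t * (a + b)) (a + b)"
            "ev2 v p q = b / (a + b) * ev2 v (t * (a + b)) (a + b)"
          using b(1) by (simp_all add: Let_def p_def q_def W_def)
        have "ev2 v p q \<noteq> 0" using 1(4) b ab by simp
        then have "eval2 (num v) p q \<noteq> 0" by (auto simp: rat_eval_def)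
        then have "eval2 B (h t a) q \<noteq> 0" "eval2 D (h t a) q \<noteq> 0"
          using 1 q0 by (simp_all add: B' D' p)
        moreover have "h (h t a) q = h t (a + b)"
          unfolding h[of "h t a" q] p 1 h[of t "a + b"] using b(3) ab by simp
        moreover have "V t a * V (h t a) q = V t (a + b)"
          unfolding V[of "h t a" q] p 1 V[of t "a + b"] Vta using W elim b(3) ab
          by (simp add: q_def)
        ultimately show ?case unfolding q using W elim by (simp add: Vta)
      qed
    qed
  qed
  have lim_h: "MOST t. (h t \<longlongrightarrow> t) (at 0)"
    using eval2_slices(1)[OF d]
  proof eventually_elim
    case (elim t)
    have "MOST b::real. b \<noteq> 0" by simp
    with elim have "MOST b. eval2 d (t * b) b \<noteq> 0 \<and> b \<noteq> 0" by eventually_elim simp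
    then obtain b where b: "eval2 d (t * b) b \<noteq> 0" "b \<noteq> 0" using MOST_real_ex by blast
    have "((\<lambda>z. h t (b * z)) \<longlongrightarrow> t * b / b) (at 0)"
    proof (rule Lim_transform_eventually)
      show "((\<lambda>z. (1 / z * ev2 u (t * b * z) (b * z)) / (1 / z * ev2 v (t * b * z) (b * z)))
          \<longlongrightarrow> t * b / b) (at 0)"
        by (intro tendsto_divide limu limv b)
      show "\<forall>\<^sub>F z in at 0. (1 / z * ev2 u (t * b * z) (b * z)) / (1 / z * ev2 v (t * b * z) (b * z)) =
          h t (b * z)"
        by (rule MOST_imp_eventually_at, rule eventually_mono[of "\<lambda>z. z \<noteq> 0"])
          (simp_all add: h mult.assoc)
    qed
    then have lim: "((\<lambda>z. h t (b * z)) \<longlongrightarrow> t) (at 0)" using b by simp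
    have "filterlim (\<lambda>q. q / b) (at 0) (at 0)"
    proof (rule filterlim_atI)
      have "((\<lambda>q. q / b) \<longlongrightarrow> 0 / b) (at 0)" by (intro tendsto_intros b)
      then show "((\<lambda>q. q / b) \<longlongrightarrow> 0) (at 0)" by simp
      show "\<forall>\<^sub>F q in at 0. q / b \<noteq> 0"
        by (rule MOST_imp_eventually_at) (use b in simp)
    qed
    from filterlim_compose[OF lim this] show ?case using b by simp
  qed
  have nontriv': "\<not> (MOST t. MOST q. h t q = t \<and> V t q = 1)"
  proof
    assume *: "MOST t. MOST q. h t q = t \<and> V t q = 1"
    have **: "MOST t. MOST q. ev2 u (t * q) q = t * q \<and> ev2 v (t * q) q = q"
      using *
    proof eventually_elim
      case (elim t)
      have "MOST q::real. q \<noteq> 0" by simp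
      with elim show ?case by eventually_elim (auto simp: h V divide_eq_eq)
    qed
    have "u = x2"
      by (rule rep2_MOST_eq[OF rep2_self rep2_x]) (use ** in \<open>auto elim!: MOST2_mono\<close>)
    moreover have "v = y2"
      by (rule rep2_MOST_eq[OF rep2_self rep2_y]) (use ** in \<open>auto elim!: MOST2_mono\<close>)
    ultimately show False using nontriv by simp
  qed
  obtain N \<alpha> \<beta> \<gamma> \<delta> wn wd where det: "\<alpha> * \<delta> - \<beta> * \<gamma> \<noteq> 0" and w0: "wn \<noteq> 0" "wd \<noteq> 0" and
    nf: "MOST t. MOST q. \<gamma> * h t q + \<delta> \<noteq> 0 \<and> \<gamma> * t + \<delta> \<noteq> 0 \<and>
      moebius \<alpha> \<beta> \<gamma> \<delta> (h t q) = moebius \<alpha> \<beta> \<gamma> \<delta> t * (1 + q * (poly wn t / poly wd t)) ^ N \<and>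
      V t q * (poly wn (h t q) / poly wd (h t q)) =
        (poly wn t / poly wd t) / (1 + q * (poly wn t / poly wd t))"
    using real_flow_normal_form[OF nz, of A, folded h_def V_def, OF flow lim_h nontriv'] by blast
  define \<rho> where "\<rho> p = ev2 u (fst p) (snd p) / ev2 v (fst p) (snd p)" for p
  define \<tau> where "\<tau> p = fst p / snd p" for p :: "real \<times> real"
  have rep_r: "pts2.rep r \<rho>" unfolding r_def \<rho>_def by (intro pts2.rep_divide rep2_self)
  have rep_t: "pts2.rep t \<tau>" unfolding t_def \<tau>_def by (intro pts2.rep_divide rep2_x rep2_y)
  have rep_w: "pts2.rep (w wn wd f) (\<lambda>p. poly wn (\<phi> p) / poly wd (\<phi> p))" if "pts2.rep f \<phi>" for f \<phi>
    unfolding w_def by (intro pts2.rep_divide pts2.rep_poly ring_map_const2 rep2_const that)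
  have nf': "MOST t. MOST q. q \<noteq> 0 \<and> \<tau> (t * q, q) = t \<and> \<rho> (t * q, q) = h t q \<and>
      ev2 v (t * q) q = q * V t q \<and> \<gamma> * h t q + \<delta> \<noteq> 0 \<and>
      moebius \<alpha> \<beta> \<gamma> \<delta> (h t q) = moebius \<alpha> \<beta> \<gamma> \<delta> t * (1 + q * (poly wn t / poly wd t)) ^ N \<and>
      V t q * (poly wn (h t q) / poly wd (h t q)) =
        (poly wn t / poly wd t) / (1 + q * (poly wn t / poly wd t))"
    using nf
  proof eventually_elim
    case (elim t)
    have "MOST q::real. q \<noteq> 0" by simp
    with elim show ?case by eventually_elim (simp add: \<tau>_def \<rho>_def h V)
  qed
  have 1: "const2 \<gamma> * r + const2 \<delta> \<noteq> 0"
  proof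
    assume e: "const2 \<gamma> * r + const2 \<delta> = 0"
    have rp: "pts2.rep (const2 \<gamma> * r + const2 \<delta>) (\<lambda>p. \<gamma> * \<rho> p + \<delta>)"
      by (intro pts2.rep_add pts2.rep_mult rep2_const rep_r)
    from zariski2_slices(1)[OF pts2.rep_eq_0[OF rp[unfolded e]]] nf' have "MOST t::real. False"
    proof eventually_elim
      case (elim t)
      then have "MOST q::real. False" by eventually_elim simp
      then show ?case by (simp add: infinite_UNIV_char_0)
    qed
    then show False by (simp add: infinite_UNIV_char_0)
  qed
  have 2: "(const2 \<alpha> * r + const2 \<beta>) / (const2 \<gamma> * r + const2 \<delta>) =
    (const2 \<alpha> * t + const2 \<beta>) / (const2 \<gamma> * t + const2 \<delta>) * (1 + y2 * w wn wd t) ^ N"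
  proof (rule rep2_MOST_eq)
    show "pts2.rep ((const2 \<alpha> * r + const2 \<beta>) / (const2 \<gamma> * r + const2 \<delta>))
        (\<lambda>p. (\<alpha> * \<rho> p + \<beta>) / (\<gamma> * \<rho> p + \<delta>))"
      by (intro pts2.rep_add pts2.rep_mult pts2.rep_divide rep2_const rep_r)
    show "pts2.rep ((const2 \<alpha> * t + const2 \<beta>) / (const2 \<gamma> * t + const2 \<delta>) * (1 + y2 * w wn wd t) ^ N)
        (\<lambda>p. (\<alpha> * \<tau> p + \<beta>) / (\<gamma> * \<tau> p + \<delta>) *
          (1 + snd p * (poly wn (\<tau> p) / poly wd (\<tau> p))) ^ N)"
      by (intro pts2.rep_add pts2.rep_mult pts2.rep_divide pts2.rep_power pts2.rep_1
          rep2_const rep_t rep_w rep2_y)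
    show "MOST t. MOST q. (\<alpha> * \<rho> (t * q, q) + \<beta>) / (\<gamma> * \<rho> (t * q, q) + \<delta>) =
        (\<alpha> * \<tau> (t * q, q) + \<beta>) / (\<gamma> * \<tau> (t * q, q) + \<delta>) *
          (1 + snd (t * q, q) * (poly wn (\<tau> (t * q, q)) / poly wd (\<tau> (t * q, q)))) ^ N"
      using nf' by (rule MOST2_mono) (simp add: moebius_def)
  qed
  have 3: "v * w wn wd r = y2 * w wn wd t / (1 + y2 * w wn wd t)"
  proof (rule rep2_MOST_eq)
    show "pts2.rep (v * w wn wd r) (\<lambda>p. ev2 v (fst p) (snd p) * (poly wn (\<rho> p) / poly wd (\<rho> p)))"
      by (intro pts2.rep_mult rep2_self rep_w rep_r)
    show "pts2.rep (y2 * w wn wd t / (1 + y2 * w wn wd t))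
        (\<lambda>p. snd p * (poly wn (\<tau> p) / poly wd (\<tau> p)) /
          (1 + snd p * (poly wn (\<tau> p) / poly wd (\<tau> p))))"
      by (intro pts2.rep_add pts2.rep_mult pts2.rep_divide pts2.rep_1 rep_t rep_w rep2_y)
    show "MOST t. MOST q. ev2 v (fst (t * q, q)) (snd (t * q, q)) *
          (poly wn (\<rho> (t * q, q)) / poly wd (\<rho> (t * q, q))) =
        snd (t * q, q) * (poly wn (\<tau> (t * q, q)) / poly wd (\<tau> (t * q, q))) /
          (1 + snd (t * q, q) * (poly wn (\<tau> (t * q, q)) / poly wd (\<tau> (t * q, q))))"
      using nf'
    proof (rule MOST2_mono)
      fix t q
      assume *: "q \<noteq> 0 \<and> \<tau> (t * q, q) = t \<and> \<rho> (t * q, q) = h t q \<and>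
        ev2 v (t * q) q = q * V t q \<and> \<gamma> * h t q + \<delta> \<noteq> 0 \<and>
        moebius \<alpha> \<beta> \<gamma> \<delta> (h t q) = moebius \<alpha> \<beta> \<gamma> \<delta> t * (1 + q * (poly wn t / poly wd t)) ^ N \<and>
        V t q * (poly wn (h t q) / poly wd (h t q)) =
          (poly wn t / poly wd t) / (1 + q * (poly wn t / poly wd t))"
      then have "q * (V t q * (poly wn (h t q) / poly wd (h t q))) =
          q * ((poly wn t / poly wd t) / (1 + q * (poly wn t / poly wd t)))" by simp
      then show "ev2 v (fst (t * q, q)) (snd (t * q, q)) *
          (poly wn (\<rho> (t * q, q)) / poly wd (\<rho> (t * q, q))) =
        snd (t * q, q) * (poly wn (\<tau> (t * q, q)) / poly wd (\<tau> (t * q, q))) /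
          (1 + snd (t * q, q) * (poly wn (\<tau> (t * q, q)) / poly wd (\<tau> (t * q, q))))"
        using * by (simp only: fst_conv snd_conv mult.assoc times_divide_eq_right)
    qed
  qed
  show ?thesis using v0 det w0 1 2 3 by blast
qed

section \<open>Existence of the level\<close>

lemma ring_map_divide:
  fixes h :: "'a::field \<Rightarrow> 'b::field"
  assumes h: "ring_map h"
  shows "h (f / g) = h f / h g"
proof (cases "g = 0")
  case True
  then show ?thesis by (simp add: ring_map_0[OF h])
next
  case False
  then have "h (f / g) * h g = h f" "h (1 / g) * h g = 1"
    by (simp_all flip: ring_map_mult[OF h] add: ring_map_1[OF h])
  moreover from this have "h g \<noteq> 0" by auto
  ultimately show ?thesis by (simp add: eq_divide_eq)
qed

text \<open>
  Substitution of an algebraically independent pair is always defined, and it is a homomorphism of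
  fields. It therefore commutes with every formula for a rational function, whereas \<open>rat_eval\<close> is
  tied to the representation in lowest terms.
\<close>

definition independent :: "(real \<Rightarrow> 'a::field) \<Rightarrow> 'a \<Rightarrow> 'a \<Rightarrow> bool" where
  "independent h a b \<longleftrightarrow> (\<forall>d. d \<noteq> 0 \<longrightarrow> bipoly h d a b \<noteq> 0)"

lemma den_neq_0: "den f \<noteq> 0"
  by simp

lemma rat_defined_independent: "independent h a b \<Longrightarrow> rat_defined h f a b"
  unfolding rat_defined_def independent_def using den_neq_0 by blast

lemma rat_eval_fract:
  assumes h: "ring_map h" and ind: "independent h a b" and d: "d \<noteq> 0"
  shows "rat_eval h (to_fract n / to_fract d) a b = bipoly h n a b / bipoly h d a b"
proof -
  define f where "f = to_fract n / to_fract d"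
  have "to_fract (num f * d) = to_fract (n * den f)"
    using num_den[of f] d den_neq_0[of f] unfolding f_def[symmetric]
    by (simp add: f_def field_simps)
  then have "num f * d = n * den f" by (simp only: to_fract_eq_iff)
  then have "bipoly h (num f) a b * bipoly h d a b = bipoly h n a b * bipoly h (den f) a b"
    by (metis ring_map_mult[OF ring_map_bipoly[OF h]])
  moreover have "bipoly h d a b \<noteq> 0" "bipoly h (den f) a b \<noteq> 0"
    using ind d den_neq_0 unfolding independent_def by blast+
  ultimately show ?thesis
    unfolding f_def[symmetric] rat_eval_def by (simp add: frac_eq_eq)
qed

lemma ring_map_rat_eval:
  assumes h: "ring_map h" and ind: "independent h a b"
  shows "ring_map (\<lambda>f. rat_eval h f a b)"
proof -
  let ?b = "\<lambda>p. bipoly h p a b"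
  have b: "?b d \<noteq> 0" if "d \<noteq> 0" for d using ind that unfolding independent_def by blast
  note ev = rat_eval_fract[OF h ind]
  note hom = ring_map_simps[OF ring_map_bipoly[OF h]]
  show ?thesis unfolding ring_map_def
  proof (intro conjI allI)
    show "rat_eval h 1 a b = 1" using ev[of 1 1] by (simp add: hom)
    fix f g :: rat2
    obtain n d where f: "f = to_fract n / to_fract d" "d \<noteq> 0" by (rule fract_cases)
    obtain m e where g: "g = to_fract m / to_fract e" "e \<noteq> 0" by (rule fract_cases)
    have de: "d * e \<noteq> 0" using f g by simp
    have add: "f + g = to_fract (n * e + m * d) / to_fract (d * e)"
      using f g by (simp add: add_frac_eq)
    have "rat_eval h (f + g) a b = ?b (n * e + m * d) / ?b (d * e)"
      unfolding add by (rule ev[OF de])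
    then show "rat_eval h (f + g) a b = rat_eval h f a b + rat_eval h g a b"
      using f g b[of d] b[of e] by (simp add: ev hom add_frac_eq)
    have mult: "f * g = to_fract (n * m) / to_fract (d * e)" using f g by simp
    have "rat_eval h (f * g) a b = ?b (n * m) / ?b (d * e)"
      unfolding mult by (rule ev[OF de])
    then show "rat_eval h (f * g) a b = rat_eval h f a b * rat_eval h g a b"
      using f g by (simp add: ev hom)
  qed
qed

lemma rat_eval_gens:
  assumes h: "ring_map h"
  shows "rat_eval h x2 a b = a" "rat_eval h y2 a b = b" "rat_eval h (const2 c) a b = h c"
  using ring_map_1[OF ring_map_bipoly[OF h]]
  by (simp_all add: rat_eval_def x2_def y2_def const2_def bipoly_const[OF h] bipoly_X[OF h] bipoly_Y[OF h])

lemma rat_eval_poly: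
  assumes h: "ring_map h" and ind: "independent h a b"
  shows "rat_eval h (poly (map_poly const2 p) f) a b = poly (map_poly h p) (rat_eval h f a b)"
  using ring_map_poly_comp[OF ring_map_rat_eval[OF h ind] ring_map_const2, of p f]
  by (simp add: rat_eval_gens[OF h])

lemmas rat_eval_hom = ring_map_simps[OF ring_map_rat_eval] ring_map_divide[OF ring_map_rat_eval]
  rat_eval_gens rat_eval_poly

lemma independent2I:
  assumes f: "pts2.rep f \<phi>" and g: "pts2.rep g \<psi>"
    and d: "\<And>d. d \<noteq> 0 \<Longrightarrow> (MOST t. MOST y. eval2 d (\<phi> (t * y, y)) (\<psi> (t * y, y)) \<noteq> 0) \<or>
      (MOST y. MOST t. eval2 d (\<phi> (t * y, y)) (\<psi> (t * y, y)) \<noteq> 0)"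
  shows "independent const2 f g"
  unfolding independent_def
proof (intro allI impI notI)
  fix e assume e: "e \<noteq> 0" "bipoly const2 e f g = 0"
  have "pts2.rep 0 (\<lambda>p. eval2 e (\<phi> p) (\<psi> p))"
    unfolding e(2)[symmetric] by (intro pts2.rep_bipoly ring_map_const2 rep2_const f g)
  note sl = zariski2_slices[OF pts2.rep_eq_0[OF this]]
  have contra: False if "MOST a. MOST b. P a b" "MOST a. MOST b. \<not> P a b" for P :: "real \<Rightarrow> real \<Rightarrow> bool"
  proof -
    from that have "MOST a::real. False"
    proof eventually_elim
      case (elim a)
      then have "MOST b::real. False" by eventually_elim simp
      then show ?case by (simp add: infinite_UNIV_char_0)
    qed
    then show False by (simp add: infinite_UNIV_char_0)
  qed
  from d[OF e(1)] show False using contra[OF sl(1)] contra[OF sl(2)] by blast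
qed

text \<open>
  In polar coordinates \<open>(t, y)\<close> the map acts on the slope by \<open>T\<close> and on the fibre over \<open>t\<close> by
  multiplication with \<open>w t\<close>, so it takes generic points to generic points.
\<close>

lemma independent2_fibred:
  assumes f: "pts2.rep f \<phi>" and g: "pts2.rep g \<psi>"
    and T: "\<And>c. MOST t. T t \<noteq> c" and w: "MOST t. w t \<noteq> 0"
    and eq: "MOST t. MOST y. \<phi> (t * y, y) = T t * (y * w t) \<and> \<psi> (t * y, y) = y * w t"
  shows "independent const2 f g"
proof (rule independent2I[OF f g], rule disjI1)
  fix d :: "real poly poly" assume "d \<noteq> 0"
  from MOST_compose[OF T eval2_slices(1)[OF this]] w eq
  show "MOST t. MOST y. eval2 d (\<phi> (t * y, y)) (\<psi> (t * y, y)) \<noteq> 0"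
  proof eventually_elim
    case (elim t)
    from MOST_scale[OF elim(1,2)] elim(3) show ?case by eventually_elim simp
  qed
qed

lemma moebius_finite_to_one:
  assumes "\<alpha> * \<delta> - \<beta> * \<gamma> \<noteq> 0"
  shows "MOST t. moebius \<alpha> \<beta> \<gamma> \<delta> t \<noteq> c"
proof -
  have 1: "[:\<delta>, \<gamma>:] \<noteq> 0" using assms by auto
  have 2: "[:\<beta> - c * \<delta>, \<alpha> - c * \<gamma>:] \<noteq> 0"
  proof
    assume "[:\<beta> - c * \<delta>, \<alpha> - c * \<gamma>:] = 0"
    then have "\<beta> = c * \<delta>" "\<alpha> = c * \<gamma>" by auto
    then show False using assms by simp
  qed
  from poly_MOST[OF 1] poly_MOST[OF 2] show ?thesis
    by eventually_elim (auto simp: moebius_def field_simps)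
qed

lemma phi_level_eq:
  "phi_level N = (x2 * ((y2 + 1) ^ N / (y2 + 1)), y2 / (y2 + 1))"
proof -
  have "y2 + 1 \<noteq> 0"
  proof -
    have "y2 + 1 = to_fract [:1, 1:]"
      unfolding y2_def to_fract_1[symmetric] to_fract_add[symmetric] one_pCons by simp
    then show ?thesis by simp
  qed
  then show ?thesis by (simp add: phi_level_def power_int_diff)
qed

text \<open>
  The model map respects the fibration by \<open>y\<close>, not the one by the slope.
\<close>

lemma independent_phi_level:
  "independent const2 (fst (phi_level N)) (snd (phi_level N))"
proof (rule independent2I)
  show "pts2.rep (fst (phi_level N)) (\<lambda>p. fst p * ((snd p + 1) ^ N / (snd p + 1)))"
    unfolding phi_level_eq fst_conv
    by (intro pts2.rep_mult pts2.rep_divide pts2.rep_power pts2.rep_add pts2.rep_1 rep2_x rep2_y)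
  show "pts2.rep (snd (phi_level N)) (\<lambda>p. snd p / (snd p + 1))"
    unfolding phi_level_eq snd_conv
    by (intro pts2.rep_divide pts2.rep_add pts2.rep_1 rep2_y)
  fix d :: "real poly poly" assume d: "d \<noteq> 0"
  have "MOST y. y / (y + 1) \<noteq> c" for c :: real
    using moebius_finite_to_one[of 1 1 0 1 c] by (simp add: moebius_def)
  from MOST_compose[OF this eval2_slices(2)[OF d]]
  have "MOST y. MOST t. eval2 d (t * (y / (y + 1))) (y / (y + 1)) \<noteq> 0" .
  moreover have "MOST y. y \<noteq> - (1::real)" by simp
  ultimately have "MOST y. MOST t. eval2 d (t * y * ((y + 1) ^ N / (y + 1))) (y / (y + 1)) \<noteq> 0"
  proof eventually_elim
    case (elim y)
    then have "(y + 1) ^ N \<noteq> 0" by simp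
    from MOST_scale[OF elim(1) this] show ?case by (simp add: mult_ac)
  qed
  then show "(MOST t. MOST y. eval2 d (fst (t * y, y) * ((snd (t * y, y) + 1) ^ N /
        (snd (t * y, y) + 1))) (snd (t * y, y) / (snd (t * y, y) + 1)) \<noteq> 0) \<or>
      (MOST y. MOST t. eval2 d (fst (t * y, y) * ((snd (t * y, y) + 1) ^ N /
        (snd (t * y, y) + 1))) (snd (t * y, y) / (snd (t * y, y) + 1)) \<noteq> 0)"
    by simp
qed

lemma independent3I:
  assumes f: "pts3.rep f \<phi>" and g: "pts3.rep g \<psi>"
    and d: "\<And>d. d \<noteq> 0 \<Longrightarrow> MOST t. MOST a. MOST b.
      eval2 d (\<phi> ((t * (a + b), a + b), a / (a + b))) (\<psi> ((t * (a + b), a + b), a / (a + b))) \<noteq> 0"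
  shows "independent const3 f g"
  unfolding independent_def
proof (intro allI impI notI)
  fix e assume e: "e \<noteq> 0" "bipoly const3 e f g = 0"
  have "pts3.rep 0 (\<lambda>p. eval2 e (\<phi> p) (\<psi> p))"
    unfolding e(2)[symmetric] by (intro pts3.rep_bipoly ring_map_const3 rep3_const f g)
  from zariski3_slices[OF pts3.rep_eq_0[OF this]] d[OF e(1)] have "MOST t::real. False"
  proof eventually_elim
    case (elim t)
    then have "MOST a::real. False"
    proof eventually_elim
      case (elim a)
      then have "MOST b::real. False" by eventually_elim simp
      then show ?case by (simp add: infinite_UNIV_char_0)
    qed
    then show ?case by (simp add: infinite_UNIV_char_0)
  qed
  then show False by (simp add: infinite_UNIV_char_0)
qed

lemma independent_x3_y3: "independent const3 x3 y3"
proof (rule independent3I[OF rep3_x rep3_y])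
  fix d :: "real poly poly" assume "d \<noteq> 0"
  from eval2_slices(1)[OF this]
  show "MOST t. MOST a. MOST b.
      eval2 d (fst (fst ((t * (a + b), a + b), a / (a + b))))
        (snd (fst ((t * (a + b), a + b), a / (a + b)))) \<noteq> 0"
  proof (rule eventually_mono)
    fix t assume *: "MOST y. eval2 d (t * y) y \<noteq> 0"
    show "MOST a. MOST b.
      eval2 d (fst (fst ((t * (a + b), a + b), a / (a + b))))
        (snd (fst ((t * (a + b), a + b), a / (a + b)))) \<noteq> 0"
      using MOST_shift[OF *] by (simp add: always_eventually)
  qed
qed

lemma independent_z3x3_z3y3: "independent const3 (z3 * x3) (z3 * y3)"
proof (rule independent3I)
  show "pts3.rep (z3 * x3) (\<lambda>p. snd p * fst (fst p))" "pts3.rep (z3 * y3) (\<lambda>p. snd p * snd (fst p))"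
    by (intro pts3.rep_mult rep3_x rep3_y rep3_z)+
  fix d :: "real poly poly" assume "d \<noteq> 0"
  from eval2_slices(1)[OF this]
  show "MOST t. MOST a. MOST b.
      eval2 d (snd ((t * (a + b), a + b), a / (a + b)) * fst (fst ((t * (a + b), a + b), a / (a + b))))
        (snd ((t * (a + b), a + b), a / (a + b)) * snd (fst ((t * (a + b), a + b), a / (a + b)))) \<noteq> 0"
  proof (rule MOST2_mono)
    fix t a assume *: "eval2 d (t * a) a \<noteq> 0"
    have "MOST b. b \<noteq> - a" by simp
    then show "MOST b.
      eval2 d (snd ((t * (a + b), a + b), a / (a + b)) * fst (fst ((t * (a + b), a + b), a / (a + b))))
        (snd ((t * (a + b), a + b), a / (a + b)) * snd (fst ((t * (a + b), a + b), a / (a + b)))) \<noteq> 0"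
    proof eventually_elim
      case (elim b)
      then have "a + b \<noteq> 0" by auto
      then show ?case using * by (simp add: mult.commute)
    qed
  qed
qed

lemma moebius_inverse:
  fixes \<alpha> \<beta> \<gamma> \<delta> f :: "'a::field"
  assumes "\<alpha> * \<delta> - \<beta> * \<gamma> \<noteq> 0" "\<gamma> * f + \<delta> \<noteq> 0"
  shows "(\<delta> * ((\<alpha> * f + \<beta>) / (\<gamma> * f + \<delta>)) - \<beta>) / (\<alpha> - \<gamma> * ((\<alpha> * f + \<beta>) / (\<gamma> * f + \<delta>))) = f"
proof -
  define q where "q = \<gamma> * f + \<delta>"
  have q: "q \<noteq> 0" using assms by (simp add: q_def)
  have 1: "\<delta> * ((\<alpha> * f + \<beta>) / q) - \<beta> = (\<alpha> * \<delta> - \<beta> * \<gamma>) * f / q"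
    using q by (simp add: eq_divide_eq left_diff_distrib) (simp add: q_def algebra_simps)
  have 2: "\<alpha> - \<gamma> * ((\<alpha> * f + \<beta>) / q) = (\<alpha> * \<delta> - \<beta> * \<gamma>) / q"
    using q by (simp add: eq_divide_eq left_diff_distrib) (simp add: q_def algebra_simps)
  show ?thesis unfolding q_def[symmetric] 1 2 using assms(1) q by simp
qed

text \<open>
  With \<open>M\<close> and \<open>w\<close> from the normal form, the transformation \<open>(x, y) \<mapsto> (y w(t) M(t), y w(t))\<close> for
  \<open>t = x / y\<close> is a \<open>1\<close>-BIR: in polar coordinates its inverse applies \<open>M\<^sup>-\<^sup>1\<close> to the slope and then divides
  by the value of \<open>w\<close> there. The two identities of the normal form say that it conjugates \<open>\<phi>\<close>
  to the model map.
\<close>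

theorem level_exists:
  assumes eq: "translation_equation (u, v)" and bnd: "boundary_condition (u, v)"
    and nontriv: "(u, v) \<noteq> (x2, y2)"
  shows "\<exists>N. has_level (u, v) N"
proof -
  define r where "r = u / v"
  define t where "t = x2 / y2"
  define W where "W wn wd f = poly (map_poly const2 wn) f / poly (map_poly const2 wd) f" for wn wd f
  obtain N \<alpha> \<beta> \<gamma> \<delta> wn wd where v0: "v \<noteq> 0" and det: "\<alpha> * \<delta> - \<beta> * \<gamma> \<noteq> 0" and
    w0: "wn \<noteq> 0" "wd \<noteq> 0" and r0: "const2 \<gamma> * r + const2 \<delta> \<noteq> 0" and
    I1: "(const2 \<alpha> * r + const2 \<beta>) / (const2 \<gamma> * r + const2 \<delta>) =
      (const2 \<alpha> * t + const2 \<beta>) / (const2 \<gamma> * t + const2 \<delta>) * (1 + y2 * W wn wd t) ^ N" and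
    I2: "v * W wn wd r = y2 * W wn wd t / (1 + y2 * W wn wd t)"
    using rat_flow_normal_form[OF eq bnd nontriv] unfolding r_def t_def W_def by blast
  define w where "w = W wn wd"
  define M where "M f = (const2 \<alpha> * f + const2 \<beta>) / (const2 \<gamma> * f + const2 \<delta>)" for f
  define M' where "M' f = (const2 \<delta> * f - const2 \<beta>) / (const2 \<alpha> - const2 \<gamma> * f)" for f
  define m where "m = moebius \<alpha> \<beta> \<gamma> \<delta>"
  define m' where "m' = moebius \<delta> (- \<beta>) (- \<gamma>) \<alpha>"
  define \<omega> where "\<omega> s = poly wn s / poly wd s" for s
  have m: "MOST s. m s \<noteq> c" for c unfolding m_def by (rule moebius_finite_to_one[OF det])
  have m': "MOST s. m' s \<noteq> c" for c
    unfolding m'_def by (rule moebius_finite_to_one) (use det in \<open>simp add: mult.commute\<close>)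
  have \<omega>: "MOST s. \<omega> s \<noteq> 0"
    using w0[THEN poly_MOST] by eventually_elim (simp add: \<omega>_def)
  have det2: "const2 \<alpha> * const2 \<delta> - const2 \<beta> * const2 \<gamma> \<noteq> 0"
    using det by (simp add: const2_def flip: to_fract_mult to_fract_diff)
  define L1 L2 where "L1 = y2 * w t * M t" and "L2 = y2 * w t"
  define K1 K2 where "K1 = y2 / w (M' t) * M' t" and "K2 = y2 / w (M' t)"
  have rep_t: "pts2.rep t (\<lambda>p. fst p / snd p)"
    unfolding t_def by (intro pts2.rep_divide rep2_x rep2_y)
  have rep_w: "pts2.rep (w f) (\<lambda>p. \<omega> (\<phi> p))" if "pts2.rep f \<phi>" for f \<phi>
    unfolding w_def W_def \<omega>_def by (intro pts2.rep_divide pts2.rep_poly ring_map_const2 rep2_const that)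
  have rep_M: "pts2.rep (M t) (\<lambda>p. m (fst p / snd p))"
    unfolding M_def m_def moebius_def
    by (intro pts2.rep_divide pts2.rep_add pts2.rep_mult rep2_const rep_t)
  have "pts2.rep (M' t) (\<lambda>p. (\<delta> * (fst p / snd p) - \<beta>) / (\<alpha> - \<gamma> * (fst p / snd p)))"
    unfolding M'_def by (intro pts2.rep_divide pts2.rep_diff pts2.rep_mult rep2_const rep_t)
  then have rep_M': "pts2.rep (M' t) (\<lambda>p. m' (fst p / snd p))"
    unfolding m'_def moebius_def by simp
  have y0: "MOST t. MOST y. (y::real) \<noteq> 0" by simp
  have indL: "independent const2 L1 L2"
  proof (rule independent2_fibred[OF _ _ m \<omega>])
    show "pts2.rep L1 (\<lambda>p. snd p * \<omega> (fst p / snd p) * m (fst p / snd p))"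
      unfolding L1_def by (intro pts2.rep_mult rep2_y rep_w rep_t rep_M)
    show "pts2.rep L2 (\<lambda>p. snd p * \<omega> (fst p / snd p))"
      unfolding L2_def by (intro pts2.rep_mult rep2_y rep_w rep_t)
    show "MOST t. MOST y. snd (t * y, y) * \<omega> (fst (t * y, y) / snd (t * y, y)) *
          m (fst (t * y, y) / snd (t * y, y)) = m t * (y * \<omega> t) \<and>
        snd (t * y, y) * \<omega> (fst (t * y, y) / snd (t * y, y)) = y * \<omega> t"
      using y0 by (rule MOST2_mono) simp
  qed
  have indK: "independent const2 K1 K2"
  proof (rule independent2_fibred[OF _ _ m'])
    show "MOST s. 1 / \<omega> (m' s) \<noteq> 0" using MOST_compose[OF m' \<omega>] by simp
    show "pts2.rep K1 (\<lambda>p. snd p / \<omega> (m' (fst p / snd p)) * m' (fst p / snd p))"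
      unfolding K1_def by (intro pts2.rep_mult pts2.rep_divide rep2_y rep_w rep_M')
    show "pts2.rep K2 (\<lambda>p. snd p / \<omega> (m' (fst p / snd p)))"
      unfolding K2_def by (intro pts2.rep_divide rep2_y rep_w rep_M')
    show "MOST t. MOST y. snd (t * y, y) / \<omega> (m' (fst (t * y, y) / snd (t * y, y))) *
          m' (fst (t * y, y) / snd (t * y, y)) = m' t * (y * (1 / \<omega> (m' t))) \<and>
        snd (t * y, y) / \<omega> (m' (fst (t * y, y) / snd (t * y, y))) = y * (1 / \<omega> (m' t))"
      using y0 by (rule MOST2_mono) simp
  qed
  have indep_neq_0: "g \<noteq> 0" "g + 1 \<noteq> 0" if "independent const2 f g" for f g
  proof -
    have "bipoly const2 [:0, 1:] f g \<noteq> 0" "bipoly const2 [:1, 1:] f g \<noteq> 0"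
      using that unfolding independent_def by simp_all
    moreover have "[:1, 1:] = 1 + [:0, 1::real poly:]" by (simp add: one_pCons)
    ultimately show "g \<noteq> 0" "g + 1 \<noteq> 0"
      using bipoly_Y[OF ring_map_const2, of f g]
      by (simp_all add: ring_map_simps[OF ring_map_bipoly[OF ring_map_const2]] add.commute
          del: add_pCons)
  qed
  have L0: "L2 \<noteq> 0" "L2 + 1 \<noteq> 0" by (rule indep_neq_0[OF indL])+
  have K0: "K2 \<noteq> 0" by (rule indep_neq_0(1)[OF indK])
  have wt0: "w t \<noteq> 0" and wM': "w (M' t) \<noteq> 0" and y20: "y2 \<noteq> 0"
    using L0 K0 by (auto simp: L2_def K2_def)
  have nz: "const2 \<gamma> * t + const2 \<delta> \<noteq> 0" "const2 \<alpha> - const2 \<gamma> * t \<noteq> 0"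
  proof -
    have "const2 c * t + const2 d \<noteq> 0" if "c \<noteq> 0 \<or> d \<noteq> 0" for c d
    proof
      assume "const2 c * t + const2 d = 0"
      then have "const2 c * x2 + const2 d * y2 = 0"
        using y20 by (simp add: t_def field_simps)
      then have "to_fract [:[:0, c:], [:d:]:] = 0"
        unfolding const2_def x2_def y2_def
        by (simp flip: to_fract_mult to_fract_add del: to_fract_eq_0_iff)
      then show False using that by simp
    qed
    note lin = this
    show "const2 \<gamma> * t + const2 \<delta> \<noteq> 0" by (rule lin) (use det in auto)
    have "const2 (- \<gamma>) * t + const2 \<alpha> \<noteq> 0" by (rule lin) (use det in auto)
    then show "const2 \<alpha> - const2 \<gamma> * t \<noteq> 0" by (simp add: ring_map_uminus[OF ring_map_const2])
  qed
  have M'M: "M' (M f) = f" if "const2 \<gamma> * f + const2 \<delta> \<noteq> 0" for f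
    unfolding M_def M'_def by (rule moebius_inverse[OF det2 that])
  have MM': "M (M' t) = t"
    using moebius_inverse[of "const2 \<delta>" "const2 \<alpha>" "- const2 \<beta>" "- const2 \<gamma>" t] det2 nz(2)
    by (simp add: M_def M'_def mult.commute add.commute)
  have ratio: "L1 / L2 = M t" "K1 / K2 = M' t"
    using L0 K0 by (simp_all add: L1_def L2_def K1_def K2_def)
  note hom = rat_eval_hom[OF ring_map_const2]
  have sub: "rat_eval const2 (M f) a b = M (rat_eval const2 f a b)"
      "rat_eval const2 (M' f) a b = M' (rat_eval const2 f a b)"
      "rat_eval const2 (w f) a b = w (rat_eval const2 f a b)"
      "rat_eval const2 t a b = a / b"
      "rat_eval const2 L1 a b = b * w (a / b) * M (a / b)" "rat_eval const2 L2 a b = b * w (a / b)"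
      "rat_eval const2 K1 a b = b / w (M' (a / b)) * M' (a / b)"
      "rat_eval const2 K2 a b = b / w (M' (a / b))"
    if "independent const2 a b" for a b f
    using that by (simp_all add: M_def M'_def w_def W_def t_def hom L1_def L2_def K1_def K2_def)
  have comp: "composable F (a, b)" if "independent const2 a b" for F a b
    unfolding composable_def map_defined_def using rat_defined_independent[OF that] by simp
  have LK: "rat_comp (L1, L2) (K1, K2) = (x2, y2)"
    using wM' y20 by (simp add: rat_comp_def map_eval_def sub[OF indK] ratio MM') (simp add: K2_def t_def)
  have KL: "rat_comp (K1, K2) (L1, L2) = (x2, y2)"
    using wt0 y20 by (simp add: rat_comp_def map_eval_def sub[OF indL] ratio M'M[OF nz(1)])
      (simp add: L2_def t_def)
  have inv: "mutually_inverse (L1, L2) (K1, K2)"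
    unfolding mutually_inverse_def using LK KL comp[OF indK] comp[OF indL] by blast
  define w3 where "w3 f = poly (map_poly const3 wn) f / poly (map_poly const3 wd) f" for f
  define M3 where "M3 f = (const3 \<alpha> * f + const3 \<beta>) / (const3 \<gamma> * f + const3 \<delta>)" for f
  have sub3: "rat_eval const3 L1 a b = b * w3 (a / b) * M3 (a / b)"
      "rat_eval const3 L2 a b = b * w3 (a / b)" if "independent const3 a b" for a b
    using that by (simp_all add: M_def M3_def w3_def w_def W_def t_def rat_eval_hom[OF ring_map_const3]
        L1_def L2_def)
  have z30: "z3 \<noteq> 0" by (simp add: z3_def)
  have "homogeneous1 L1" "homogeneous1 L2"
    unfolding homogeneous1_def sub3[OF independent_x3_y3] sub3[OF independent_z3x3_z3y3]
    using z30 by simp_all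
  then have BIR: "one_BIR (L1, L2)"
    unfolding one_BIR_def birational_def using inv by auto
  define G1 G2 where "G1 = L1 * ((L2 + 1) ^ N / (L2 + 1))" and "G2 = L2 / (L2 + 1)"
  have G: "rat_comp (phi_level N) (L1, L2) = (G1, G2)"
    unfolding rat_comp_def map_eval_def phi_level_eq using indL
    by (simp add: hom G1_def G2_def)
  have indG: "independent const2 G1 G2"
  proof -
    have "bipoly const2 d G1 G2 \<noteq> 0" if "d \<noteq> 0" for d
    proof -
      let ?\<sigma> = "\<lambda>f. rat_eval const2 f L1 L2"
      have \<sigma>: "ring_map ?\<sigma>" by (rule ring_map_rat_eval[OF ring_map_const2 indL])
      have "?\<sigma> (bipoly const2 d (fst (phi_level N)) (snd (phi_level N))) = bipoly const2 d G1 G2"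
        using G by (simp add: ring_map_bipoly_comp[OF \<sigma> ring_map_const2] hom rat_comp_def map_eval_def)
      moreover have "bipoly const2 d (fst (phi_level N)) (snd (phi_level N)) \<noteq> 0"
        using independent_phi_level that unfolding independent_def by blast
      moreover have "?\<sigma> f \<noteq> 0" if "f \<noteq> 0" for f
        using ring_map_mult[OF \<sigma>, of f "1 / f"] ring_map_1[OF \<sigma>] that by auto
      ultimately show ?thesis by metis
    qed
    then show ?thesis unfolding independent_def by blast
  qed
  have "G1 / G2 = L1 / L2 * (1 + L2) ^ N"
    unfolding G1_def G2_def add.commute[of L2] using L0(2) by (simp add: add.commute)
  also have "\<dots> = M r"
    unfolding ratio using I1 by (simp add: M_def L2_def w_def)
  finally have G12: "G1 / G2 = M r" .
  have G2: "G2 = v * w r"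
    using I2 by (simp add: G2_def L2_def w_def add.commute)
  have G20: "G2 \<noteq> 0" using L0 by (simp add: G2_def)
  then have wr: "w r \<noteq> 0" using G2 by auto
  have "rat_eval const2 K2 G1 G2 = v"
    unfolding sub(8)[OF indG] G12 M'M[OF r0] using G2 wr by simp
  moreover have "rat_eval const2 K1 G1 G2 = u"
    unfolding sub(7)[OF indG] G12 M'M[OF r0] using G2 wr v0 by (simp add: r_def)
  ultimately have "rat_comp (K1, K2) (G1, G2) = (u, v)"
    by (simp add: rat_comp_def map_eval_def)
  then have "has_level (u, v) N"
    unfolding has_level_def using BIR inv comp[OF indL] comp[OF indG] G by metis
  then show ?thesis ..
qed

section \<open>Uniqueness of the level\<close>

text \<open>
  For each slope \<open>t\<close> the ratio of \<open>L(tq, q)\<close> to \<open>q\<close> is constant in \<open>q\<close>; evaluation at one suitable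
  \<open>q = c\<close>, the same for all \<open>t\<close>, shows that the constant is a rational function of \<open>t\<close>.
\<close>

lemma homogeneous1_polar:
  assumes "homogeneous1 L"
  shows "\<exists>n d. d \<noteq> 0 \<and> (MOST t. MOST y. ev2 L (t * y) y = y * (poly n t / poly d t))"
proof -
  have 1: "pts3.rep (rat_eval const3 L (z3 * x3) (z3 * y3))
      (\<lambda>p. ev2 L (snd p * fst (fst p)) (snd p * snd (fst p)))"
    by (intro pts3.rep_rat_eval ring_map_const3 rep3_const pts3.rep_mult rep3_x rep3_y rep3_z)
  have 2: "pts3.rep (z3 * rat_eval const3 L x3 y3)
      (\<lambda>p. snd p * ev2 L (fst (fst p)) (snd (fst p)))"
    by (intro pts3.rep_rat_eval ring_map_const3 rep3_const pts3.rep_mult rep3_x rep3_y rep3_z)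
  note hom = zariski3_slices[OF pts3.rep_unique[OF 1[unfolded assms[unfolded homogeneous1_def]] 2],
      unfolded fst_conv snd_conv]
  note slice = eval2_slices[OF den_neq_0[of L]]
  have "MOST y::real. y \<noteq> 0" by simp
  with slice(2) have "MOST y. (MOST t. eval2 (den L) (t * y) y \<noteq> 0) \<and> y \<noteq> 0"
    by eventually_elim simp
  then obtain c where c: "MOST t. eval2 (den L) (t * c) c \<noteq> 0" "c \<noteq> 0"
    using MOST_real_ex by blast
  have "polyfun (\<lambda>t. eval2 (num L) (t * c) c)" "polyfun (\<lambda>t. c * eval2 (den L) (t * c) c)"
    by (intro polyfun_intros)+
  then obtain n d where n: "\<And>t. poly n t = eval2 (num L) (t * c) c"
    and d: "\<And>t. poly d t = c * eval2 (den L) (t * c) c"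
    unfolding polyfun_def by metis
  have "d \<noteq> 0" using MOST_real_ex[OF c(1)] d c(2) by auto
  moreover have "MOST t. MOST y. ev2 L (t * y) y = y * (poly n t / poly d t)"
    using hom c(1) slice(1)
  proof eventually_elim
    case (elim t)
    have "MOST y::real. y \<noteq> 0" by simp
    with elim(1) have "MOST a. (MOST b. ev2 L (a / (a + b) * (t * (a + b))) (a / (a + b) * (a + b)) =
        a / (a + b) * ev2 L (t * (a + b)) (a + b)) \<and> a \<noteq> 0"
      by eventually_elim simp
    then obtain a where a: "a \<noteq> 0" "MOST b. ev2 L (a / (a + b) * (t * (a + b))) (a / (a + b) * (a + b)) =
        a / (a + b) * ev2 L (t * (a + b)) (a + b)"
      using MOST_real_ex by blast
    define k where "k = ev2 L (t * a) a / a"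
    have "MOST y. ev2 L (a / y * (t * y)) (a / y * y) = a / y * ev2 L (t * y) y"
      using MOST_shift[OF a(2), of "- a"] by simp
    moreover have "MOST y::real. y \<noteq> 0" by simp
    ultimately have k: "MOST y. ev2 L (t * y) y = y * k"
    proof eventually_elim
      case (elim y)
      then show ?case using a(1) by (simp add: k_def mult.commute[of t])
    qed
    from k elim(3) have "MOST y. eval2 (num L) (t * y) y = y * k * eval2 (den L) (t * y) y"
      by eventually_elim (simp add: rat_eval_def divide_eq_eq)
    then have "eval2 (num L) (t * c) c = c * k * eval2 (den L) (t * c) c"
      by (rule polyfun_eq[rotated 2]) (intro polyfun_intros)+
    then have "k = poly n t / poly d t"
      unfolding n d using elim(2) c(2) by simp
    with k show ?case by simp
  qed
  ultimately show ?thesis by blast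
qed

text \<open>
  What a conjugation of level \<open>N\<close> leaves of the flow on slopes: an action \<open>T\<close> of \<open>\<l>\<close> on slopes, a
  rational left inverse \<open>X/Z\<close> of \<open>T\<close>, which exists because \<open>\<l>\<close> is invertible, and the \<open>N\<close>-th power of
  an affine function of the time.
\<close>

lemma level_data:
  assumes "has_level (u, v) N"
  defines "h \<equiv> \<lambda>t y. ev2 u (t * y) y / ev2 v (t * y) y"
  shows "\<exists>Tn Td wn wd X Z. wn \<noteq> 0 \<and> wd \<noteq> 0 \<and> Z \<noteq> 0 \<and>
    (\<forall>c. MOST t. poly Tn t / poly Td t \<noteq> c) \<and>
    (MOST t. poly X (poly Tn t / poly Td t) = t * poly Z (poly Tn t / poly Td t)) \<and>
    (MOST t. MOST y. poly Tn (h t y) / poly Td (h t y) =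
      poly Tn t / poly Td t * (1 + y * (poly wn t / poly wd t)) ^ N)"
proof -
  obtain L1 L2 K1 K2 where BIR: "one_BIR (L1, L2)" and inv: "mutually_inverse (L1, L2) (K1, K2)"
    and comp: "composable (K1, K2) (rat_comp (phi_level N) (L1, L2))"
    and uv: "(u, v) = rat_comp (K1, K2) (rat_comp (phi_level N) (L1, L2))"
    using assms(1) unfolding has_level_def by (metis surj_pair)
  have KL: "rat_eval const2 K1 L1 L2 = x2" "rat_eval const2 K2 L1 L2 = y2"
    and LK: "rat_eval const2 L1 K1 K2 = x2" "rat_eval const2 L2 K1 K2 = y2"
    using inv by (simp_all add: mutually_inverse_def rat_comp_def map_eval_def)
  have y20: "y2 \<noteq> 0" by (simp add: y2_def)
  define t where "t = x2 / y2"
  define \<tau> where "\<tau> p = fst p / snd p" for p :: "real \<times> real"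
  define pw where "pw p = poly (map_poly const2 p)" for p
  have rep_t: "pts2.rep t \<tau>" unfolding t_def \<tau>_def by (intro pts2.rep_divide rep2_x rep2_y)
  have rep_pw: "pts2.rep (pw p f) (\<lambda>q. poly p (\<phi> q))" if "pts2.rep f \<phi>" for p f \<phi>
    unfolding pw_def by (intro pts2.rep_poly ring_map_const2 rep2_const that)
  obtain n1 d1 where d1: "d1 \<noteq> 0" and L1: "MOST t. MOST y. ev2 L1 (t * y) y = y * (poly n1 t / poly d1 t)"
    using homogeneous1_polar BIR unfolding one_BIR_def fst_conv by blast
  obtain n2 d2 where d2: "d2 \<noteq> 0" and L2: "MOST t. MOST y. ev2 L2 (t * y) y = y * (poly n2 t / poly d2 t)"
    using homogeneous1_polar BIR unfolding one_BIR_def snd_conv by blast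
  have polar: "L = y2 * (pw n t / pw d t)"
    if "MOST t. MOST y. ev2 L (t * y) y = y * (poly n t / poly d t)" for L n d
  proof (rule rep2_MOST_eq[OF rep2_self])
    show "pts2.rep (y2 * (pw n t / pw d t)) (\<lambda>p. snd p * (poly n (\<tau> p) / poly d (\<tau> p)))"
      by (intro pts2.rep_mult pts2.rep_divide rep2_y rep_pw rep_t)
    show "MOST t. MOST y. ev2 L (fst (t * y, y)) (snd (t * y, y)) =
        snd (t * y, y) * (poly n (\<tau> (t * y, y)) / poly d (\<tau> (t * y, y)))"
      using that
    proof eventually_elim
      case (elim t)
      have "MOST y::real. y \<noteq> 0" by simp
      with elim show ?case by eventually_elim (simp add: \<tau>_def)
    qed
  qed
  have L20: "L2 \<noteq> 0"
  proof
    assume "L2 = 0"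
    then have "rat_eval const2 L2 K1 K2 = 0"
      by (simp add: rat_eval_def quot_of_fract_0 bipoly_def)
    then show False using LK y20 by simp
  qed
  have n2: "n2 \<noteq> 0" using polar[OF L2] L20 by (auto simp: pw_def)
  define Tn Td where "Tn = n1 * d2" and "Td = d1 * n2"
  define T where "T t = poly Tn t / poly Td t" for t
  define \<omega> where "\<omega> t = poly n2 t / poly d2 t" for t
  have Td0: "Td \<noteq> 0" using d1 n2 by (simp add: Td_def)
  have \<omega>: "MOST t. \<omega> t \<noteq> 0"
    using poly_MOST[OF d2] poly_MOST[OF n2] by eventually_elim (simp add: \<omega>_def)
  have L12: "MOST t. MOST y. ev2 L1 (t * y) y = T t * (y * \<omega> t) \<and> ev2 L2 (t * y) y = y * \<omega> t"
    using L1 L2 poly_MOST[OF d1] poly_MOST[OF d2] poly_MOST[OF n2]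
  proof eventually_elim
    case (elim t)
    have eq: "poly n1 t / poly d1 t = T t * \<omega> t"
      using elim by (simp add: T_def Tn_def Td_def \<omega>_def)
    from elim(1,2) show ?case
    proof eventually_elim
      case (elim y)
      then show ?case unfolding eq by (simp add: \<omega>_def)
    qed
  qed
  \<comment> \<open>\<open>p / q\<close> is the slope of the inverse of \<open>\<l>\<close>\<close>
  define p where "p = num K1 * den K2"
  define q where "q = num K2 * den K1"
  have "pts2.rep x2 (\<lambda>p. ev2 K1 (ev2 L1 (fst p) (snd p)) (ev2 L2 (fst p) (snd p)))"
    unfolding KL[symmetric] by (intro pts2.rep_rat_eval ring_map_const2 rep2_const rep2_self)
  note K1 = zariski2_slices(1)[OF pts2.rep_unique[OF this rep2_x]]
  have "pts2.rep y2 (\<lambda>p. ev2 K2 (ev2 L1 (fst p) (snd p)) (ev2 L2 (fst p) (snd p)))"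
    unfolding KL[symmetric] by (intro pts2.rep_rat_eval ring_map_const2 rep2_const rep2_self)
  note K2 = zariski2_slices(1)[OF pts2.rep_unique[OF this rep2_y]]
  have t0: "MOST t::real. t \<noteq> 0" by simp
  from K1 K2 \<omega> L12 t0
  have pq: "MOST t. (\<forall>Y. eval2 p (T t * Y) Y = t * eval2 q (T t * Y) Y) \<and>
      (\<exists>Y. eval2 q (T t * Y) Y \<noteq> 0)"
  proof eventually_elim
    case (elim t)
    have "MOST y::real. y \<noteq> 0" by simp
    with elim(1,2,4) have *: "MOST y. eval2 p (T t * (y * \<omega> t)) (y * \<omega> t) =
        t * eval2 q (T t * (y * \<omega> t)) (y * \<omega> t) \<and> eval2 q (T t * (y * \<omega> t)) (y * \<omega> t) \<noteq> 0"
    proof eventually_elim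
      case (elim y)
      let ?X = "T t * (y * \<omega> t)" and ?Y = "y * \<omega> t"
      have K: "ev2 K1 ?X ?Y = t * y" "ev2 K2 ?X ?Y = y" using elim by auto
      then have "eval2 (den K1) ?X ?Y \<noteq> 0" "eval2 (den K2) ?X ?Y \<noteq> 0" "eval2 (num K2) ?X ?Y \<noteq> 0"
        using \<open>y \<noteq> 0\<close> \<open>t \<noteq> 0\<close> by (auto simp: rat_eval_def)
      moreover from this K have "eval2 (num K1) ?X ?Y = t * y * eval2 (den K1) ?X ?Y"
        "eval2 (num K2) ?X ?Y = y * eval2 (den K2) ?X ?Y"
        by (simp_all add: rat_eval_def divide_eq_eq)
      ultimately show ?case by (simp add: p_def q_def eval2_mult)
    qed
    from MOST_real_ex[OF *] have "\<exists>Y. eval2 q (T t * Y) Y \<noteq> 0" by blast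
    moreover have "eval2 p (T t * (y * \<omega> t)) (y * \<omega> t) = t * eval2 q (T t * (y * \<omega> t)) (y * \<omega> t)" for y
      by (rule polyfun_eq[OF _ _ eventually_mono[OF *]]) (intro polyfun_intros | simp)+
    from this[of "Y / \<omega> t" for Y] have "\<forall>Y. eval2 p (T t * Y) Y = t * eval2 q (T t * Y) Y"
      using elim(3) by simp
    ultimately show ?case by blast
  qed
  have T: "MOST t. T t \<noteq> c" for c
  proof -
    have "Tn - smult c Td \<noteq> 0"
    proof
      assume "Tn - smult c Td = 0"
      then have Tn: "Tn = smult c Td" by simp
      have "MOST t. T t = c"
        using poly_MOST[OF Td0] by eventually_elim (simp add: T_def Tn)
      with pq have Tc: "MOST t. T t = c \<and> (\<forall>Y. eval2 p (c * Y) Y = t * eval2 q (c * Y) Y) \<and>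
          (\<exists>Y. eval2 q (c * Y) Y \<noteq> 0)"
        by eventually_elim auto
      then obtain t1 where t1: "\<And>Y. eval2 p (c * Y) Y = t1 * eval2 q (c * Y) Y"
        using MOST_real_ex by blast
      have "MOST t. t \<noteq> t1" by simp
      with Tc have "MOST t. t \<noteq> t1 \<and> (\<forall>Y. eval2 p (c * Y) Y = t * eval2 q (c * Y) Y) \<and>
          (\<exists>Y. eval2 q (c * Y) Y \<noteq> 0)"
        by eventually_elim auto
      from MOST_real_ex[OF this] obtain t2 Y where "t2 \<noteq> t1"
          "eval2 p (c * Y) Y = t2 * eval2 q (c * Y) Y" "eval2 q (c * Y) Y \<noteq> 0"
        by blast
      then show False using t1[of Y] by simp
    qed
    from poly_MOST[OF this] poly_MOST[OF Td0] show ?thesis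
      by eventually_elim (auto simp: T_def divide_eq_eq)
  qed
  have q0: "q \<noteq> 0" using MOST_real_ex[OF pq] by auto
  obtain c where c: "MOST \<theta>. eval2 q (\<theta> * c) c \<noteq> 0"
    using MOST_real_ex[OF eval2_slices(2)[OF q0]] by blast
  have "polyfun (\<lambda>\<theta>. eval2 p (\<theta> * c) c)" "polyfun (\<lambda>\<theta>. eval2 q (\<theta> * c) c)"
    by (intro polyfun_intros)+
  then obtain X Z where X: "\<And>\<theta>. poly X \<theta> = eval2 p (\<theta> * c) c"
    and Z: "\<And>\<theta>. poly Z \<theta> = eval2 q (\<theta> * c) c"
    unfolding polyfun_def by metis
  have Z0: "Z \<noteq> 0" using MOST_real_ex[OF c] Z by auto
  have XZ: "MOST t. poly X (T t) = t * poly Z (T t)"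
    using pq by eventually_elim (simp add: X Z)
  have indL: "independent const2 L1 L2"
    by (rule independent2_fibred[OF rep2_self rep2_self T \<omega>]) (use L12 in simp)
  note hom = rat_eval_hom[OF ring_map_const2]
  define G1 G2 where "G1 = L1 * ((L2 + 1) ^ N / (L2 + 1))" and "G2 = L2 / (L2 + 1)"
  have G: "rat_comp (phi_level N) (L1, L2) = (G1, G2)"
    unfolding rat_comp_def map_eval_def phi_level_eq using indL
    by (simp add: hom G1_def G2_def)
  have compose: "independent const2 (rat_eval const2 f a b) (rat_eval const2 g a b)"
    if ab: "independent const2 a b" and fg: "independent const2 f g" for a b f g
    unfolding independent_def
  proof (intro allI impI)
    fix d :: "real poly poly" assume "d \<noteq> 0"
    let ?\<sigma> = "\<lambda>f. rat_eval const2 f a b"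
    have \<sigma>: "ring_map ?\<sigma>" by (rule ring_map_rat_eval[OF ring_map_const2 ab])
    have "?\<sigma> e \<noteq> 0" if "e \<noteq> 0" for e
      using ring_map_mult[OF \<sigma>, of e "1 / e"] ring_map_1[OF \<sigma>] that by auto
    then have "?\<sigma> (bipoly const2 d f g) \<noteq> 0" using fg \<open>d \<noteq> 0\<close> unfolding independent_def by blast
    then show "bipoly const2 d (?\<sigma> f) (?\<sigma> g) \<noteq> 0"
      by (simp add: ring_map_bipoly_comp[OF \<sigma> ring_map_const2] hom)
  qed
  have indG: "independent const2 G1 G2"
    using compose[OF indL independent_phi_level[of N]] G by (simp add: rat_comp_def map_eval_def)
  have push: "rat_eval const2 (rat_eval const2 f g1 g2) a b =
      rat_eval const2 f (rat_eval const2 g1 a b) (rat_eval const2 g2 a b)"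
    if ab: "independent const2 a b" for f g1 g2 a b
  proof -
    have \<sigma>: "ring_map (\<lambda>f. rat_eval const2 f a b)" by (rule ring_map_rat_eval[OF ring_map_const2 ab])
    show ?thesis
      unfolding rat_eval_def[of const2 f]
      by (simp add: ring_map_divide[OF \<sigma>] ring_map_bipoly_comp[OF \<sigma> ring_map_const2] hom)
  qed
  have u: "u = rat_eval const2 K1 G1 G2" and v: "v = rat_eval const2 K2 G1 G2"
    using uv unfolding G by (simp_all add: rat_comp_def map_eval_def)
  \<comment> \<open>a relation between \<open>K1\<close> and \<open>K2\<close> would give one between \<open>x\<close> and \<open>y\<close>\<close>
  have indK: "independent const2 K1 K2"
    unfolding independent_def
  proof (intro allI impI notI)
    fix d :: "real poly poly" assume d: "d \<noteq> 0" "bipoly const2 d K1 K2 = 0"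
    have \<sigma>: "ring_map (\<lambda>f. rat_eval const2 f L1 L2)" by (rule ring_map_rat_eval[OF ring_map_const2 indL])
    have "bipoly const2 d x2 y2 = rat_eval const2 (bipoly const2 d K1 K2) L1 L2"
      by (simp add: ring_map_bipoly_comp[OF \<sigma> ring_map_const2] hom KL)
    then have "bipoly const2 d x2 y2 = 0" by (simp add: d ring_map_0[OF \<sigma>])
    moreover have "independent const2 x2 y2"
      by (rule independent2_fibred[OF rep2_x rep2_y, of "\<lambda>t. t" "\<lambda>t. 1"]) simp_all
    ultimately show False using d(1) unfolding independent_def by blast
  qed
  have induv: "independent const2 u v" unfolding u v by (rule compose[OF indG indK])
  \<comment> \<open>the conjugation in the form \<open>\<l> \<circ> \<phi> = \<phi>\<^sub>N \<circ> \<l>\<close>\<close>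
  have Luv: "rat_eval const2 L1 u v = G1" "rat_eval const2 L2 u v = G2"
    unfolding u v push[OF indG, symmetric] LK by (simp_all add: hom)
  have L21: "L2 + 1 \<noteq> 0"
  proof -
    have "bipoly const2 [:1, 1:] L1 L2 \<noteq> 0" using indL unfolding independent_def by simp
    moreover have "[:1, 1:] = 1 + [:0, 1::real poly:]" by (simp add: one_pCons)
    ultimately show ?thesis
      using bipoly_Y[OF ring_map_const2, of L1 L2]
      by (simp add: ring_map_simps[OF ring_map_bipoly[OF ring_map_const2]] add.commute del: add_pCons)
  qed
  have ratio: "L1 / L2 = pw Tn t / pw Td t"
  proof -
    have "L1 / L2 = (y2 * (pw n1 t / pw d1 t)) / (y2 * (pw n2 t / pw d2 t))"
      by (simp only: polar[OF L1, symmetric] polar[OF L2, symmetric])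
    also have "\<dots> = (pw n1 t * pw d2 t) / (pw d1 t * pw n2 t)"
      using y20 by simp
    finally show ?thesis
      unfolding Tn_def Td_def pw_def by (simp add: ring_map_mult[OF ring_map_poly[OF ring_map_const2]])
  qed
  have "G1 / G2 = L1 / L2 * (1 + L2) ^ N"
    unfolding G1_def G2_def add.commute[of L2] using L21 by (simp add: add.commute)
  moreover have "G1 / G2 = pw Tn (u / v) / pw Td (u / v)"
  proof -
    have "G1 / G2 = rat_eval const2 (L1 / L2) u v"
      using induv by (simp add: hom Luv)
    also have "\<dots> = pw Tn (u / v) / pw Td (u / v)"
      unfolding ratio using induv by (simp add: hom pw_def t_def)
    finally show ?thesis .
  qed
  ultimately have E: "pw Tn (u / v) / pw Td (u / v) = pw Tn t / pw Td t * (1 + y2 * (pw n2 t / pw d2 t)) ^ N"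
    unfolding ratio using polar[OF L2] by simp
  have "pts2.rep (pw Tn (u / v) / pw Td (u / v))
      (\<lambda>p. poly Tn (ev2 u (fst p) (snd p) / ev2 v (fst p) (snd p)) /
        poly Td (ev2 u (fst p) (snd p) / ev2 v (fst p) (snd p)))"
    by (intro pts2.rep_divide rep_pw rep2_self)
  moreover have "pts2.rep (pw Tn t / pw Td t * (1 + y2 * (pw n2 t / pw d2 t)) ^ N)
      (\<lambda>p. poly Tn (\<tau> p) / poly Td (\<tau> p) *
        (1 + snd p * (poly n2 (\<tau> p) / poly d2 (\<tau> p))) ^ N)"
    by (intro pts2.rep_mult pts2.rep_power pts2.rep_add pts2.rep_1 pts2.rep_divide rep_pw rep_t rep2_y)
  ultimately have "eventually (\<lambda>p. poly Tn (ev2 u (fst p) (snd p) / ev2 v (fst p) (snd p)) /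
        poly Td (ev2 u (fst p) (snd p) / ev2 v (fst p) (snd p)) =
      poly Tn (\<tau> p) / poly Td (\<tau> p) *
        (1 + snd p * (poly n2 (\<tau> p) / poly d2 (\<tau> p))) ^ N) pts2.zariski"
    unfolding E by (rule pts2.rep_unique)
  from zariski2_slices(1)[OF this] have "MOST t. MOST y. T (h t y) = T t * (1 + y * \<omega> t) ^ N"
  proof eventually_elim
    case (elim t)
    have "MOST y::real. y \<noteq> 0" by simp
    with elim show ?case by eventually_elim (simp add: \<tau>_def T_def h_def \<omega>_def)
  qed
  then show ?thesis
    using n2 d2 Z0 T XZ unfolding T_def \<omega>_def by blast
qed

lemma poly_of_fraction:
  fixes n X Z :: "real poly"
  shows "\<exists>H k. \<forall>x. poly Z x \<noteq> 0 \<longrightarrow> poly n (poly X x / poly Z x) = poly H x / poly Z x ^ k"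
proof (induction n)
  case 0
  show ?case by (rule exI[of _ 0]) simp
next
  case (pCons c n)
  then obtain H k where H: "\<And>x. poly Z x \<noteq> 0 \<Longrightarrow> poly n (poly X x / poly Z x) = poly H x / poly Z x ^ k"
    by blast
  show ?case
    by (rule exI[of _ "smult c (Z ^ Suc k) + X * H"], rule exI[of _ "Suc k"])
      (simp add: H add_divide_distrib)
qed

text \<open>
  By the left inverse of \<open>T\<close> the slope along an orbit is a rational function of the \<open>N\<close>-th power \<open>\<theta>\<close>
  of an affine function of the time. So the polynomial \<open>\<theta>'\<close>, which belongs to another level, is a rational
  function of \<open>\<theta>\<close>; its degree is then a multiple of that of \<open>\<theta>\<close>.
\<close>

lemma level_dvd:
  fixes h :: "real \<Rightarrow> real \<Rightarrow> real"
  assumes N: "N > 0"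
    and w: "wn \<noteq> 0" "wd \<noteq> 0" and Z: "Z \<noteq> 0" and T: "\<And>c. MOST t. poly Tn t / poly Td t \<noteq> c"
    and X: "MOST t. poly X (poly Tn t / poly Td t) = t * poly Z (poly Tn t / poly Td t)"
    and h: "MOST t. MOST y. poly Tn (h t y) / poly Td (h t y) =
      poly Tn t / poly Td t * (1 + y * (poly wn t / poly wd t)) ^ N"
    and w': "wn' \<noteq> 0" "wd' \<noteq> 0" and T': "\<And>c. MOST t. poly Tn' t / poly Td' t \<noteq> c"
    and h': "MOST t. MOST y. poly Tn' (h t y) / poly Td' (h t y) =
      poly Tn' t / poly Td' t * (1 + y * (poly wn' t / poly wd' t)) ^ N'"
  shows "N' > 0 \<and> N dvd N'"
proof -
  have "MOST t. poly Tn t / poly Td t \<noteq> 0" "MOST t. poly Tn' t / poly Td' t \<noteq> 0"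
    by (rule T T')+
  with h h' poly_MOST[OF w(1)] poly_MOST[OF w(2)] poly_MOST[OF w'(1)] poly_MOST[OF w'(2)]
  have "MOST t::real. N' > 0 \<and> N dvd N'"
  proof eventually_elim
    case (elim t)
    define a b where "a = poly Tn t / poly Td t" and "b = poly wn t / poly wd t"
    define a' b' where "a' = poly Tn' t / poly Td' t" and "b' = poly wn' t / poly wd' t"
    have nz: "a \<noteq> 0" "b \<noteq> 0" "a' \<noteq> 0" "b' \<noteq> 0"
      using elim by (auto simp: a_def b_def a'_def b'_def)
    define \<theta> where "\<theta> = smult a ([:1, b:] ^ N)"
    define \<theta>' where "\<theta>' = smult a' ([:1, b':] ^ N')"
    have deg: "degree \<theta> = N" "degree \<theta>' = N'"
      using nz by (simp_all add: \<theta>_def \<theta>'_def degree_power_eq)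
    have \<theta>: "MOST y. poly Tn (h t y) / poly Td (h t y) = poly \<theta> y"
      using elim(1) by eventually_elim (simp add: \<theta>_def a_def b_def)
    have \<theta>': "MOST y. poly Tn' (h t y) / poly Td' (h t y) = poly \<theta>' y"
      using elim(2) by eventually_elim (simp add: \<theta>'_def a'_def b'_def)
    have fin\<theta>: "MOST y. poly \<theta> y \<noteq> c" for c
    proof -
      have "\<theta> - [:c:] \<noteq> 0" using deg(1) N by auto
      from poly_MOST[OF this] show ?thesis by simp
    qed
    have fin: "MOST y. h t y \<noteq> c" for c
      using \<theta> fin\<theta>[of "poly Tn c / poly Td c"] by eventually_elim auto
    have "N' > 0"
    proof (rule ccontr)
      assume "\<not> N' > 0"
      then have \<theta>0: "\<And>y. poly \<theta>' y = a'" by (simp add: \<theta>'_def)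
      have "MOST y::real. False"
        using \<theta>' MOST_compose[OF fin T'[of a']] by eventually_elim (simp add: \<theta>0)
      then show False by (simp add: infinite_UNIV_char_0)
    qed
    have hm: "MOST y. poly Z (poly \<theta> y) \<noteq> 0 \<and> h t y = poly X (poly \<theta> y) / poly Z (poly \<theta> y)"
      using \<theta> MOST_compose[OF fin X] MOST_compose[OF fin\<theta> poly_MOST[OF Z]]
      by eventually_elim (simp add: eq_divide_eq)
    obtain Hn k where Hn: "\<And>x. poly Z x \<noteq> 0 \<Longrightarrow> poly Tn' (poly X x / poly Z x) = poly Hn x / poly Z x ^ k"
      using poly_of_fraction by blast
    obtain Hd l where Hd: "\<And>x. poly Z x \<noteq> 0 \<Longrightarrow> poly Td' (poly X x / poly Z x) = poly Hd x / poly Z x ^ l"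
      using poly_of_fraction by blast
    define A B where "A = Hn * Z ^ l" and "B = Hd * Z ^ k"
    have \<theta>'0: "\<theta>' \<noteq> 0" and \<theta>0: "degree \<theta> > 0" using nz N deg by (auto simp: \<theta>'_def)
    have eq: "MOST y. poly \<theta>' y * poly (B \<circ>\<^sub>p \<theta>) y = poly (A \<circ>\<^sub>p \<theta>) y \<and>
        poly (B \<circ>\<^sub>p \<theta>) y \<noteq> 0"
      using \<theta>' hm poly_MOST[OF \<theta>'0]
    proof eventually_elim
      case (elim y)
      define x where "x = poly \<theta> y"
      have zx: "poly Z x \<noteq> 0" using elim by (simp add: x_def)
      have *: "poly \<theta>' y = (poly Hn x / poly Z x ^ k) / (poly Hd x / poly Z x ^ l)"
        using elim Hn[OF zx] Hd[OF zx] by (simp add: x_def)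
      then have "poly Hd x \<noteq> 0" using elim by auto
      with * zx show ?case
        by (simp add: poly_pcompose A_def B_def x_def[symmetric] field_simps)
    qed
    then have e: "\<theta>' * (B \<circ>\<^sub>p \<theta>) = A \<circ>\<^sub>p \<theta>"
      by (intro poly_eq_MOST) (auto elim: eventually_mono)
    have B0: "B \<circ>\<^sub>p \<theta> \<noteq> 0" using MOST_real_ex[OF eq] by auto
    have "N' + degree B * N = degree A * N"
      using arg_cong[OF e, of degree] \<theta>'0 B0 by (simp add: degree_mult_eq degree_pcompose deg)
    then have "N dvd N'" by (metis dvd_add_left_iff dvd_triv_right)
    with \<open>N' > 0\<close> show ?case by simp
  qed
  then show ?thesis using MOST_real_ex by blast
qed

theorem level_unique:
  assumes "has_level (u, v) N" "has_level (u, v) N'"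
  shows "N = N'"
proof -
  obtain Tn Td wn wd X Z where 1: "wn \<noteq> 0" "wd \<noteq> 0" "Z \<noteq> 0" "\<And>c. MOST t. poly Tn t / poly Td t \<noteq> c"
    "MOST t. poly X (poly Tn t / poly Td t) = t * poly Z (poly Tn t / poly Td t)"
    "MOST t. MOST y. poly Tn (ev2 u (t * y) y / ev2 v (t * y) y) / poly Td (ev2 u (t * y) y / ev2 v (t * y) y) =
      poly Tn t / poly Td t * (1 + y * (poly wn t / poly wd t)) ^ N"
    using level_data[OF assms(1)] by blast
  obtain Tn' Td' wn' wd' X' Z' where 2: "wn' \<noteq> 0" "wd' \<noteq> 0" "Z' \<noteq> 0" "\<And>c. MOST t. poly Tn' t / poly Td' t \<noteq> c"
    "MOST t. poly X' (poly Tn' t / poly Td' t) = t * poly Z' (poly Tn' t / poly Td' t)"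
    "MOST t. MOST y. poly Tn' (ev2 u (t * y) y / ev2 v (t * y) y) / poly Td' (ev2 u (t * y) y / ev2 v (t * y) y) =
      poly Tn' t / poly Td' t * (1 + y * (poly wn' t / poly wd' t)) ^ N'"
    using level_data[OF assms(2)] by blast
  have "N' > 0 \<and> N dvd N'" if "N > 0"
    by (rule level_dvd[OF that 1 2(1,2,4,6)])
  moreover have "N > 0 \<and> N' dvd N" if "N' > 0"
    by (rule level_dvd[OF that 2 1(1,2,4,6)])
  ultimately show ?thesis by (metis dvd_antisym gr0I)
qed

theorem mainTheorem1:
  fixes u v :: rat2
  assumes "translation_equation (u, v)"
    and "boundary_condition (u, v)"
    and "(u, v) \<noteq> (x2, y2)"
  shows "\<exists>!N. has_level (u, v) N"
  using level_exists[OF assms] level_unique by blast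

end
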